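(* Let $-A$ be the generator of a uniformly bounded cosine function $\mathrm{Cos}$ on a Banach space $X$. Let $\phi\in(0,\pi)$ and $f\in H^\infty_0(S_\phi)$. Then (the restriction to $\mathbb{R}_+$ of) $f$ belongs to $\mathcal{E}(\mathbb{R}_+)$ and $\Phi(f)=\Psi(f)$.
   Context: A cosine function on a complex Banach space $X$ is a strongly continuous map $\mathrm{Cos}:\mathbb{R}\to\mathcal{L}(X)$ with $\mathrm{Cos}(0)=I$ and $\mathrm{Cos}(t+s)+\mathrm{Cos}(t-s)=2\,\mathrm{Cos}(t)\mathrm{Cos}(s)$ for all $t,s\in\mathbb{R}$; it is bounded if $\sup_t\|\mathrm{Cos}(t)\|<\infty$. That $-A$ generates the bounded cosine function $\mathrm{Cos}$ means $\lambda R(\lambda^2,-A)x=\int_0^\infty e^{-\lambda t}\mathrm{Cos}(t)x\,dt$ for all $\lambda>0$, $x\in X$, where $R(\mu,C)=(\mu-C)^{-1}$. The calculus $\Phi$: $\mathbb{R}_+=[0,\infty)$; $\mathbf{M}(\mathbb{R})$ is the space of complex regular Borel measures on $\mathbb{R}$. For $\mu\in\mathbf{M}(\mathbb{R})$ put $T_\mu x=\int_{\mathbb{R}}\mathrm{Cos}(s)x\,\mu(ds)$ and let the cosine transform be $(\mathcal{C}\mu)(t)=\int_{\mathbb{R}}\cos(st)\,\mu(ds)$ for $t\in\mathbb{R}$. This is an even function, and functions on $\mathbb{R}_+$ are identified with their even extensions to $\mathbb{R}$. Put $\mathcal{E}(\mathbb{R}_+)=\{\mathcal{C}\mu:\mu\in\mathbf{M}(\mathbb{R})\}$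 and, for $f=\mathcal{C}\mu\in\mathcal{E}(\mathbb{R}_+)$, $\Phi(f):=T_\mu\in\mathcal{L}(X)$ (well defined, i.e. depends only on $f$). The calculus $\Psi$: $S_\phi=\{z\ne0:|\arg z|<\phi\}$ for $\phi\in(0,\pi]$, and $H^\infty_0(S_\phi)$ is the set of bounded holomorphic functions $f$ on $S_\phi$ for which there exist $M,s>0$ with $|f(z)|\le M\min(|z|^s,|z|^{-s})$ for all $z\in S_\phi$. Functions in $H^\infty_0(S_\phi)$ are identified with their restrictions to $\mathbb{R}_+$ (with value $0$ at $0$). The operator $A$ is sectorial of angle $0$, $A^{1/2}$ denotes its square root in the sense of fractional powers of sectorial operators (the unique sectorial operator $C$ of angle $<\pi/2$ with $C^2=A$), and it is again sectorial of angle $0$. For $f\in H^\infty_0(S_\phi)$, $\Psi(f)=\frac{1}{2\pi i}\int_\Gamma f(z)R(z,A^{1/2})\,dz$, where $\Gamma=\partial S_{\phi'}$ with arbitrary $0<\phi'<\phi$, oriented positively with respect to the sector (from $\infty e^{i\phi'}$ to $0$ to $\infty e^{-i\phi'}$). An operator $C$ is sectorial of angle $\omega\in[0,\pi)$ if $\sigma(C)\subset\overline{S_\omega}$ (with $S_0=(0,\infty)$) and $\sup\{\|\lambda R(\lambda,C)\|:\lambda\notin\overline{S_{\omega'}}\}<\infty$ for every $\omega'\in(\omega,\pi)$. *)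

theory Defs
  imports "HOL-Complex_Analysis.Complex_Analysis"
begin

class complex_banach = banach +
  fixes scaleC :: "complex \<Rightarrow> 'a \<Rightarrow> 'a"  (infixr "*\<^sub>C" 75)
  assumes scaleC_add_right: "c *\<^sub>C (x + y) = c *\<^sub>C x + c *\<^sub>C y"
    and scaleC_add_left: "(c + d) *\<^sub>C x = c *\<^sub>C x + d *\<^sub>C x"
    and scaleC_scaleC: "c *\<^sub>C d *\<^sub>C x = (c * d) *\<^sub>C x"
    and scaleR_scaleC: "r *\<^sub>R x = complex_of_real r *\<^sub>C x"
    and norm_scaleC: "norm (c *\<^sub>C x) = cmod c * norm x"

instantiation complex :: complex_banach
begin

definition scaleC_complex :: "complex \<Rightarrow> complex \<Rightarrow> complex"
  where "scaleC_complex c x = c * x"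

instance
  by standard (auto simp: scaleC_complex_def algebra_simps norm_mult scaleR_conv_of_real)

end

lemma bounded_linear_scaleC_right:
  "bounded_linear (\<lambda>x::'a::complex_banach. c *\<^sub>C x)"
proof (rule bounded_linear_intro[where K = "cmod c"])
  fix x y :: 'a and r :: real
  show "c *\<^sub>C (x + y) = c *\<^sub>C x + c *\<^sub>C y" by (rule scaleC_add_right)
  show "c *\<^sub>C (r *\<^sub>R x) = r *\<^sub>R (c *\<^sub>C x)"
    by (simp add: scaleR_scaleC scaleC_scaleC mult.commute)
  show "norm (c *\<^sub>C x) \<le> norm x * cmod c"
    by (simp add: norm_scaleC mult.commute)
qed

instantiation blinfun :: (real_normed_vector, complex_banach) complex_banach
begin

definition scaleC_blinfun :: "complex \<Rightarrow> ('a \<Rightarrow>\<^sub>L 'b) \<Rightarrow> ('a \<Rightarrow>\<^sub>L 'b)"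
  where "scaleC_blinfun c T = Blinfun (\<lambda>x. c *\<^sub>C blinfun_apply T x)"

lemma blinfun_apply_scaleC: "blinfun_apply (c *\<^sub>C T) x = c *\<^sub>C blinfun_apply T x"
  for T :: "'a \<Rightarrow>\<^sub>L 'b"
  unfolding scaleC_blinfun_def
  by (subst bounded_linear_Blinfun_apply)
    (auto intro: bounded_linear_compose[OF bounded_linear_scaleC_right blinfun.bounded_linear_right])

lemma norm_scaleC_blinfun_le: "norm (c *\<^sub>C T) \<le> cmod c * norm T"
  for T :: "'a \<Rightarrow>\<^sub>L 'b"
proof (rule norm_blinfun_bound)
  fix x
  have "cmod c * norm (blinfun_apply T x) \<le> cmod c * (norm T * norm x)"
    by (intro mult_left_mono norm_blinfun) auto
  then show "norm (blinfun_apply (c *\<^sub>C T) x) \<le> cmod c * norm T * norm x"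
    by (simp add: blinfun_apply_scaleC norm_scaleC mult.assoc)
qed auto

instance
proof
  fix c d :: complex and r :: real and S T :: "'a \<Rightarrow>\<^sub>L 'b"
  show "c *\<^sub>C (S + T) = c *\<^sub>C S + c *\<^sub>C T"
    by (rule blinfun_eqI) (simp add: blinfun_apply_scaleC plus_blinfun.rep_eq scaleC_add_right)
  show "(c + d) *\<^sub>C T = c *\<^sub>C T + d *\<^sub>C T"
    by (rule blinfun_eqI) (simp add: blinfun_apply_scaleC plus_blinfun.rep_eq scaleC_add_left)
  show assoc: "c *\<^sub>C d *\<^sub>C T = (c * d) *\<^sub>C T" for c d
    by (rule blinfun_eqI) (simp add: blinfun_apply_scaleC scaleC_scaleC)
  show scaleR: "r *\<^sub>R T = complex_of_real r *\<^sub>C T" for r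
    by (rule blinfun_eqI) (simp add: blinfun_apply_scaleC scaleR_blinfun.rep_eq scaleR_scaleC)
  show "norm (c *\<^sub>C T) = cmod c * norm T"
  proof (cases "c = 0")
    case True
    then show ?thesis using norm_scaleC_blinfun_le[of 0 T] by simp
  next
    case False
    have "T = inverse c *\<^sub>C (c *\<^sub>C T)"
      using False assoc scaleR[of 1] by simp
    then have "norm T \<le> cmod (inverse c) * norm (c *\<^sub>C T)"
      using norm_scaleC_blinfun_le[of "inverse c" "c *\<^sub>C T"] by simp
    then have "cmod c * norm T \<le> norm (c *\<^sub>C T)"
      using False by (simp add: norm_divide norm_inverse field_simps)
    then show ?thesis using norm_scaleC_blinfun_le[of c T] by simp
  qed
qed

end

text \<open>
  The library type of bounded operators consists of the real-linear ones; \<open>\<L>(X)\<close> is its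
  subspace of complex-linear elements.
\<close>

definition complex_linear :: "('a::complex_banach \<Rightarrow>\<^sub>L 'a) \<Rightarrow> bool"
  where "complex_linear T \<longleftrightarrow> (\<forall>c x. blinfun_apply T (c *\<^sub>C x) = c *\<^sub>C blinfun_apply T x)"

text \<open>An operator is identified with its graph.\<close>

type_synonym 'a operator = "('a \<times> 'a) set"

definition linear_operator :: "'a::complex_banach operator \<Rightarrow> bool"
  where "linear_operator C \<longleftrightarrow> single_valued C \<and> (0, 0) \<in> C
    \<and> (\<forall>x y u v. (x, y) \<in> C \<longrightarrow> (u, v) \<in> C \<longrightarrow> (x + u, y + v) \<in> C)
    \<and> (\<forall>c x y. (x, y) \<in> C \<longrightarrow> (c *\<^sub>C x, c *\<^sub>C y) \<in> C)"

definition neg_op :: "'a::complex_banach operator \<Rightarrow> 'a operator"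
  where "neg_op C = {(x, - y) |x y. (x, y) \<in> C}"

definition shift_op :: "complex \<Rightarrow> 'a::complex_banach operator \<Rightarrow> 'a operator"
  where "shift_op z C = {(x, z *\<^sub>C x - y) |x y. (x, y) \<in> C}"

definition blinfun_graph :: "('a::complex_banach \<Rightarrow>\<^sub>L 'a) \<Rightarrow> 'a operator"
  where "blinfun_graph T = {(x, blinfun_apply T x) |x. True}"

text \<open>For a linear operator \<open>C\<close>, a bounded inverse of \<open>z - C\<close> is automatically complex-linear.\<close>

definition resolvent_set :: "'a::complex_banach operator \<Rightarrow> complex set"
  where "resolvent_set C = {z. \<exists>R. (shift_op z C)\<inverse> = blinfun_graph R}"

definition spectrum :: "'a::complex_banach operator \<Rightarrow> complex set"
  where "spectrum C = - resolvent_set C"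

definition resolvent :: "complex \<Rightarrow> 'a::complex_banach operator \<Rightarrow> ('a \<Rightarrow>\<^sub>L 'a)"
  where "resolvent z C = (THE R. (shift_op z C)\<inverse> = blinfun_graph R)"

definition sector :: "real \<Rightarrow> complex set"
  where "sector \<phi> = (if \<phi> = 0 then {complex_of_real r |r. r > 0}
    else {z. z \<noteq> 0 \<and> \<bar>Arg z\<bar> < \<phi>})"

definition sectorial :: "real \<Rightarrow> 'a::complex_banach operator \<Rightarrow> bool"
  where "sectorial \<omega> C \<longleftrightarrow> linear_operator C \<and> 0 \<le> \<omega> \<and> \<omega> < pi
    \<and> spectrum C \<subseteq> closure (sector \<omega>)
    \<and> (\<forall>\<omega>'. \<omega> < \<omega>' \<and> \<omega>' < pi \<longrightarrow>
          bounded {z *\<^sub>C resolvent z C |z. z \<notin> closure (sector \<omega>')})"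

definition sqrt_op :: "'a::complex_banach operator \<Rightarrow> 'a operator"
  where "sqrt_op A = (THE C. (\<exists>\<omega> < pi / 2. sectorial \<omega> C) \<and> C O C = A)"

definition cosine_function :: "(real \<Rightarrow> 'a::complex_banach \<Rightarrow>\<^sub>L 'a) \<Rightarrow> bool"
  where "cosine_function Cos \<longleftrightarrow>
      (\<forall>t. complex_linear (Cos t))
    \<and> (\<forall>x. continuous_on UNIV (\<lambda>t. blinfun_apply (Cos t) x))
    \<and> Cos 0 = id_blinfun
    \<and> (\<forall>t s. Cos (t + s) + Cos (t - s) = 2 *\<^sub>R (Cos t o\<^sub>L Cos s))"

text \<open>
  The library's Bochner integral is only available for separable spaces. The integrands in
  integrals with respect to Lebesgue measure below are continuous with integrable norm, so the
  Henstock-Kurzweil integral, which needs no separability, gives the same value.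
\<close>

definition generates_cosine ::
  "'a::complex_banach operator \<Rightarrow> (real \<Rightarrow> 'a \<Rightarrow>\<^sub>L 'a) \<Rightarrow> bool"
  where "generates_cosine G Cos \<longleftrightarrow> linear_operator G \<and>
    (\<forall>l::real. l > 0 \<longrightarrow> complex_of_real (l\<^sup>2) \<in> resolvent_set G \<and>
      (\<forall>x. ((\<lambda>t. exp (- l * t) *\<^sub>R blinfun_apply (Cos t) x) has_integral
              l *\<^sub>R blinfun_apply (resolvent (complex_of_real (l\<^sup>2)) G) x) {0..}))"

text \<open>
  A complex measure is a set function that is countably additive on the Borel sets; its values on
  other sets are irrelevant. Regularity is automatic on \<open>\<real>\<close>.
\<close>

definition complex_measure :: "(real set \<Rightarrow> complex) \<Rightarrow> bool"
  where "complex_measure \<mu> \<longleftrightarrow>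
    (\<forall>E::nat \<Rightarrow> real set. range E \<subseteq> sets borel \<longrightarrow> disjoint_family E \<longrightarrow>
      (\<lambda>n. \<mu> (E n)) sums \<mu> (\<Union>n. E n))"

text \<open>Finite partitions give the same supremum as countable ones.\<close>

definition total_variation :: "(real set \<Rightarrow> complex) \<Rightarrow> real measure"
  where "total_variation \<mu> = measure_of UNIV (sets borel)
    (\<lambda>B. SUP P \<in> {P. finite P \<and> P \<subseteq> sets borel \<and> disjoint P \<and> \<Union>P = B}.
       \<Sum>E\<in>P. ennreal (cmod (\<mu> E)))"

definition simple_cintegral ::
  "(real set \<Rightarrow> complex) \<Rightarrow> (real \<Rightarrow> 'a::complex_banach) \<Rightarrow> 'a"
  where "simple_cintegral \<mu> s = (\<Sum>y\<in>range s. \<mu> (s -` {y}) *\<^sub>C y)"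

text \<open>
  Bochner integrability, as in the library's \<open>has_bochner_integral\<close>: approximation by simple
  functions in \<open>L\<^sup>1(\<bar>\<mu>\<bar>)\<close>. No separability of the codomain is needed.
\<close>

definition has_cintegral ::
  "(real set \<Rightarrow> complex) \<Rightarrow> (real \<Rightarrow> 'a::complex_banach) \<Rightarrow> 'a \<Rightarrow> bool"
  where "has_cintegral \<mu> g y \<longleftrightarrow> g \<in> borel_measurable borel \<and>
    (\<exists>s::nat \<Rightarrow> real \<Rightarrow> 'a. (\<forall>n. simple_function borel (s n)) \<and>
      (\<lambda>n. \<integral>\<^sup>+ t. ennreal (norm (g t - s n t)) \<partial>total_variation \<mu>) \<longlonglongrightarrow> 0 \<and>
      (\<lambda>n. simple_cintegral \<mu> (s n)) \<longlonglongrightarrow> y)"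

definition cintegral ::
  "(real set \<Rightarrow> complex) \<Rightarrow> (real \<Rightarrow> 'a::complex_banach) \<Rightarrow> 'a"
  where "cintegral \<mu> g = (THE y. has_cintegral \<mu> g y)"

definition T_op ::
  "(real \<Rightarrow> 'a::complex_banach \<Rightarrow>\<^sub>L 'a) \<Rightarrow> (real set \<Rightarrow> complex) \<Rightarrow> ('a \<Rightarrow>\<^sub>L 'a)"
  where "T_op Cos \<mu> = Blinfun (\<lambda>x. cintegral \<mu> (\<lambda>s. blinfun_apply (Cos s) x))"

definition cosine_transform :: "(real set \<Rightarrow> complex) \<Rightarrow> real \<Rightarrow> complex"
  where "cosine_transform \<mu> t = cintegral \<mu> (\<lambda>s. complex_of_real (cos (s * t)))"

text \<open>Functions on \<open>[0, \<infinity>)\<close> are represented by their even extensions to \<open>\<real>\<close>.\<close>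

definition E_space :: "(real \<Rightarrow> complex) set"
  where "E_space = {cosine_transform \<mu> |\<mu>. complex_measure \<mu>}"

definition Phi ::
  "(real \<Rightarrow> 'a::complex_banach \<Rightarrow>\<^sub>L 'a) \<Rightarrow> (real \<Rightarrow> complex) \<Rightarrow> ('a \<Rightarrow>\<^sub>L 'a)"
  where "Phi Cos g =
    (THE T. \<exists>\<mu>. complex_measure \<mu> \<and> cosine_transform \<mu> = g \<and> T = T_op Cos \<mu>)"

definition H_inf_0 :: "real \<Rightarrow> (complex \<Rightarrow> complex) set"
  where "H_inf_0 \<phi> = {f. f holomorphic_on sector \<phi> \<and> bounded (f ` sector \<phi>) \<and>
    (\<exists>M s. M > 0 \<and> s > 0 \<and>
      (\<forall>z\<in>sector \<phi>. cmod (f z) \<le> M * min (cmod z powr s) (cmod z powr (- s))))}"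

definition restrict_Rplus :: "(complex \<Rightarrow> complex) \<Rightarrow> real \<Rightarrow> complex"
  where "restrict_Rplus f t = (if t = 0 then 0 else f (complex_of_real \<bar>t\<bar>))"

text \<open>
  The integral along the boundary of the sector of half-angle \<open>\<theta>\<close>, coming in from
  \<open>\<infinity> e\<^sup>i\<^sup>\<theta>\<close> along the upper ray and going out to \<open>\<infinity> e\<^sup>-\<^sup>i\<^sup>\<theta>\<close> along the lower ray.
\<close>

definition sector_boundary_integral :: "real \<Rightarrow> (complex \<Rightarrow> 'b::complex_banach) \<Rightarrow> 'b"
  where "sector_boundary_integral \<theta> g =
      integral {0<..} (\<lambda>r. cis (- \<theta>) *\<^sub>C g (complex_of_real r * cis (- \<theta>)))
    - integral {0<..} (\<lambda>r. cis \<theta> *\<^sub>C g (complex_of_real r * cis \<theta>))"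

text \<open>
  The half-angle \<open>\<theta>\<close> of the contour is kept as an argument; for \<open>f\<close> in \<open>H_inf_0 \<phi>\<close> the value is
  the same for all \<open>\<theta>\<close> between \<open>0\<close> and \<open>\<phi>\<close>.
\<close>

definition Psi ::
  "'a::complex_banach operator \<Rightarrow> real \<Rightarrow> (complex \<Rightarrow> complex) \<Rightarrow> ('a \<Rightarrow>\<^sub>L 'a)"
  where "Psi A \<theta> f = (1 / (2 * complex_of_real pi * \<i>)) *\<^sub>C
    sector_boundary_integral \<theta> (\<lambda>z. f z *\<^sub>C resolvent z (sqrt_op A))"

end

theory Submission
  imports Defs "HOL-Probability.Probability" "HOL-Real_Asymp.Real_Asymp"
begin

text \<open>
  Write \<open>c(s) = \<psi>(Cos(s)x)\<close> for a vector \<open>x\<close> and a bounded complex-linear functional \<open>\<psi>\<close>. This is an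
  even bounded continuous scalar function, and since functionals separate points (a small
  Hahn-Banach theorem, \<open>cfunctionals_separate_points\<close>) every operator identity below is reduced to
  an identity between scalar integrals of such functions, where Fubini's theorem and Cauchy's
  theorem are at hand.

  The calculus \<open>\<Phi>\<close>. A complex measure has finite total variation, so that \<open>T_op Cos \<mu>\<close> is a
  bounded operator. It depends on the values of \<open>\<mu>\<close> on symmetric sets only, because \<open>Cos\<close> is even,
  and these values are determined by the cosine transform of \<open>\<mu>\<close> by Levy's uniqueness theorem
  (\<open>cosine_transform_determines_symmetric_part\<close>). Hence \<open>\<Phi>\<close> is well defined. By d'Alembert's
  equation it is multiplicative on transforms of even integrable densities (\<open>Phi_mult\<close>). So algebraic
  identities between functions of \<open>|t|\<close> become identities between operators.

  The square root. The functions \<open>1/(u\<^sup>2 + t\<^sup>2)\<close> for \<open>Re u > 0\<close> and \<open>1/(l + |t|)\<close> for \<open>l > 0\<close> have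
  explicit integrable kernels, and all \<open>1/(z - |t|)\<close> with \<open>z\<close> off the half-line \<open>[0,\<infinity>)\<close> are algebraic
  combinations of them. The operators \<open>R z = \<Phi>(1/(z - |t|))\<close> therefore satisfy the resolvent
  identity, and they are the resolvents of an operator whose square is \<open>A\<close> and which is sectorial
  of angle \<open>0\<close>. It is the only sectorial root of angle below \<open>\<pi>/2\<close>: if \<open>C\<close> is such a root, then
  \<open>R(z,C) - R(-z,C) = 2z R(z\<^sup>2,A)\<close>, so the difference \<open>G\<close> of the resolvents of two roots is even and
  extends to the punctured plane with \<open>zG(z)\<close> bounded. By Liouville's theorem \<open>zG(z)\<close> is constant,
  and being odd it vanishes (\<open>square_root_unique\<close>). Thus \<open>R(z, \<surd>A) = \<Phi>(1/(z - |t|))\<close>.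

  Comparison. For \<open>t > 0\<close>, Cauchy's formula on the boundary of a sector gives
  \<open>f(t) = (1/2\<pi>i) \<integral> f(z)/(z - t) dz\<close> (\<open>sector_Cauchy\<close>). If \<open>g\<close> is the kernel of \<open>1/(e - |t|)\<close> with
  \<open>|e| = 1\<close>, then \<open>s \<mapsto> g(rs)\<close> is the kernel of \<open>1/(re - |t|)\<close> and has norm \<open>\<parallel>g\<parallel>/r\<close>. Since
  \<open>\<integral> |f(re)| dr/r\<close> is finite, the kernels can be superposed along the two rays: the result is an
  integrable density with cosine transform \<open>f\<close>, and by Fubini its operator is the
  Dunford integral \<open>\<Psi>(f)\<close>.
\<close>

section \<open>Norming functionals\<close>

definition sublinear :: "('a::real_vector \<Rightarrow> real) \<Rightarrow> bool"
  where "sublinear p \<longleftrightarrow> (\<forall>x y. p (x + y) \<le> p x + p y) \<and> (\<forall>a x. a \<ge> 0 \<longrightarrow> p (a *\<^sub>R x) = a * p x)"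

lemma sublinearD:
  assumes "sublinear p"
  shows "p (x + y) \<le> p x + p y" "a \<ge> 0 \<Longrightarrow> p (a *\<^sub>R x) = a * p x" "p 0 = 0" "- p (- x) \<le> p x"
proof -
  show 1: "p (x + y) \<le> p x + p y" for x y using assms by (simp add: sublinear_def)
  show 2: "a \<ge> 0 \<Longrightarrow> p (a *\<^sub>R x) = a * p x" using assms by (simp add: sublinear_def)
  show 3: "p 0 = 0" using assms unfolding sublinear_def by (metis mult_zero_left order_refl scaleR_zero_left)
  show "- p (- x) \<le> p x" using 1[of x "-x"] 3 by simp
qed

lemma sublinear_norm: "sublinear norm"
  by (simp add: sublinear_def norm_triangle_ineq)

text \<open>
  The largest sublinear functional below \<open>p\<close> whose value at \<open>- y\<close> is at most \<open>- p y\<close>.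
\<close>
definition tilt :: "('a::real_vector \<Rightarrow> real) \<Rightarrow> 'a \<Rightarrow> 'a \<Rightarrow> real"
  where "tilt p y x = (INF t\<in>{0..}. p (x + t *\<^sub>R y) - t * p y)"

lemma tilt_bdd_below:
  assumes "sublinear p"
  shows "bdd_below ((\<lambda>t. p (x + t *\<^sub>R y) - t * p y) ` {0..})"
proof (rule bdd_belowI2)
  fix t :: real assume "t \<in> {0..}"
  then have "t * p y = p (t *\<^sub>R y)" using sublinearD(2)[OF assms] by simp
  also have "\<dots> \<le> p (x + t *\<^sub>R y) + p (- x)"
    using sublinearD(1)[OF assms, of "x + t *\<^sub>R y" "- x"] by simp
  finally show "- p (- x) \<le> p (x + t *\<^sub>R y) - t * p y" by simp
qed

lemma tilt_le:
  assumes "sublinear p" "t \<ge> 0"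
  shows "tilt p y x \<le> p (x + t *\<^sub>R y) - t * p y"
  unfolding tilt_def by (rule cINF_lower[OF tilt_bdd_below[OF assms(1)]]) (use assms in auto)

lemma tilt_le_self: "sublinear p \<Longrightarrow> tilt p y x \<le> p x"
  using tilt_le[of p 0 y x] by simp

lemma sublinear_tilt:
  assumes p: "sublinear p"
  shows "sublinear (tilt p y)"
  unfolding sublinear_def
proof (intro conjI allI impI)
  fix x z
  have "tilt p y (x + z) - (p (x + t *\<^sub>R y) - t * p y) \<le> tilt p y z" if t: "t \<ge> 0" for t
    unfolding tilt_def[of p y z]
  proof (rule cINF_greatest)
    fix s :: real assume s: "s \<in> {0..}"
    have "tilt p y (x + z) \<le> p ((x + z) + (t + s) *\<^sub>R y) - (t + s) * p y"
      by (rule tilt_le[OF p]) (use t s in auto)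
    also have "(x + z) + (t + s) *\<^sub>R y = (x + t *\<^sub>R y) + (z + s *\<^sub>R y)"
      by (simp add: algebra_simps)
    also have "p \<dots> \<le> p (x + t *\<^sub>R y) + p (z + s *\<^sub>R y)" by (rule sublinearD[OF p])
    finally show "tilt p y (x + z) - (p (x + t *\<^sub>R y) - t * p y) \<le> p (z + s *\<^sub>R y) - s * p y"
      by (simp add: algebra_simps)
  qed auto
  then have "tilt p y (x + z) - tilt p y z \<le> tilt p y x"
    unfolding tilt_def[of p y x] by (intro cINF_greatest) (auto simp: algebra_simps)
  then show "tilt p y (x + z) \<le> tilt p y x + tilt p y z" by simp
next
  fix a :: real and x assume a: "0 \<le> a"
  have le: "tilt p y (b *\<^sub>R x) \<le> b * tilt p y x" if b: "b > 0" for b x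
  proof -
    have "tilt p y (b *\<^sub>R x) / b \<le> tilt p y x"
      unfolding tilt_def[of p y x]
    proof (rule cINF_greatest)
      fix t :: real assume t: "t \<in> {0..}"
      have "tilt p y (b *\<^sub>R x) \<le> p (b *\<^sub>R x + (b * t) *\<^sub>R y) - (b * t) * p y"
        by (rule tilt_le[OF p]) (use t b in auto)
      also have "b *\<^sub>R x + (b * t) *\<^sub>R y = b *\<^sub>R (x + t *\<^sub>R y)" by (simp add: scaleR_add_right)
      also have "p \<dots> = b * p (x + t *\<^sub>R y)" using sublinearD(2)[OF p] b by simp
      finally show "tilt p y (b *\<^sub>R x) / b \<le> p (x + t *\<^sub>R y) - t * p y"
        using b by (simp add: field_simps)
    qed auto
    then show ?thesis using b by (simp add: field_simps)
  qed
  show "tilt p y (a *\<^sub>R x) = a * tilt p y x"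
  proof (cases "a = 0")
    case True
    have "(\<lambda>t. p (0 + t *\<^sub>R y) - t * p y) ` {0..} = {0}"
      using sublinearD(2)[OF p] by (auto simp: image_iff intro!: exI[of _ 0])
    then have "tilt p y 0 = 0" unfolding tilt_def by simp
    then show ?thesis using True by simp
  next
    case False
    then have a: "a > 0" using a by simp
    have "tilt p y x = tilt p y (inverse a *\<^sub>R (a *\<^sub>R x))" using a by simp
    also have "\<dots> \<le> inverse a * tilt p y (a *\<^sub>R x)" by (rule le) (use a in simp)
    finally show ?thesis using le[OF a, of x] a by (simp add: field_simps)
  qed
qed

text \<open>
  The tilted functional lies below \<open>p\<close>, hence equals \<open>p\<close> by minimality, and tilting by one step says
  \<open>p x + p y \<le> p (x + y)\<close>.
\<close>
lemma minimal_sublinear_additive: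
  assumes p: "sublinear p" and min: "\<And>q. sublinear q \<Longrightarrow> q \<le> p \<Longrightarrow> q = p"
  shows "p (x + y) = p x + p y"
proof -
  have "tilt p y = p"
    using min[OF sublinear_tilt[OF p, of y]] tilt_le_self[OF p, of y] by (auto simp: le_fun_def)
  then have "p x \<le> p (x + y) - p y" using tilt_le[OF p, of 1 y x] by simp
  with sublinearD(1)[OF p, of x y] show ?thesis by simp
qed

text \<open>
  For two members of a chain the smaller one bounds the infimum at \<open>x + y\<close> by a sum in which
  both members occur, which is why the infimum stays subadditive.
\<close>
lemma sublinear_chain_Inf:
  assumes ch: "\<And>p q. p \<in> C \<Longrightarrow> q \<in> C \<Longrightarrow> p \<le> q \<or> q \<le> p"
    and sub: "\<And>p. p \<in> C \<Longrightarrow> sublinear p" and ne: "C \<noteq> {}"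
    and bd: "\<And>p x. p \<in> C \<Longrightarrow> L x \<le> p x"
  shows "sublinear (\<lambda>x. INF p\<in>C. p x)"
  unfolding sublinear_def
proof (intro conjI allI impI)
  have bdd: "bdd_below ((\<lambda>p. p x) ` C)" for x by (rule bdd_belowI2[of _ "L x"]) (rule bd)
  fix x y
  have "(INF p\<in>C. p (x + y)) - q x \<le> (INF p\<in>C. p y)" if q: "q \<in> C" for q
  proof (rule cINF_greatest[OF ne])
    fix r assume r: "r \<in> C"
    obtain m where m: "m \<in> C" "m \<le> q" "m \<le> r" using ch[OF q r] q r by auto
    have "(INF p\<in>C. p (x + y)) \<le> m (x + y)" by (rule cINF_lower[OF bdd m(1)])
    also have "\<dots> \<le> m x + m y" by (rule sublinearD[OF sub[OF m(1)]])
    also have "\<dots> \<le> q x + r y" using m by (intro add_mono) (auto simp: le_fun_def)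
    finally show "(INF p\<in>C. p (x + y)) - q x \<le> r y" by simp
  qed
  then have "(INF p\<in>C. p (x + y)) - (INF p\<in>C. p y) \<le> (INF p\<in>C. p x)"
    by (intro cINF_greatest[OF ne]) (auto simp: algebra_simps)
  then show "(INF p\<in>C. p (x + y)) \<le> (INF p\<in>C. p x) + (INF p\<in>C. p y)" by simp
next
  have bdd: "bdd_below ((\<lambda>p. p x) ` C)" for x by (rule bdd_belowI2[of _ "L x"]) (rule bd)
  fix a :: real and x assume a: "0 \<le> a"
  have "(INF p\<in>C. p (a *\<^sub>R x)) = (INF p\<in>C. a * p x)"
    by (intro INF_cong refl sublinearD(2)[OF sub] a)
  also have "\<dots> = a * (INF p\<in>C. p x)"
    using continuous_at_Inf_mono[of "\<lambda>z. a * z" "(\<lambda>p. p x) ` C"] a bdd[of x] ne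
    by (simp add: image_image mono_def mult_left_mono continuous_mult_left)
  finally show "(INF p\<in>C. p (a *\<^sub>R x)) = a * (INF p\<in>C. p x)" .
qed

lemma exists_minimal_sublinear:
  assumes p0: "sublinear p0"
  obtains p where "sublinear p" "p \<le> p0" "\<And>q. sublinear q \<Longrightarrow> q \<le> p \<Longrightarrow> q = p"
proof -
  define A where "A = {p. sublinear p \<and> p \<le> p0}"
  have "\<exists>m\<in>A. \<forall>q\<in>A. q \<le> m \<longrightarrow> q = m"
  proof (rule predicate_Zorn[of A "\<lambda>p q. q \<le> p", simplified])
    show "partial_order_on A (relation_of (\<lambda>p q. q \<le> p) A)"
      by (rule partial_order_on_relation_ofI) auto
  next
    fix C assume "C \<in> Chains (relation_of (\<lambda>p q. q \<le> p) A)"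
    then have C: "C \<subseteq> A" and ch: "\<And>p q. p \<in> C \<Longrightarrow> q \<in> C \<Longrightarrow> p \<le> q \<or> q \<le> p"
      by (auto simp: Chains_def relation_of_def)
    show "\<exists>u\<in>A. \<forall>a\<in>C. u \<le> a"
    proof (cases "C = {}")
      case True
      then show ?thesis using p0 by (auto simp: A_def)
    next
      case False
      have bd: "- p0 (- x) \<le> p x" if "p \<in> C" for p x
      proof -
        have "sublinear p" "p \<le> p0" using C that by (auto simp: A_def)
        then show ?thesis using sublinearD(4)[of p x] by (smt (verit) le_funD)
      qed
      have "sublinear (\<lambda>x. INF p\<in>C. p x)"
        by (rule sublinear_chain_Inf[where L = "\<lambda>x. - p0 (- x)"])
          (use ch False bd C in \<open>auto simp: A_def\<close>)
      moreover have low: "(\<lambda>x. INF p\<in>C. p x) \<le> p" if "p \<in> C" for p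
        using that by (auto simp: le_fun_def intro!: cINF_lower bdd_belowI2[OF bd])
      moreover from False obtain p where "p \<in> C" by auto
      then have "(\<lambda>x. INF p\<in>C. p x) \<le> p0"
        using low C by (auto simp: A_def intro: order_trans)
      ultimately show ?thesis by (intro bexI[of _ "\<lambda>x. INF p\<in>C. p x"]) (auto simp: A_def)
    qed
  qed
  then obtain p where "p \<in> A" and m: "\<And>q. q \<in> A \<Longrightarrow> q \<le> p \<Longrightarrow> q = p" by blast
  then show ?thesis by (intro that[of p]) (auto simp: A_def intro: order_trans)
qed

text \<open>
  Tilting the norm in the direction \<open>x0\<close> forces every linear functional below the result to take
  the value \<open>norm x0\<close> at \<open>x0\<close>. A minimal sublinear functional below it is linear.
\<close>
lemma norming_functional:
  fixes x0 :: "'a::real_normed_vector"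
  obtains u :: "'a \<Rightarrow> real" where "bounded_linear u" "u x0 = norm x0"
proof -
  define p0 where "p0 = tilt norm x0"
  have sp0: "sublinear p0" unfolding p0_def by (rule sublinear_tilt[OF sublinear_norm])
  have p0n: "p0 x \<le> norm x" for x unfolding p0_def by (rule tilt_le_self[OF sublinear_norm])
  have p00: "p0 (- x0) \<le> - norm x0"
    unfolding p0_def using tilt_le[OF sublinear_norm, of 1 x0 "- x0"] by simp
  obtain p where p: "sublinear p" "p \<le> p0" and min: "\<And>q. sublinear q \<Longrightarrow> q \<le> p \<Longrightarrow> q = p"
    by (rule exists_minimal_sublinear[OF sp0]) blast
  note add = minimal_sublinear_additive[OF p(1) min]
  have neg: "p (- x) = - p x" for x using add[of x "- x"] sublinearD(3)[OF p(1)] by simp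
  have sc: "p (a *\<^sub>R x) = a * p x" for a x
  proof (cases "a \<ge> 0")
    case True then show ?thesis by (rule sublinearD(2)[OF p(1)])
  next
    case False
    then show ?thesis using sublinearD(2)[OF p(1), of "- a" x] neg[of "a *\<^sub>R x"] by simp
  qed
  have le: "p x \<le> norm x" for x using p(2) p0n[of x] by (meson le_funD order_trans)
  have "bounded_linear p"
  proof (rule bounded_linear_intro[where K = 1])
    show "norm (p x) \<le> norm x * 1" for x using le[of x] le[of "- x"] neg[of x] by auto
  qed (auto simp: add sc)
  moreover have "p (- x0) \<le> p0 (- x0)" using p(2) by (auto simp: le_fun_def)
  then have "p x0 = norm x0" using p00 neg[of x0] le[of x0] by linarith
  ultimately show ?thesis by (rule that)
qed

definition cfunctional :: "('a::complex_banach \<Rightarrow> complex) \<Rightarrow> bool"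
  where "cfunctional \<psi> \<longleftrightarrow> bounded_linear \<psi> \<and> (\<forall>c x. \<psi> (c *\<^sub>C x) = c * \<psi> x)"

text \<open>
  A real functional \<open>u\<close> is the real part of the complex-linear functional \<open>u(z) - i u(iz)\<close>.
\<close>
lemma cfunctionals_separate_points:
  fixes x y :: "'a::complex_banach"
  assumes "\<And>\<psi>. cfunctional \<psi> \<Longrightarrow> \<psi> x = \<psi> y"
  shows "x = y"
proof -
  obtain u :: "'a \<Rightarrow> real" where u: "bounded_linear u" "u (x - y) = norm (x - y)"
    by (rule norming_functional)
  define \<psi> where "\<psi> z = complex_of_real (u z) - \<i> * complex_of_real (u (\<i> *\<^sub>C z))" for z
  interpret u: bounded_linear u by (rule u)
  have blc: "bounded_linear (\<lambda>z. u (c *\<^sub>C z))" for c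
    by (rule bounded_linear_compose[OF u(1) bounded_linear_scaleC_right])
  have \<psi>bl: "bounded_linear \<psi>"
    unfolding \<psi>_def
    by (intro bounded_linear_sub bounded_linear_compose[OF bounded_linear_of_real]
        bounded_linear_compose[OF bounded_linear_mult_right] u(1) blc)
  have uc: "u (c *\<^sub>C z) = Re c * u z + Im c * u (\<i> *\<^sub>C z)" for c z
  proof -
    have "c *\<^sub>C z = (complex_of_real (Re c) + complex_of_real (Im c) * \<i>) *\<^sub>C z"
      using complex_eq[of c] by (simp add: mult.commute)
    also have "\<dots> = Re c *\<^sub>R z + Im c *\<^sub>R (\<i> *\<^sub>C z)"
      by (simp add: scaleC_add_left scaleR_scaleC scaleC_scaleC)
    finally show ?thesis by (simp add: u.add u.scaleR)
  qed
  have "\<psi> (c *\<^sub>C z) = c * \<psi> z" for c z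
    unfolding \<psi>_def scaleC_scaleC uc[of "\<i> * c" z] uc[of c z]
    by (simp add: complex_eq_iff algebra_simps)
  then have "cfunctional \<psi>" using \<psi>bl by (simp add: cfunctional_def)
  then have "\<psi> (x - y) = 0" using assms[of \<psi>] linear_diff[OF bounded_linear.linear[OF \<psi>bl]] by simp
  then have "Re (\<psi> (x - y)) = 0" by simp
  then have "u (x - y) = 0" by (simp add: \<psi>_def)
  then show ?thesis using u by simp
qed

section \<open>The total variation of a complex measure\<close>

lemma complex_measure_sums:
  assumes "complex_measure \<mu>" "\<And>n. E n \<in> sets borel" "disjoint_family E"
  shows "(\<lambda>n. \<mu> (E n)) sums \<mu> (\<Union>n. E n)"
  using assms unfolding complex_measure_def by (auto simp: image_subset_iff)

lemma complex_measure_empty: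
  assumes "complex_measure \<mu>" shows "\<mu> {} = 0"
proof -
  have "(\<lambda>n::nat. \<mu> {}) sums \<mu> (\<Union>n::nat. {})"
    by (rule complex_measure_sums[OF assms]) (auto simp: disjoint_family_on_def)
  then have "(\<lambda>n::nat. \<mu> {}) \<longlonglongrightarrow> 0" by (intro summable_LIMSEQ_zero) (auto simp: summable_def)
  then show ?thesis by (simp add: LIMSEQ_const_iff)
qed

lemma complex_measure_Un:
  assumes \<mu>: "complex_measure \<mu>" and A: "A \<in> sets borel" and B: "B \<in> sets borel" and AB: "A \<inter> B = {}"
  shows "\<mu> (A \<union> B) = \<mu> A + \<mu> B"
proof -
  define E where "E n = (if n = 0 then A else if n = Suc 0 then B else {})" for n :: nat
  have U: "(\<Union>n. E n) = A \<union> B"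
    by (auto simp: E_def split: if_splits)
  have "(\<lambda>n. \<mu> (E n)) sums \<mu> (\<Union>n. E n)"
    by (rule complex_measure_sums[OF \<mu>]) (use A B AB in \<open>auto simp: E_def disjoint_family_on_def\<close>)
  moreover have "(\<lambda>n. \<mu> (E n)) sums (\<Sum>n\<in>{0, Suc 0}. \<mu> (E n))"
    by (rule sums_finite) (auto simp: E_def complex_measure_empty[OF \<mu>])
  ultimately have "\<mu> (\<Union>n. E n) = (\<Sum>n\<in>{0, Suc 0}. \<mu> (E n))" by (rule sums_unique2)
  then show ?thesis unfolding U by (simp add: E_def)
qed

lemma complex_measure_Diff:
  assumes "complex_measure \<mu>" "A \<in> sets borel" "B \<in> sets borel" "A \<subseteq> B"
  shows "\<mu> (B - A) = \<mu> B - \<mu> A"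
  using complex_measure_Un[of \<mu> A "B - A"] assms by (simp add: Un_absorb1)

lemma disjoint_family_on_Int:
  assumes "disjoint P" "Q \<subseteq> P"
  shows "disjoint_family_on (\<lambda>E. E \<inter> A) Q"
  unfolding disjoint_family_on_def
proof (intro ballI impI)
  fix E F assume "E \<in> Q" "F \<in> Q" "E \<noteq> F"
  then have "E \<inter> F = {}" using assms disjointD[of P E F] by blast
  then show "E \<inter> A \<inter> (F \<inter> A) = {}" by blast
qed

lemma complex_measure_finite_UN:
  assumes \<mu>: "complex_measure \<mu>" and I: "finite I" and F: "\<And>i. i \<in> I \<Longrightarrow> F i \<in> sets borel"
    and d: "disjoint_family_on F I"
  shows "\<mu> (\<Union>i\<in>I. F i) = (\<Sum>i\<in>I. \<mu> (F i))"
  using I F d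
proof (induction I)
  case empty
  then show ?case by (simp add: complex_measure_empty[OF \<mu>])
next
  case (insert i I)
  have "\<mu> (F i \<union> (\<Union>j\<in>I. F j)) = \<mu> (F i) + \<mu> (\<Union>j\<in>I. F j)"
    by (rule complex_measure_Un[OF \<mu>]) (use insert in \<open>auto simp: disjoint_family_on_def\<close>)
  moreover have "disjoint_family_on F I" using insert.prems(2) by (auto simp: disjoint_family_on_def)
  ultimately show ?case using insert by simp
qed

text \<open>
  The set function from which \<open>total_variation\<close> is built. It has to be shown countably additive
  before \<open>emeasure (total_variation \<mu>)\<close> says anything.
\<close>
definition variation :: "(real set \<Rightarrow> complex) \<Rightarrow> real set \<Rightarrow> ennreal"
  where "variation \<mu> B = (SUP P \<in> {P. finite P \<and> P \<subseteq> sets borel \<and> disjoint P \<and> \<Union>P = B}.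
       \<Sum>E\<in>P. ennreal (cmod (\<mu> E)))"

text \<open>
  An indexed family is allowed, so that intersecting a partition with a set needs no care about
  members that become empty and coincide. The rest of \<open>B\<close> completes the family to a partition.
\<close>
lemma variation_ge:
  assumes \<mu>: "complex_measure \<mu>" and I: "finite I" and F: "\<And>i. i \<in> I \<Longrightarrow> F i \<in> sets borel"
    and d: "disjoint_family_on F I" and B: "B \<in> sets borel" and sub: "\<And>i. i \<in> I \<Longrightarrow> F i \<subseteq> B"
  shows "(\<Sum>i\<in>I. ennreal (cmod (\<mu> (F i)))) \<le> variation \<mu> B"
proof -
  define Q where "Q = insert (B - (\<Union>i\<in>I. F i)) (F ` I)"
  have "(\<Sum>i\<in>I. ennreal (cmod (\<mu> (F i)))) = (\<Sum>E\<in>F ` I. ennreal (cmod (\<mu> E)))"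
    by (subst sum.reindex_nontrivial[OF I])
      (use d complex_measure_empty[OF \<mu>] in \<open>auto simp: disjoint_family_on_def, metis Int_absorb\<close>)
  also have "\<dots> \<le> (\<Sum>E\<in>Q. ennreal (cmod (\<mu> E)))"
    unfolding Q_def by (rule sum_mono2) (use I in auto)
  also have "\<dots> \<le> variation \<mu> B"
    unfolding variation_def
  proof (rule SUP_upper, safe)
    show "finite Q" using I by (simp add: Q_def)
    show "disjoint Q" using disjoint_family_on_disjoint_image[OF d]
      by (auto simp: Q_def pairwise_insert disjnt_def)
    show "X \<in> sets borel" if "X \<in> Q" for X using that F B I by (auto simp: Q_def)
    show "x \<in> B" if "x \<in> X" "X \<in> Q" for x X using that sub by (auto simp: Q_def)
    show "x \<in> \<Union>Q" if "x \<in> B" for x using that by (auto simp: Q_def)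
  qed
  finally show ?thesis .
qed

lemma norm_le_variation:
  assumes "complex_measure \<mu>" "B \<in> sets borel"
  shows "ennreal (cmod (\<mu> B)) \<le> variation \<mu> B"
  using variation_ge[of \<mu> "{()}" "\<lambda>_. B" B] assms by (simp add: disjoint_family_on_def)

lemma variation_least:
  assumes "\<And>P. finite P \<Longrightarrow> P \<subseteq> sets borel \<Longrightarrow> disjoint P \<Longrightarrow> \<Union>P = B \<Longrightarrow> (\<Sum>E\<in>P. ennreal (cmod (\<mu> E))) \<le> c"
  shows "variation \<mu> B \<le> c"
  unfolding variation_def by (rule SUP_least) (use assms in auto)

lemma variation_empty:
  assumes "complex_measure \<mu>" shows "variation \<mu> {} = 0"
proof -
  have "variation \<mu> {} \<le> 0"
    by (rule variation_least) (auto intro!: sum.neutral simp del: sum_ennreal simp: complex_measure_empty[OF assms])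
  then show ?thesis by simp
qed

lemma variation_superadditive:
  assumes \<mu>: "complex_measure \<mu>" and A: "A \<in> sets borel" and B: "B \<in> sets borel" and AB: "A \<inter> B = {}"
  shows "variation \<mu> A + variation \<mu> B \<le> variation \<mu> (A \<union> B)"
proof -
  define \<P> where "\<P> C = {P. finite P \<and> P \<subseteq> sets borel \<and> disjoint P \<and> \<Union>P = C}" for C :: "real set"
  define S where "S P = (\<Sum>E\<in>P. ennreal (cmod (\<mu> E)))" for P
  have v: "variation \<mu> C = (SUP P\<in>\<P> C. S P)" for C unfolding variation_def \<P>_def S_def ..
  have ne: "\<P> C \<noteq> {}" if "C \<in> sets borel" for C
    using that by (auto simp: \<P>_def intro!: exI[of _ "{C}"])
  have le: "S P + S Q \<le> variation \<mu> (A \<union> B)" if P: "P \<in> \<P> A" and Q: "Q \<in> \<P> B" for P Q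
  proof -
    have fin: "finite P" "finite Q" using P Q by (auto simp: \<P>_def)
    have "E = {}" if "E \<in> P \<inter> Q" for E using that P Q AB by (auto simp: \<P>_def)
    then have "S (P \<inter> Q) = 0"
      unfolding S_def using complex_measure_empty[OF \<mu>]
      by (intro sum.neutral ballI) (metis ennreal_0 norm_zero)
    then have "S P + S Q = S (P \<union> Q)"
      using sum.union_inter[OF fin, of "\<lambda>E. ennreal (cmod (\<mu> E))"] by (simp add: S_def)
    also have "\<dots> = (\<Sum>E\<in>P \<union> Q. ennreal (cmod (\<mu> (id E))))" by (simp add: S_def)
    also have "\<dots> \<le> variation \<mu> (A \<union> B)"
    proof (rule variation_ge[OF \<mu>])
      show "disjoint_family_on id (P \<union> Q)"
        unfolding disjoint_family_on_def
      proof (intro ballI impI)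
        fix E F assume "E \<in> P \<union> Q" "F \<in> P \<union> Q" "E \<noteq> F"
        then show "id E \<inter> id F = {}"
          using P Q AB by (auto simp: \<P>_def disjoint_def) blast+
      qed
    qed (use P Q A B fin in \<open>auto simp: \<P>_def\<close>)
    finally show ?thesis .
  qed
  have "variation \<mu> A + S Q \<le> variation \<mu> (A \<union> B)" if "Q \<in> \<P> B" for Q
    unfolding v[of A] using ne[OF A] le[OF _ that]
    by (subst ennreal_SUP_add_left[symmetric]) (auto intro!: SUP_least)
  then show ?thesis
    unfolding v[of B] using ne[OF B]
    by (subst add.commute, subst ennreal_SUP_add_left[symmetric]) (auto intro!: SUP_least simp: add.commute)
qed

lemma variation_mono:
  assumes "complex_measure \<mu>" "A \<in> sets borel" "B \<in> sets borel" "A \<subseteq> B"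
  shows "variation \<mu> A \<le> variation \<mu> B"
proof -
  have "variation \<mu> A + variation \<mu> (B - A) \<le> variation \<mu> (A \<union> (B - A))"
    by (rule variation_superadditive) (use assms in auto)
  moreover have "A \<union> (B - A) = B" using assms by auto
  ultimately show ?thesis by (metis add_increasing2 order_trans zero_le order_refl)
qed

lemma variation_countably_additive:
  assumes \<mu>: "complex_measure \<mu>"
  shows "countably_additive (sets borel) (variation \<mu>)"
proof (rule countably_additiveI)
  fix A :: "nat \<Rightarrow> real set"
  assume "range A \<subseteq> sets borel" and d: "disjoint_family A"
  then have A: "A i \<in> sets borel" for i by auto
  have "(\<Sum>i<n. variation \<mu> (A i)) \<le> variation \<mu> (\<Union>i<n. A i)" for n
  proof (induction n)
    case (Suc n)
    have "(\<Sum>i<Suc n. variation \<mu> (A i)) \<le> variation \<mu> (\<Union>i<n. A i) + variation \<mu> (A n)"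
      using Suc by (simp add: add_right_mono)
    also have "\<dots> \<le> variation \<mu> ((\<Union>i<n. A i) \<union> A n)"
      by (rule variation_superadditive[OF \<mu>])
        (use A d in \<open>auto simp: disjoint_family_on_def, metis IntI empty_iff less_irrefl\<close>)
    also have "(\<Union>i<n. A i) \<union> A n = (\<Union>i<Suc n. A i)" by (auto simp: less_Suc_eq)
    finally show ?case .
  qed (simp add: variation_empty[OF \<mu>])
  also have "variation \<mu> (\<Union>i<n. A i) \<le> variation \<mu> (\<Union>i. A i)" for n
    by (rule variation_mono[OF \<mu>]) (use A in auto)
  finally have 1: "(\<Sum>i. variation \<mu> (A i)) \<le> variation \<mu> (\<Union>i. A i)"
    by (intro suminf_le_const summableI) auto
  have 2: "variation \<mu> (\<Union>i. A i) \<le> (\<Sum>i. variation \<mu> (A i))"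
  proof (rule variation_least)
    fix P assume P: "finite P" "P \<subseteq> sets borel" "disjoint P" "\<Union>P = (\<Union>i. A i)"
    have "ennreal (cmod (\<mu> E)) \<le> (\<Sum>i. ennreal (cmod (\<mu> (E \<inter> A i))))" if E: "E \<in> P" for E
    proof -
      have "(\<lambda>i. \<mu> (E \<inter> A i)) sums \<mu> (\<Union>i. E \<inter> A i)"
        by (rule complex_measure_sums[OF \<mu>])
          (use A P E d in \<open>auto simp: disjoint_family_on_def, metis IntI empty_iff\<close>)
      also have "(\<Union>i. E \<inter> A i) = E" using E P(4) by auto
      finally have "(\<lambda>n. \<Sum>i<n. \<mu> (E \<inter> A i)) \<longlonglongrightarrow> \<mu> E" by (simp add: sums_def)
      then have "(\<lambda>n. ennreal (cmod (\<Sum>i<n. \<mu> (E \<inter> A i)))) \<longlonglongrightarrow> ennreal (cmod (\<mu> E))"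
        by (intro tendsto_ennrealI tendsto_norm)
      then show ?thesis
      proof (rule LIMSEQ_le_const2, intro exI allI impI)
        fix n
        have "ennreal (cmod (\<Sum>i<n. \<mu> (E \<inter> A i))) \<le> ennreal (\<Sum>i<n. cmod (\<mu> (E \<inter> A i)))"
          by (intro ennreal_leI norm_sum)
        also have "\<dots> = (\<Sum>i<n. ennreal (cmod (\<mu> (E \<inter> A i))))" by (simp add: sum_ennreal)
        also have "\<dots> \<le> (\<Sum>i. ennreal (cmod (\<mu> (E \<inter> A i))))"
          by (rule sum_le_suminf) auto
        finally show "ennreal (cmod (\<Sum>i<n. \<mu> (E \<inter> A i))) \<le> (\<Sum>i. ennreal (cmod (\<mu> (E \<inter> A i))))" .
      qed
    qed
    then have "(\<Sum>E\<in>P. ennreal (cmod (\<mu> E))) \<le> (\<Sum>E\<in>P. \<Sum>i. ennreal (cmod (\<mu> (E \<inter> A i))))"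
      by (rule sum_mono)
    also have "\<dots> = (\<Sum>i. \<Sum>E\<in>P. ennreal (cmod (\<mu> (E \<inter> A i))))"
      by (rule suminf_sum[symmetric]) auto
    also have "\<dots> \<le> (\<Sum>i. variation \<mu> (A i))"
    proof (rule suminf_le)
      fix i
      show "(\<Sum>E\<in>P. ennreal (cmod (\<mu> (E \<inter> A i)))) \<le> variation \<mu> (A i)"
        by (rule variation_ge[OF \<mu> P(1)]) (use A P disjoint_family_on_Int[OF P(3) order_refl] in auto)
    qed auto
    finally show "(\<Sum>E\<in>P. ennreal (cmod (\<mu> E))) \<le> (\<Sum>i. variation \<mu> (A i))" .
  qed
  show "(\<Sum>i. variation \<mu> (A i)) = variation \<mu> (\<Union>i. A i)" using 1 2 by (rule antisym)
qed

lemma sets_total_variation [simp, measurable_cong]: "sets (total_variation \<mu>) = sets borel"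
  unfolding total_variation_def using sets.sigma_sets_eq[of borel] by (simp add: sets_measure_of_conv)

lemma space_total_variation [simp]: "space (total_variation \<mu>) = UNIV"
  unfolding total_variation_def by (simp add: space_measure_of_conv)

lemma emeasure_total_variation:
  assumes \<mu>: "complex_measure \<mu>" and B: "B \<in> sets borel"
  shows "emeasure (total_variation \<mu>) B = variation \<mu> B"
  unfolding total_variation_def variation_def[symmetric]
  by (rule emeasure_measure_of_sigma[OF _ _ variation_countably_additive[OF \<mu>] B])
    (use sets.sigma_algebra_axioms[of borel] variation_empty[OF \<mu>] in \<open>auto simp: positive_def\<close>)

lemma variation_additive:
  assumes \<mu>: "complex_measure \<mu>" and A: "A \<in> sets borel" and B: "B \<in> sets borel" and AB: "A \<inter> B = {}"
  shows "variation \<mu> (A \<union> B) = variation \<mu> A + variation \<mu> B"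
  using plus_emeasure[of A "total_variation \<mu>" B] assms by (simp add: emeasure_total_variation)

text \<open>
  One of the four half-planes \<open>Re \<ge> 0\<close>, \<open>Re < 0\<close>, \<open>Im \<ge> 0\<close>, \<open>Im < 0\<close> carries at least a quarter of
  the sum of the absolute values, and inside a half-plane there is no cancellation in the
  corresponding coordinate.
\<close>
lemma large_partial_sum:
  assumes I: "finite I"
  shows "\<exists>J\<subseteq>I. (\<Sum>i\<in>I. cmod (z i)) \<le> 4 * cmod (\<Sum>i\<in>J. z i)"
proof -
  define S where "S Q = cmod (\<Sum>i\<in>{i\<in>I. Q (z i)}. z i)" for Q
  have R: "(\<Sum>i\<in>I. \<bar>g (z i)\<bar>) \<le> S (\<lambda>z. g z \<ge> 0) + S (\<lambda>z. g z < 0)"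
    if g: "bounded_linear g" and n: "\<And>z. \<bar>g z\<bar> \<le> cmod z" for g :: "complex \<Rightarrow> real"
  proof -
    have "(\<Sum>i\<in>I. \<bar>g (z i)\<bar>) = (\<Sum>i\<in>{i\<in>I. g (z i) \<ge> 0} \<union> {i\<in>I. g (z i) < 0}. \<bar>g (z i)\<bar>)"
      by (rule sum.cong) auto
    also have "\<dots> = (\<Sum>i\<in>{i\<in>I. g (z i) \<ge> 0}. \<bar>g (z i)\<bar>) + (\<Sum>i\<in>{i\<in>I. g (z i) < 0}. \<bar>g (z i)\<bar>)"
      by (rule sum.union_disjoint) (use I in auto)
    also have "\<dots> = (\<Sum>i\<in>{i\<in>I. g (z i) \<ge> 0}. g (z i)) + (\<Sum>i\<in>{i\<in>I. g (z i) < 0}. - g (z i))"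
      by (intro arg_cong2[where f = "(+)"] sum.cong) auto
    also have "\<dots> = g (\<Sum>i\<in>{i\<in>I. g (z i) \<ge> 0}. z i) - g (\<Sum>i\<in>{i\<in>I. g (z i) < 0}. z i)"
      by (simp add: sum_negf linear_sum[OF bounded_linear.linear[OF g]])
    also have "\<dots> \<le> S (\<lambda>z. g z \<ge> 0) + S (\<lambda>z. g z < 0)"
      unfolding S_def using n[of "\<Sum>i\<in>{i\<in>I. g (z i) \<ge> 0}. z i"] n[of "\<Sum>i\<in>{i\<in>I. g (z i) < 0}. z i"] by linarith
    finally show ?thesis .
  qed
  have "(\<Sum>i\<in>I. cmod (z i)) \<le> (\<Sum>i\<in>I. \<bar>Re (z i)\<bar> + \<bar>Im (z i)\<bar>)"
    by (rule sum_mono) (rule cmod_le)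
  also have "\<dots> = (\<Sum>i\<in>I. \<bar>Re (z i)\<bar>) + (\<Sum>i\<in>I. \<bar>Im (z i)\<bar>)" by (rule sum.distrib)
  finally have le: "(\<Sum>i\<in>I. cmod (z i)) \<le> S (\<lambda>z. Re z \<ge> 0) + S (\<lambda>z. Re z < 0) + S (\<lambda>z. Im z \<ge> 0) + S (\<lambda>z. Im z < 0)"
    using R[OF bounded_linear_Re abs_Re_le_cmod] R[OF bounded_linear_Im abs_Im_le_cmod] by linarith
  show ?thesis
  proof (rule ccontr)
    assume "\<not> ?thesis"
    then have "4 * S Q < (\<Sum>i\<in>I. cmod (z i))" for Q
      unfolding S_def by (auto simp: not_le)
    from this[of "\<lambda>z. Re z \<ge> 0"] this[of "\<lambda>z. Re z < 0"] this[of "\<lambda>z. Im z \<ge> 0"] this[of "\<lambda>z. Im z < 0"]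
    show False using le by linarith
  qed
qed

text \<open>
  A subset with large measure has a complement with large measure, and one of the two still has
  infinite variation.
\<close>
lemma infinite_variation_split:
  assumes \<mu>: "complex_measure \<mu>" and B: "B \<in> sets borel" and inf: "variation \<mu> B = \<infinity>"
  shows "\<exists>A\<in>sets borel. A \<subseteq> B \<and> variation \<mu> A = \<infinity> \<and> cmod (\<mu> (B - A)) > 1"
proof -
  \<comment> \<open>the factor \<open>4\<close> is lost when passing to a partial sum without cancellation\<close>
  define t where "t = 4 * (1 + cmod (\<mu> B))"
  have "ennreal t < variation \<mu> B" using inf by simp
  then obtain P where P: "finite P" "P \<subseteq> sets borel" "disjoint P" "\<Union>P = B"
    and t: "ennreal t < (\<Sum>E\<in>P. ennreal (cmod (\<mu> E)))"
    unfolding variation_def less_SUP_iff by auto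
  have t: "t < (\<Sum>E\<in>P. cmod (\<mu> E))"
    using t by (subst (asm) sum_ennreal, simp, subst (asm) ennreal_less_iff) (auto simp: t_def)
  obtain Q where Q: "Q \<subseteq> P" "(\<Sum>E\<in>P. cmod (\<mu> E)) \<le> 4 * cmod (\<Sum>E\<in>Q. \<mu> E)"
    using large_partial_sum[OF P(1), of \<mu>] by blast
  define A where "A = \<Union>Q"
  have fQ: "finite Q" using Q(1) P(1) finite_subset by blast
  have A: "A \<in> sets borel" "A \<subseteq> B"
    unfolding A_def using fQ Q(1) P by (auto intro!: sets.finite_Union)
  have "\<mu> (\<Union>E\<in>Q. id E) = (\<Sum>E\<in>Q. \<mu> (id E))"
    by (rule complex_measure_finite_UN[OF \<mu> fQ]) (use Q(1) P disjoint_family_on_Int[OF P(3) Q(1), of UNIV] in \<open>auto simp: id_def\<close>)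
  then have "\<mu> A = (\<Sum>E\<in>Q. \<mu> E)" by (simp add: A_def)
  then have 1: "cmod (\<mu> A) > 1 + cmod (\<mu> B)" using t Q(2) by (simp add: t_def)
  have "\<mu> (B - A) = \<mu> B - \<mu> A" by (rule complex_measure_Diff[OF \<mu> A(1) B A(2)])
  then have 2: "cmod (\<mu> (B - A)) > 1" using 1 norm_triangle_ineq2[of "\<mu> A" "\<mu> B"]
    by (simp add: norm_minus_commute)
  have "variation \<mu> (A \<union> (B - A)) = variation \<mu> A + variation \<mu> (B - A)"
    by (rule variation_additive[OF \<mu>]) (use A B in auto)
  moreover have "A \<union> (B - A) = B" using A by auto
  ultimately have "variation \<mu> A = \<infinity> \<or> variation \<mu> (B - A) = \<infinity>"
    using inf by (metis ennreal_add_eq_top infinity_ennreal_def)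
  then show ?thesis
  proof
    assume "variation \<mu> A = \<infinity>"
    then show ?thesis using A 2 by blast
  next
    assume "variation \<mu> (B - A) = \<infinity>"
    moreover have "B - (B - A) = A" using A by auto
    moreover have "1 < cmod (\<mu> A)" using 1 by (smt (verit) norm_ge_zero)
    ultimately show ?thesis using A B by (intro bexI[of _ "B - A"]) auto
  qed
qed

text \<open>
  Otherwise repeated splitting produces disjoint sets of measure larger than \<open>1\<close> in absolute value,
  which contradicts the convergence of the series of their measures.
\<close>
lemma variation_finite:
  assumes \<mu>: "complex_measure \<mu>"
  shows "variation \<mu> UNIV < \<infinity>"
proof (rule ccontr)
  assume "\<not> variation \<mu> UNIV < \<infinity>"
  then have inf: "variation \<mu> UNIV = \<infinity>" by (simp add: less_top[symmetric])
  define R where "R B A \<longleftrightarrow> A \<subseteq> B \<and> cmod (\<mu> (B - A)) > 1" for A B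
  obtain B where B: "\<And>n. B n \<in> sets borel \<and> variation \<mu> (B n) = \<infinity>" "\<And>n. R (B n) (B (Suc n))"
    using dependent_nat_choice[of "\<lambda>_ B. B \<in> sets borel \<and> variation \<mu> B = \<infinity>" "\<lambda>_. R"]
      infinite_variation_split[OF \<mu>] inf unfolding R_def by (metis UNIV_I sets.top space_borel)
  define D where "D n = B n - B (Suc n)" for n
  have dec: "B n \<subseteq> B m" if "m \<le> n" for m n
    by (rule lift_Suc_antimono_le[of B, OF _ that]) (use B(2) in \<open>auto simp: R_def\<close>)
  have "D m \<inter> D n = {}" if "m < n" for m n
    using dec[of "Suc m" n] that by (auto simp: D_def)
  then have "disjoint_family D" unfolding disjoint_family_on_def by (metis inf_commute nat_neq_iff)
  moreover have "D n \<in> sets borel" for n using B(1)[of n] B(1)[of "Suc n"] by (auto simp: D_def)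
  ultimately have "(\<lambda>n. \<mu> (D n)) sums \<mu> (\<Union>n. D n)" by (intro complex_measure_sums[OF \<mu>])
  then have "(\<lambda>n. \<mu> (D n)) \<longlonglongrightarrow> 0" by (intro summable_LIMSEQ_zero) (auto simp: summable_def)
  then have "\<forall>\<^sub>F n in sequentially. cmod (\<mu> (D n)) < 1"
    by (auto simp: tendsto_iff dist_norm)
  then obtain n where "cmod (\<mu> (D n)) < 1" by (auto simp: eventually_sequentially)
  moreover have "cmod (\<mu> (D n)) > 1" using B(2)[of n] by (simp add: R_def D_def)
  ultimately show False by simp
qed

lemma finite_measure_total_variation:
  "complex_measure \<mu> \<Longrightarrow> finite_measure (total_variation \<mu>)"
  using variation_finite[of \<mu>] by (intro finite_measureI) (simp add: emeasure_total_variation)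

section \<open>Integration against a complex measure\<close>

lemma scaleC_sum_right: "c *\<^sub>C (\<Sum>i\<in>I. f i) = (\<Sum>i\<in>I. c *\<^sub>C (f i :: 'a::complex_banach))"
  using linear_sum[OF bounded_linear.linear[OF bounded_linear_scaleC_right[where 'a='a]]] .

lemma scaleC_0 [simp]: "(0::complex) *\<^sub>C x = (0::'a::complex_banach)"
  using scaleR_scaleC[of 0 x] by simp

lemma scaleC_0_right [simp]: "c *\<^sub>C (0::'a::complex_banach) = 0"
  using linear_0[OF bounded_linear.linear[OF bounded_linear_scaleC_right]] .

lemma scaleC_1 [simp]: "(1::complex) *\<^sub>C x = (x::'a::complex_banach)"
  using scaleR_scaleC[of 1 x] by simp

lemma scaleC_sum_left: "(\<Sum>i\<in>I. c i) *\<^sub>C x = (\<Sum>i\<in>I. c i *\<^sub>C (x :: 'a::complex_banach))"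
  by (induction I rule: infinite_finite_induct) (auto simp: scaleC_add_left)

lemma simple_function_vimage:
  assumes "simple_function borel (s :: real \<Rightarrow> 'a)"
  shows "finite (range s)" "s -` A \<in> sets borel"
proof -
  show "finite (range s)" using simple_functionD(1)[OF assms] by simp
  show "s -` A \<in> sets borel" using simple_functionD(2)[OF assms, of A] by simp
qed

text \<open>
  A simple integral may be computed on any finite partition on whose members the integrand is
  constant. Linearity and compatibility with functionals both follow by choosing a common partition.
\<close>
lemma simple_cintegral_compose:
  assumes \<mu>: "complex_measure \<mu>" and p: "simple_function borel p"
  shows "simple_cintegral \<mu> (\<lambda>t. f (p t)) = (\<Sum>c\<in>range p. \<mu> (p -` {c}) *\<^sub>C f c)"
proof -
  have fin: "finite (range p)" and B: "p -` A \<in> sets borel" for A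
    using simple_function_vimage[OF p] by auto
  have fin': "finite (range (\<lambda>t. f (p t)))"
    using finite_imageI[OF fin, of f] by (simp add: image_image)
  have "\<mu> ((\<lambda>t. f (p t)) -` {y}) = (\<Sum>c\<in>{c\<in>range p. f c = y}. \<mu> (p -` {c}))" for y
  proof -
    have "(\<lambda>t. f (p t)) -` {y} = (\<Union>c\<in>{c\<in>range p. f c = y}. p -` {c})" by auto
    also have "\<mu> \<dots> = (\<Sum>c\<in>{c\<in>range p. f c = y}. \<mu> (p -` {c}))"
      by (rule complex_measure_finite_UN[OF \<mu>]) (use fin B in \<open>auto simp: disjoint_family_on_def\<close>)
    finally show ?thesis .
  qed
  then have "simple_cintegral \<mu> (\<lambda>t. f (p t))
      = (\<Sum>y\<in>range (\<lambda>t. f (p t)). \<Sum>c\<in>{c\<in>range p. f c = y}. \<mu> (p -` {c}) *\<^sub>C f c)"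
    unfolding simple_cintegral_def by (intro sum.cong refl) (simp add: scaleC_sum_left)
  also have "\<dots> = (\<Sum>c\<in>range p. \<mu> (p -` {c}) *\<^sub>C f c)"
    by (rule sum.group) (use fin fin' in auto)
  finally show ?thesis .
qed

lemma simple_cintegral_diff:
  assumes \<mu>: "complex_measure \<mu>" and s: "simple_function borel s" and s': "simple_function borel s'"
  shows "simple_cintegral \<mu> (\<lambda>t. s t - s' t) = simple_cintegral \<mu> s - simple_cintegral \<mu> s'"
proof -
  define p where "p t = (s t, s' t)" for t
  have p: "simple_function borel p" unfolding p_def using s s' by (rule simple_function_Pair)
  have sub: "c *\<^sub>C (x - y) = c *\<^sub>C x - c *\<^sub>C (y::'a)" for c x y
    using linear_diff[OF bounded_linear.linear[OF bounded_linear_scaleC_right]] .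
  have "simple_cintegral \<mu> (\<lambda>t. s t - s' t) = simple_cintegral \<mu> (\<lambda>t. (\<lambda>(a, b). a - b) (p t))"
    by (simp add: p_def)
  also have "\<dots> = simple_cintegral \<mu> (\<lambda>t. fst (p t)) - simple_cintegral \<mu> (\<lambda>t. snd (p t))"
    unfolding simple_cintegral_compose[OF \<mu> p] by (simp add: sub sum_subtractf split_def)
  finally show ?thesis by (simp add: p_def)
qed

lemma norm_simple_cintegral_le:
  assumes \<mu>: "complex_measure \<mu>" and s: "simple_function borel s"
  shows "ennreal (norm (simple_cintegral \<mu> s)) \<le> (\<integral>\<^sup>+t. ennreal (norm (s t)) \<partial>total_variation \<mu>)"
proof -
  have fin: "finite (range s)" and B: "s -` A \<in> sets borel" for A
    using simple_function_vimage[OF s] by auto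
  have "ennreal (norm (simple_cintegral \<mu> s)) \<le> ennreal (\<Sum>y\<in>range s. cmod (\<mu> (s -` {y})) * norm y)"
    unfolding simple_cintegral_def
    by (intro ennreal_leI order_trans[OF norm_sum]) (simp add: norm_scaleC)
  also have "\<dots> = (\<Sum>y\<in>range s. ennreal (cmod (\<mu> (s -` {y}))) * ennreal (norm y))"
    by (simp add: sum_ennreal ennreal_mult flip: ennreal_mult)
  also have "\<dots> \<le> (\<Sum>y\<in>range s. emeasure (total_variation \<mu>) (s -` {y}) * ennreal (norm y))"
    unfolding emeasure_total_variation[OF \<mu> B]
    by (intro sum_mono mult_right_mono norm_le_variation[OF \<mu> B]) simp
  also have "\<dots> = (\<Sum>y\<in>range s. \<integral>\<^sup>+t. ennreal (norm y) * indicator (s -` {y}) t \<partial>total_variation \<mu>)"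
    by (intro sum.cong refl) (simp add: nn_integral_cmult_indicator B mult.commute)
  also have "\<dots> = (\<integral>\<^sup>+t. (\<Sum>y\<in>range s. ennreal (norm y) * indicator (s -` {y}) t) \<partial>total_variation \<mu>)"
    by (rule nn_integral_sum[symmetric]) (use B in \<open>auto intro!: borel_measurable_times_ennreal borel_measurable_indicator\<close>)
  also have "\<dots> = (\<integral>\<^sup>+t. ennreal (norm (s t)) \<partial>total_variation \<mu>)"
  proof (rule nn_integral_cong)
    fix t
    have "(\<Sum>y\<in>range s. ennreal (norm y) * indicator (s -` {y}) t) = (\<Sum>y\<in>range s. if y = s t then ennreal (norm y) else 0)"
      by (intro sum.cong refl) auto
    also have "\<dots> = ennreal (norm (s t))" using fin by simp
    finally show "(\<Sum>y\<in>range s. ennreal (norm y) * indicator (s -` {y}) t) = ennreal (norm (s t))" .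
  qed
  finally show ?thesis .
qed

text \<open>
  The values may lie in a nonseparable space, where differences of measurable functions need not be
  measurable. Subtracting a simple function is harmless, as one can argue value by value.
\<close>
lemma measurable_norm_diff_simple:
  fixes g s :: "real \<Rightarrow> 'a::real_normed_vector"
  assumes g: "g \<in> borel_measurable borel" and s: "simple_function borel s"
  shows "(\<lambda>t. norm (g t - s t)) \<in> borel_measurable borel"
proof (rule measurable_compose_countable'[where f = "\<lambda>y t. norm (g t - y)" and g = s and I = "range s"])
  fix y :: 'a
  have "(\<lambda>x. norm (x - y)) \<in> borel_measurable borel"
    by (intro borel_measurable_continuous_onI continuous_intros)
  then show "(\<lambda>t. norm (g t - y)) \<in> borel_measurable borel"
    by (rule measurable_compose[OF g])
next
  show "s \<in> measurable borel (count_space (range s))"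
    using simple_function_vimage[OF s] by (subst measurable_count_space_eq2) auto
  show "countable (range s)" using simple_function_vimage(1)[OF s] by (rule countable_finite)
qed

lemma simple_cintegral_dist_le:
  assumes \<mu>: "complex_measure \<mu>" and g: "g \<in> borel_measurable borel"
    and s: "simple_function borel s" and s': "simple_function borel s'"
  shows "ennreal (norm (simple_cintegral \<mu> s - simple_cintegral \<mu> s'))
    \<le> (\<integral>\<^sup>+t. ennreal (norm (g t - s t)) \<partial>total_variation \<mu>)
      + (\<integral>\<^sup>+t. ennreal (norm (g t - s' t)) \<partial>total_variation \<mu>)"
proof -
  have sd: "simple_function borel (\<lambda>t. s t - s' t)"
    using simple_function_compose2[OF s s', of "(-)"] .
  have "ennreal (norm (simple_cintegral \<mu> s - simple_cintegral \<mu> s'))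
      \<le> (\<integral>\<^sup>+t. ennreal (norm (s t - s' t)) \<partial>total_variation \<mu>)"
    using norm_simple_cintegral_le[OF \<mu> sd] by (simp add: simple_cintegral_diff[OF \<mu> s s'])
  also have "\<dots> \<le> (\<integral>\<^sup>+t. ennreal (norm (g t - s t)) + ennreal (norm (g t - s' t)) \<partial>total_variation \<mu>)"
  proof (rule nn_integral_mono)
    fix t
    have "norm (s t - s' t) \<le> norm (g t - s t) + norm (g t - s' t)"
      using norm_triangle_ineq4[of "g t - s' t" "g t - s t"] by (simp add: algebra_simps)
    then show "ennreal (norm (s t - s' t)) \<le> ennreal (norm (g t - s t)) + ennreal (norm (g t - s' t))"
      by (simp flip: ennreal_plus)
  qed
  also have "\<dots> = (\<integral>\<^sup>+t. ennreal (norm (g t - s t)) \<partial>total_variation \<mu>)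
      + (\<integral>\<^sup>+t. ennreal (norm (g t - s' t)) \<partial>total_variation \<mu>)"
    by (rule nn_integral_add)
      (use measurable_norm_diff_simple[OF g] s s' in \<open>auto simp: measurable_cong_sets[OF sets_total_variation refl]\<close>)
  finally show ?thesis .
qed

lemma has_cintegral_unique:
  assumes \<mu>: "complex_measure \<mu>" and y: "has_cintegral \<mu> g y" and z: "has_cintegral \<mu> g z"
  shows "y = z"
proof -
  let ?I = "\<lambda>s. \<integral>\<^sup>+t. ennreal (norm (g t - s t)) \<partial>total_variation \<mu>"
  obtain s where g: "g \<in> borel_measurable borel" and s: "\<And>n. simple_function borel (s n)"
    "(\<lambda>n. ?I (s n)) \<longlonglongrightarrow> 0" "(\<lambda>n. simple_cintegral \<mu> (s n)) \<longlonglongrightarrow> y"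
    using y unfolding has_cintegral_def by blast
  obtain s' where s': "\<And>n. simple_function borel (s' n)"
    "(\<lambda>n. ?I (s' n)) \<longlonglongrightarrow> 0" "(\<lambda>n. simple_cintegral \<mu> (s' n)) \<longlonglongrightarrow> z"
    using z unfolding has_cintegral_def by blast
  have "(\<lambda>n. ennreal (norm (simple_cintegral \<mu> (s n) - simple_cintegral \<mu> (s' n)))) \<longlonglongrightarrow> ennreal (norm (y - z))"
    by (intro tendsto_ennrealI tendsto_intros s s')
  moreover have "(\<lambda>n. ?I (s n) + ?I (s' n)) \<longlonglongrightarrow> 0"
    using tendsto_add[OF s(2) s'(2)] by simp
  ultimately have "ennreal (norm (y - z)) \<le> 0"
    by (rule LIMSEQ_le) (use simple_cintegral_dist_le[OF \<mu> g s(1) s'(1)] in auto)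
  then show ?thesis by simp
qed

lemma cintegral_eqI:
  "complex_measure \<mu> \<Longrightarrow> has_cintegral \<mu> g y \<Longrightarrow> cintegral \<mu> g = y"
  unfolding cintegral_def using has_cintegral_unique by blast

definition even_bcont :: "(real \<Rightarrow> 'a::real_normed_vector) \<Rightarrow> bool"
  where "even_bcont g \<longleftrightarrow> continuous_on UNIV g \<and> bounded (range g) \<and> (\<forall>t. g (- t) = g t)"

text \<open>
  \<open>grid n\<close> cuts \<open>[-n, n]\<close> into finitely many symmetric cells, on which \<open>|t|\<close> is rounded down to a
  multiple of \<open>1/(n+1)\<close>; the outside is the cell \<open>None\<close>. The same cells serve for all integrands
  and all measures.
\<close>
definition grid :: "nat \<Rightarrow> real \<Rightarrow> real option"
  where "grid n t = (if \<bar>t\<bar> \<le> real n then Some (real_of_int \<lfloor>real (Suc n) * \<bar>t\<bar>\<rfloor> / real (Suc n)) else None)"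

definition sample :: "(real \<Rightarrow> 'a::zero) \<Rightarrow> real option \<Rightarrow> 'a"
  where "sample g p = (case p of None \<Rightarrow> 0 | Some u \<Rightarrow> g u)"

lemma simple_function_grid: "simple_function borel (grid n)"
  unfolding simple_function_eq_measurable
proof
  have "grid n t \<in> insert None ((\<lambda>k. Some (real_of_int k / real (Suc n))) ` {0..\<lfloor>real (Suc n) * real n\<rfloor>})" for t
    unfolding grid_def by (auto intro!: imageI floor_mono mult_left_mono)
  then have "range (grid n) \<subseteq> insert None ((\<lambda>k. Some (real_of_int k / real (Suc n))) ` {0..\<lfloor>real (Suc n) * real n\<rfloor>})"
    by (rule image_subsetI)
  then show "finite (grid n ` space borel)" by (simp add: finite_subset)
  have 1: "(\<lambda>t::real. \<lfloor>real (Suc n) * \<bar>t\<bar>\<rfloor>) \<in> measurable borel (count_space UNIV)" by measurable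
  have 2: "(\<lambda>t. Some (real_of_int \<lfloor>real (Suc n) * \<bar>t\<bar>\<rfloor> / real (Suc n))) \<in> measurable borel (count_space UNIV)"
    by (rule measurable_compose[OF 1]) simp
  show "grid n \<in> measurable borel (count_space UNIV)"
    unfolding grid_def by (rule measurable_If[OF 2]) auto
qed

lemma sample_grid_tendsto:
  assumes g: "even_bcont g"
  shows "(\<lambda>n. sample g (grid n t)) \<longlonglongrightarrow> g t"
proof -
  have "(\<lambda>n. real_of_int \<lfloor>real (Suc n) * \<bar>t\<bar>\<rfloor> / real (Suc n)) \<longlonglongrightarrow> \<bar>t\<bar>"
  proof (rule tendsto_sandwich[where f = "\<lambda>n. \<bar>t\<bar> - 1 / real (Suc n)" and h = "\<lambda>n. \<bar>t\<bar>"])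
    show "(\<lambda>n. \<bar>t\<bar> - 1 / real (Suc n)) \<longlonglongrightarrow> \<bar>t\<bar>"
      using tendsto_diff[OF tendsto_const LIMSEQ_Suc[OF lim_1_over_n], of "\<bar>t\<bar>"] by simp
    show "\<forall>\<^sub>F n in sequentially. \<bar>t\<bar> - 1 / real (Suc n) \<le> real_of_int \<lfloor>real (Suc n) * \<bar>t\<bar>\<rfloor> / real (Suc n)"
    proof (intro always_eventually allI)
      fix n
      have "real (Suc n) * \<bar>t\<bar> - 1 \<le> real_of_int \<lfloor>real (Suc n) * \<bar>t\<bar>\<rfloor>" by linarith
      then have "(real (Suc n) * \<bar>t\<bar> - 1) / real (Suc n) \<le> real_of_int \<lfloor>real (Suc n) * \<bar>t\<bar>\<rfloor> / real (Suc n)"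
        by (rule divide_right_mono) simp
      then show "\<bar>t\<bar> - 1 / real (Suc n) \<le> real_of_int \<lfloor>real (Suc n) * \<bar>t\<bar>\<rfloor> / real (Suc n)"
        by (simp add: diff_divide_distrib)
    qed
    show "\<forall>\<^sub>F n in sequentially. real_of_int \<lfloor>real (Suc n) * \<bar>t\<bar>\<rfloor> / real (Suc n) \<le> \<bar>t\<bar>"
      by (intro always_eventually allI) (subst pos_divide_le_eq, auto simp: mult.commute simp del: of_nat_Suc)
  qed auto
  then have "(\<lambda>n. g (real_of_int \<lfloor>real (Suc n) * \<bar>t\<bar>\<rfloor> / real (Suc n))) \<longlonglongrightarrow> g \<bar>t\<bar>"
    using g by (intro isCont_tendsto_compose[where g = g]) (auto simp: even_bcont_def continuous_on_eq_continuous_at)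
  also have "g \<bar>t\<bar> = g t" using g by (simp add: even_bcont_def abs_if)
  finally show ?thesis
  proof (rule Lim_transform_eventually)
    obtain N where N: "\<bar>t\<bar> \<le> real N" using real_arch_simple by blast
    show "\<forall>\<^sub>F n in sequentially. g (real_of_int \<lfloor>real (Suc n) * \<bar>t\<bar>\<rfloor> / real (Suc n)) = sample g (grid n t)"
      using eventually_ge_at_top[of N]
      by eventually_elim (use N in \<open>auto simp: grid_def sample_def\<close>)
  qed
qed

lemma norm_sample_le: "(\<And>t. norm (g t) \<le> K) \<Longrightarrow> norm (sample g p) \<le> K"
  by (cases p) (auto simp: sample_def intro: order_trans[OF norm_ge_zero])

lemma even_bcont_measurable: "even_bcont g \<Longrightarrow> g \<in> borel_measurable borel"
  by (auto simp: even_bcont_def intro: borel_measurable_continuous_onI)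

lemma even_bcontE:
  assumes "even_bcont g" obtains K where "K \<ge> 0" "\<And>t. norm (g t) \<le> K"
  using assms unfolding even_bcont_def bounded_pos by (auto intro: less_imp_le)

lemma simple_function_sample: "simple_function borel (\<lambda>t. sample g (grid n t))"
  using simple_function_compose[OF simple_function_grid, of "sample g"] by (simp add: comp_def)

lemma sample_tendsto_L1:
  assumes \<mu>: "complex_measure \<mu>" and g: "even_bcont g"
  shows "(\<lambda>n. \<integral>\<^sup>+t. ennreal (norm (g t - sample g (grid n t))) \<partial>total_variation \<mu>) \<longlonglongrightarrow> 0"
proof -
  interpret finite_measure "total_variation \<mu>" by (rule finite_measure_total_variation[OF \<mu>])
  obtain K where K: "K \<ge> 0" "\<And>t. norm (g t) \<le> K" using even_bcontE[OF g] by metis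
  have "(\<lambda>n. \<integral>\<^sup>+t. ennreal (norm (g t - sample g (grid n t))) \<partial>total_variation \<mu>)
      \<longlonglongrightarrow> (\<integral>\<^sup>+t. 0 \<partial>total_variation \<mu>)"
  proof (rule nn_integral_dominated_convergence[where w = "\<lambda>_. ennreal (2 * K)"])
    show "(\<lambda>t. ennreal (norm (g t - sample g (grid n t)))) \<in> borel_measurable (total_variation \<mu>)" for n
      using measurable_norm_diff_simple[OF even_bcont_measurable[OF g] simple_function_sample[of g n]]
      by (auto simp: measurable_cong_sets[OF sets_total_variation refl])
    have "norm (g t - sample g (grid n t)) \<le> 2 * K" for n t
      using norm_triangle_ineq4[of "g t" "sample g (grid n t)"] K(2)[of t] norm_sample_le[of g K "grid n t", OF K(2)]
      by linarith
    then show "AE t in total_variation \<mu>. ennreal (norm (g t - sample g (grid n t))) \<le> ennreal (2 * K)" for n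
      by (intro AE_I2 ennreal_leI)
    show "(\<integral>\<^sup>+t. ennreal (2 * K) \<partial>total_variation \<mu>) < \<infinity>"
      by (simp add: ennreal_mult_less_top emeasure_eq_measure)
    have "(\<lambda>n. ennreal (norm (g t - sample g (grid n t)))) \<longlonglongrightarrow> ennreal (norm (g t - g t))" for t
      by (intro tendsto_ennrealI tendsto_intros sample_grid_tendsto[OF g])
    then show "AE t in total_variation \<mu>. (\<lambda>n. ennreal (norm (g t - sample g (grid n t)))) \<longlonglongrightarrow> 0"
      by simp
  qed auto
  then show ?thesis by simp
qed

text \<open>
  The integral of an even bounded continuous function is the limit of one explicit sequence of
  Riemann-Stieltjes sums. All properties of \<open>cintegral\<close> used later are read off these sums.
\<close>
lemma cintegral_tendsto:
  fixes g :: "real \<Rightarrow> 'a::complex_banach"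
  assumes \<mu>: "complex_measure \<mu>" and g: "even_bcont g"
  shows "(\<lambda>n. simple_cintegral \<mu> (\<lambda>t. sample g (grid n t))) \<longlonglongrightarrow> cintegral \<mu> g"
proof -
  let ?s = "\<lambda>n t. sample g (grid n t)"
  let ?I = "\<lambda>n. \<integral>\<^sup>+t. ennreal (norm (g t - ?s n t)) \<partial>total_variation \<mu>"
  have lim: "?I \<longlonglongrightarrow> 0" by (rule sample_tendsto_L1[OF \<mu> g])
  have gm: "g \<in> borel_measurable borel" by (rule even_bcont_measurable[OF g])
  have "Cauchy (\<lambda>n. simple_cintegral \<mu> (?s n))"
  proof (rule CauchyI)
    fix e :: real assume e: "0 < e"
    have "\<forall>\<^sub>F n in sequentially. ?I n < ennreal (e / 2)"
      using order_tendstoD(2)[OF lim, of "ennreal (e / 2)"] e by simp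
    then obtain N where N: "\<And>n. n \<ge> N \<Longrightarrow> ?I n < ennreal (e / 2)" by (auto simp: eventually_sequentially)
    show "\<exists>N. \<forall>m\<ge>N. \<forall>n\<ge>N. norm (simple_cintegral \<mu> (?s m) - simple_cintegral \<mu> (?s n)) < e"
    proof (intro exI allI impI)
      fix m n assume mn: "N \<le> m" "N \<le> n"
      have "ennreal (norm (simple_cintegral \<mu> (?s m) - simple_cintegral \<mu> (?s n))) \<le> ?I m + ?I n"
        by (rule simple_cintegral_dist_le[OF \<mu> gm simple_function_sample simple_function_sample])
      also have "\<dots> < ennreal (e / 2) + ennreal (e / 2)" using N[OF mn(1)] N[OF mn(2)] by (rule add_strict_mono)
      also have "\<dots> = ennreal e" using e by (simp flip: ennreal_plus)
      finally show "norm (simple_cintegral \<mu> (?s m) - simple_cintegral \<mu> (?s n)) < e"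
        using e by (simp add: ennreal_less_iff)
    qed
  qed
  then obtain y where y: "(\<lambda>n. simple_cintegral \<mu> (?s n)) \<longlonglongrightarrow> y"
    using Cauchy_convergent_iff convergent_def by blast
  have "has_cintegral \<mu> g y"
    unfolding has_cintegral_def using gm y lim simple_function_sample[of g]
    by (intro conjI exI[of _ ?s]) auto
  then have "cintegral \<mu> g = y" by (rule cintegral_eqI[OF \<mu>])
  then show ?thesis using y by simp
qed

abbreviation cells :: "nat \<Rightarrow> real option set" where "cells n \<equiv> range (grid n)"

lemma finite_cells: "finite (cells n)" and cell_borel: "grid n -` A \<in> sets borel"
  using simple_function_vimage[OF simple_function_grid] by auto

lemma sample_simple_cintegral:
  assumes \<mu>: "complex_measure \<mu>"
  shows "simple_cintegral \<mu> (\<lambda>t. sample g (grid n t)) = (\<Sum>c\<in>cells n. \<mu> (grid n -` {c}) *\<^sub>C sample g c)"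
  by (rule simple_cintegral_compose[OF \<mu> simple_function_grid])

lemma cintegral_sample_tendsto:
  fixes g :: "real \<Rightarrow> 'a::complex_banach"
  assumes \<mu>: "complex_measure \<mu>" and g: "even_bcont g"
  shows "(\<lambda>n. \<Sum>c\<in>cells n. \<mu> (grid n -` {c}) *\<^sub>C sample g c) \<longlonglongrightarrow> cintegral \<mu> g"
  using cintegral_tendsto[OF assms] by (simp add: sample_simple_cintegral[OF \<mu>])

lemma cell_symmetric: "t \<in> grid n -` A \<longleftrightarrow> - t \<in> grid n -` A"
  by (simp add: grid_def)

text \<open>
  The cells are symmetric, so the approximating sums see \<open>\<mu>\<close> on symmetric sets only.
\<close>
lemma cintegral_cong_symmetric:
  fixes g :: "real \<Rightarrow> 'a::complex_banach"
  assumes \<mu>: "complex_measure \<mu>" and \<nu>: "complex_measure \<nu>" and g: "even_bcont g"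
    and eq: "\<And>B. B \<in> sets borel \<Longrightarrow> (\<And>t. t \<in> B \<longleftrightarrow> - t \<in> B) \<Longrightarrow> \<mu> B = \<nu> B"
  shows "cintegral \<mu> g = cintegral \<nu> g"
proof -
  have "\<mu> (grid n -` {c}) = \<nu> (grid n -` {c})" for n c
    by (rule eq[OF cell_borel cell_symmetric])
  then show ?thesis
    using cintegral_sample_tendsto[OF \<mu> g] cintegral_sample_tendsto[OF \<nu> g] LIMSEQ_unique by simp
qed

lemma even_bcont_compose:
  assumes \<psi>: "bounded_linear \<psi>" and g: "even_bcont g"
  shows "even_bcont (\<lambda>t. \<psi> (g t))"
proof -
  have "bounded (\<psi> ` range g)"
    using g by (intro bounded_linear_image[OF _ \<psi>]) (simp add: even_bcont_def)
  moreover have "continuous_on UNIV (\<lambda>t. \<psi> (g t))"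
    by (rule bounded_linear.continuous_on[OF \<psi>]) (use g in \<open>simp add: even_bcont_def\<close>)
  ultimately show ?thesis
    using g unfolding even_bcont_def by (simp add: image_image)
qed

lemma cfunctional_cintegral:
  assumes \<psi>: "cfunctional \<psi>" and \<mu>: "complex_measure \<mu>" and g: "even_bcont g"
  shows "\<psi> (cintegral \<mu> g) = cintegral \<mu> (\<lambda>t. \<psi> (g t))"
proof (rule LIMSEQ_unique)
  have bl: "bounded_linear \<psi>" and hom: "\<psi> (c *\<^sub>C x) = c * \<psi> x" for c x
    using \<psi> by (auto simp: cfunctional_def)
  have "\<psi> (sample g c) = sample (\<lambda>t. \<psi> (g t)) c" for c
    using linear_0[OF bounded_linear.linear[OF bl]] by (auto simp: sample_def split: option.split)
  then have "\<psi> (\<Sum>c\<in>cells n. \<mu> (grid n -` {c}) *\<^sub>C sample g c)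
      = (\<Sum>c\<in>cells n. \<mu> (grid n -` {c}) *\<^sub>C sample (\<lambda>t. \<psi> (g t)) c)" for n
    by (simp add: linear_sum[OF bounded_linear.linear[OF bl]] hom scaleC_complex_def)
  then show "(\<lambda>n. \<Sum>c\<in>cells n. \<mu> (grid n -` {c}) *\<^sub>C sample (\<lambda>t. \<psi> (g t)) c) \<longlonglongrightarrow> \<psi> (cintegral \<mu> g)"
    using bounded_linear.tendsto[OF bl cintegral_sample_tendsto[OF \<mu> g]] by simp
  show "(\<lambda>n. \<Sum>c\<in>cells n. \<mu> (grid n -` {c}) *\<^sub>C sample (\<lambda>t. \<psi> (g t)) c) \<longlonglongrightarrow> cintegral \<mu> (\<lambda>t. \<psi> (g t))"
    by (rule cintegral_sample_tendsto[OF \<mu> even_bcont_compose[OF bl g]])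
qed

lemma norm_cintegral_le:
  fixes g :: "real \<Rightarrow> 'a::complex_banach"
  assumes \<mu>: "complex_measure \<mu>" and g: "even_bcont g" and K: "\<And>t. norm (g t) \<le> K"
    and V: "\<And>n. (\<Sum>c\<in>cells n. cmod (\<mu> (grid n -` {c}))) \<le> V"
  shows "norm (cintegral \<mu> g) \<le> V * K"
proof (rule LIMSEQ_le_const2[OF tendsto_norm[OF cintegral_sample_tendsto[OF \<mu> g]]], intro exI allI impI)
  fix n
  have K0: "K \<ge> 0" using K[of 0] norm_ge_zero order_trans by blast
  have "norm (\<Sum>c\<in>cells n. \<mu> (grid n -` {c}) *\<^sub>C sample g c)
      \<le> (\<Sum>c\<in>cells n. cmod (\<mu> (grid n -` {c})) * K)"
    by (intro order_trans[OF norm_sum] sum_mono) (simp add: norm_scaleC mult_left_mono norm_sample_le K)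
  also have "\<dots> \<le> V * K"
    using V[of n] K0 by (simp add: sum_distrib_right[symmetric] mult_right_mono)
  finally show "norm (\<Sum>c\<in>cells n. \<mu> (grid n -` {c}) *\<^sub>C sample g c) \<le> V * K" .
qed

lemma sum_cells_le_variation:
  assumes \<mu>: "complex_measure \<mu>"
  shows "(\<Sum>c\<in>cells n. cmod (\<mu> (grid n -` {c}))) \<le> enn2real (variation \<mu> UNIV)"
proof -
  have "(\<Sum>c\<in>cells n. ennreal (cmod (\<mu> (grid n -` {c})))) \<le> variation \<mu> UNIV"
    by (rule variation_ge[OF \<mu> finite_cells cell_borel]) (auto simp: disjoint_family_on_def)
  then have "ennreal (\<Sum>c\<in>cells n. cmod (\<mu> (grid n -` {c}))) \<le> variation \<mu> UNIV"
    by (subst sum_ennreal[symmetric]) auto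
  then have "enn2real (ennreal (\<Sum>c\<in>cells n. cmod (\<mu> (grid n -` {c})))) \<le> enn2real (variation \<mu> UNIV)"
    by (rule enn2real_mono) (use variation_finite[OF \<mu>] in simp)
  then show ?thesis by (subst (asm) enn2real_ennreal) (auto intro: sum_nonneg)
qed

section \<open>Injectivity of the cosine transform\<close>

lemma complex_measure_diff:
  "complex_measure \<mu> \<Longrightarrow> complex_measure \<nu> \<Longrightarrow> complex_measure (\<lambda>B. \<mu> B - \<nu> B)"
  unfolding complex_measure_def by (intro allI impI sums_diff) simp_all

lemma complex_measure_cmult: "complex_measure \<mu> \<Longrightarrow> complex_measure (\<lambda>B. c * \<mu> B)"
  unfolding complex_measure_def by (intro allI impI sums_mult) simp_all

lemma even_bcont_cos: "even_bcont (\<lambda>s. complex_of_real (cos (s * t)))"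
  unfolding even_bcont_def
  by (auto intro!: continuous_intros boundedI[of _ 1] simp: norm_of_real)

lemma cosine_transform_tendsto:
  assumes "complex_measure \<mu>"
  shows "(\<lambda>n. \<Sum>c\<in>cells n. \<mu> (grid n -` {c}) * sample (\<lambda>s. complex_of_real (cos (s * t))) c)
    \<longlonglongrightarrow> cosine_transform \<mu> t"
  using cintegral_sample_tendsto[OF assms even_bcont_cos] by (simp add: cosine_transform_def scaleC_complex_def)

text \<open>
  As \<open>|Re \<rho>| \<le> \<tau>\<close>, the set functions \<open>\<tau> + k Re \<rho>\<close> with \<open>|k| \<le> 1\<close> are positive measures. They allow to
  test \<open>Re \<rho>\<close> with uniqueness theorems for positive measures; symmetrising makes their
  characteristic functions real.
\<close>
lemma symmetrised_measure_exists:
  assumes \<rho>: "complex_measure \<rho>" and k: "\<bar>k\<bar> \<le> (1::real)"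
  defines "\<tau> \<equiv> measure (total_variation \<rho>)"
  obtains m :: "real measure" where "finite_measure m" "sets m = sets borel"
    "\<And>B. B \<in> sets borel \<Longrightarrow> measure m B = \<tau> B + \<tau> (uminus -` B) + k * (Re (\<rho> B) + Re (\<rho> (uminus -` B)))"
proof -
  interpret T: finite_measure "total_variation \<rho>" by (rule finite_measure_total_variation[OF \<rho>])
  define \<sigma> where "\<sigma> B = (\<tau> B + k * Re (\<rho> B)) + (\<tau> (uminus -` B) + k * Re (\<rho> (uminus -` B)))" for B
  have um: "uminus -` B \<in> sets borel" if "B \<in> sets borel" for B :: "real set"
    using measurable_sets[of uminus borel borel B] that by simp
  have le: "cmod (\<rho> B) \<le> \<tau> B" if "B \<in> sets borel" for B
    using norm_le_variation[OF \<rho> that] unfolding \<tau>_def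
    by (simp add: emeasure_total_variation[OF \<rho> that, symmetric] T.emeasure_eq_measure)
  have pos1: "0 \<le> \<tau> B + k * Re (\<rho> B)" if "B \<in> sets borel" for B
  proof -
    have "\<bar>k * Re (\<rho> B)\<bar> \<le> 1 * cmod (\<rho> B)"
      unfolding abs_mult by (rule mult_mono) (use k abs_Re_le_cmod in auto)
    then show ?thesis using le[OF that] by linarith
  qed
  have pos: "0 \<le> \<sigma> B" if "B \<in> sets borel" for B
    using pos1[OF that] pos1[OF um[OF that]] by (simp add: \<sigma>_def)
  have sums1: "(\<lambda>n. \<tau> (E n) + k * Re (\<rho> (E n))) sums (\<tau> (\<Union>n. E n) + k * Re (\<rho> (\<Union>n. E n)))"
    if "range E \<subseteq> sets borel" "disjoint_family E" for E :: "nat \<Rightarrow> real set"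
    unfolding \<tau>_def using that
    by (intro sums_add sums_mult sums_Re complex_measure_sums[OF \<rho>] T.finite_measure_UNION) auto
  have sums: "(\<lambda>n. \<sigma> (E n)) sums \<sigma> (\<Union>n. E n)"
    if E: "range E \<subseteq> sets borel" "disjoint_family E" for E :: "nat \<Rightarrow> real set"
  proof -
    have "range (\<lambda>n. uminus -` E n) \<subseteq> sets borel" "disjoint_family (\<lambda>n. uminus -` E n)"
      using E um by (auto simp: disjoint_family_on_def)
    from sums_add[OF sums1[OF E] sums1[OF this]] show ?thesis
      by (simp add: \<sigma>_def vimage_UN)
  qed
  define m where "m = measure_of UNIV (sets borel) (\<lambda>B. ennreal (\<sigma> B))"
  have sets: "sets m = sets borel"
    using sets.sigma_sets_eq[of borel] by (simp add: m_def sets_measure_of_conv)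
  have em: "emeasure m B = ennreal (\<sigma> B)" if "B \<in> sets borel" for B
    unfolding m_def
  proof (rule emeasure_measure_of_sigma[OF _ _ _ that])
    show "sigma_algebra UNIV (sets borel :: real set set)" using sets.sigma_algebra_axioms[of borel] by simp
    show "positive (sets borel) (\<lambda>B. ennreal (\<sigma> B))"
      by (simp add: positive_def \<sigma>_def complex_measure_empty[OF \<rho>] \<tau>_def)
    show "countably_additive (sets borel) (\<lambda>B. ennreal (\<sigma> B))"
    proof (rule countably_additiveI)
      fix E :: "nat \<Rightarrow> real set" assume E: "range E \<subseteq> sets borel" "disjoint_family E" "(\<Union>i. E i) \<in> sets borel"
      have "(\<lambda>i. ennreal (\<sigma> (E i))) sums ennreal (\<sigma> (\<Union>i. E i))"
        using sums[OF E(1,2)] E by (subst sums_ennreal) (auto intro!: pos)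
      then show "(\<Sum>i. ennreal (\<sigma> (E i))) = ennreal (\<sigma> (\<Union>i. E i))" by (rule sums_unique[symmetric])
    qed
  qed
  have "finite_measure m"
    using em[of UNIV] sets_eq_imp_space_eq[OF sets] by (intro finite_measureI) simp
  moreover have "measure m B = \<tau> B + \<tau> (uminus -` B) + k * (Re (\<rho> B) + Re (\<rho> (uminus -` B)))" if "B \<in> sets borel" for B
    using em[OF that] pos[OF that] by (simp add: measure_def \<sigma>_def algebra_simps)
  ultimately show ?thesis using sets that by blast
qed

lemma integral_sample_tendsto:
  fixes h :: "real \<Rightarrow> real"
  assumes m: "finite_measure m" and sets: "sets m = sets borel" and h: "even_bcont h"
  shows "(\<lambda>n. \<Sum>c\<in>cells n. measure m (grid n -` {c}) * sample h c) \<longlonglongrightarrow> (\<integral>t. h t \<partial>m)"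
proof -
  interpret finite_measure m by (rule m)
  have sp: "space m = UNIV" using sets_eq_imp_space_eq[OF sets] by simp
  obtain K where K: "K \<ge> 0" "\<And>t. norm (h t) \<le> K" using even_bcontE[OF h] by metis
  have meas: "f \<in> borel_measurable borel \<Longrightarrow> f \<in> borel_measurable m" for f :: "real \<Rightarrow> real"
    by (simp add: measurable_cong_sets[OF sets refl])
  have "(\<lambda>n. \<integral>t. sample h (grid n t) \<partial>m) \<longlonglongrightarrow> (\<integral>t. h t \<partial>m)"
  proof (rule integral_dominated_convergence[where w = "\<lambda>_. K"])
    show "(\<lambda>t. sample h (grid n t)) \<in> borel_measurable m" for n
      by (intro meas borel_measurable_simple_function simple_function_sample)
    show "h \<in> borel_measurable m" by (rule meas[OF even_bcont_measurable[OF h]])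
    show "AE t in m. (\<lambda>n. sample h (grid n t)) \<longlonglongrightarrow> h t"
      by (intro AE_I2 sample_grid_tendsto[OF h])
    show "AE t in m. norm (sample h (grid n t)) \<le> K" for n
      by (intro AE_I2 norm_sample_le K)
  qed simp
  moreover have "(\<integral>t. sample h (grid n t) \<partial>m) = (\<Sum>c\<in>cells n. measure m (grid n -` {c}) * sample h c)" for n
  proof -
    have "(\<integral>t. sample h (grid n t) \<partial>m) = (\<integral>t. (\<Sum>c\<in>cells n. indicat_real (grid n -` {c}) t * sample h c) \<partial>m)"
    proof (rule Bochner_Integration.integral_cong[OF refl])
      fix t
      have "(\<Sum>c\<in>cells n. indicat_real (grid n -` {c}) t * sample h c) = (\<Sum>c\<in>cells n. if c = grid n t then sample h c else 0)"
        by (intro sum.cong refl) auto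
      then show "sample h (grid n t) = (\<Sum>c\<in>cells n. indicat_real (grid n -` {c}) t * sample h c)"
        using finite_cells[of n] by simp
    qed
    also have "\<dots> = (\<Sum>c\<in>cells n. \<integral>t. indicat_real (grid n -` {c}) t * sample h c \<partial>m)"
      using cell_borel sets by (intro Bochner_Integration.integral_sum) (auto simp: emeasure_eq_measure)
    also have "\<dots> = (\<Sum>c\<in>cells n. measure m (grid n -` {c}) * sample h c)"
      using sp by simp
    finally show ?thesis .
  qed
  ultimately show ?thesis by simp
qed

text \<open>
  Normalising to total mass \<open>1\<close> reduces this to Levy's theorem for probability measures; the masses
  agree since they are the values of the characteristic functions at \<open>0\<close>.
\<close>
lemma finite_measure_eqI_char:
  fixes m m' :: "real measure"
  assumes m: "finite_measure m" "sets m = sets borel" and m': "finite_measure m'" "sets m' = sets borel"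
    and char: "char m = char m'"
  shows "m = m'"
proof -
  have sp: "space m = UNIV" "space m' = UNIV"
    using sets_eq_imp_space_eq[OF m(2)] sets_eq_imp_space_eq[OF m'(2)] by auto
  define M where "M = measure m UNIV"
  have M': "measure m' UNIV = M"
    using fun_cong[OF char, of 0] sp by (simp add: char_def M_def scaleR_conv_of_real)
  note em = finite_measure.emeasure_eq_measure[OF m(1)] finite_measure.emeasure_eq_measure[OF m'(1)]
  show ?thesis
  proof (cases "M = 0")
    case True
    then have "emeasure m B = 0" "emeasure m' B = 0" for B
      using em M' emeasure_mono[of B UNIV m] emeasure_mono[of B UNIV m'] m(2) m'(2)
      by (auto simp: M_def)
    then show ?thesis by (intro measure_eqI) (auto simp: m m')
  next
    case False
    then have M: "M > 0" unfolding M_def by (simp add: less_le)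
    define N where "N m = density m (\<lambda>_::real. ennreal (1 / M))" for m
    have rd: "real_distribution (N m)" "char (N m) t = char m t / M"
      if "finite_measure m" "sets m = sets borel" "measure m UNIV = M" for m t
    proof -
      have sp: "space m = UNIV" using sets_eq_imp_space_eq[OF that(2)] by simp
      have "emeasure (N m) UNIV = 1"
        using M that sp finite_measure.emeasure_eq_measure[OF that(1), of UNIV]
        by (simp add: N_def emeasure_density nn_integral_cmult flip: ennreal_mult)
      then have "prob_space (N m)" by (intro prob_spaceI) (simp add: N_def sp)
      then show "real_distribution (N m)"
        by (simp add: real_distribution_def real_distribution_axioms_def N_def that(2))
      show "char (N m) t = char m t / M"
        unfolding char_def N_def using M that(2)
        by (subst integral_density)
          (auto simp: measurable_cong_sets[OF that(2) refl] scaleR_conv_of_real divide_inverse mult.commute)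
    qed
    have "N m = N m'"
      by (rule Levy_uniqueness) (use rd[OF m] rd[OF m'] M' char in \<open>auto simp: M_def[symmetric] fun_eq_iff\<close>)
    then have eq: "ennreal (1 / M) * emeasure m B = ennreal (1 / M) * emeasure m' B" if "B \<in> sets borel" for B
      using emeasure_density_const[of B m "ennreal (1 / M)"] emeasure_density_const[of B m' "ennreal (1 / M)"]
        that m(2) m'(2) by (simp add: N_def)
    show ?thesis
    proof (rule measure_eqI)
      fix B assume "B \<in> sets m"
      then have "ennreal M * (ennreal (1 / M) * emeasure m B) = ennreal M * (ennreal (1 / M) * emeasure m' B)"
        using eq[of B] m by simp
      then show "emeasure m B = emeasure m' B"
        using M by (simp add: mult.assoc[symmetric] flip: ennreal_mult)
    qed (simp add: m m')
  qed
qed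

lemma symmetric_measure_char:
  assumes m: "finite_measure m" and sets: "sets m = sets borel"
    and sym: "\<And>B. B \<in> sets borel \<Longrightarrow> measure m (uminus -` B) = measure m B"
  shows "char m t = complex_of_real (\<integral>x. cos (x * t) \<partial>m)"
proof -
  interpret finite_measure m by (rule m)
  have sp: "space m = UNIV" using sets_eq_imp_space_eq[OF sets] by simp
  have meas: "f \<in> borel_measurable borel \<Longrightarrow> f \<in> borel_measurable m" for f :: "real \<Rightarrow> 'b::topological_space"
    by (simp add: measurable_cong_sets[OF sets refl])
  have um: "uminus \<in> measurable m m" using measurable_cong_sets[OF sets sets] by simp
  have "distr m m uminus = m"
    by (rule measure_eqI) (use um sets sym sp in \<open>auto simp: emeasure_distr emeasure_eq_measure\<close>)
  then have "(\<integral>x. sin (t * x) \<partial>m) = (\<integral>x. sin (t * - x) \<partial>m)"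
    using integral_distr[OF um, of "\<lambda>x. sin (t * x)"] by (simp add: meas)
  then have s: "(\<integral>x. sin (t * x) \<partial>m) = 0" by simp
  have int: "integrable m (\<lambda>x. iexp (t * x))"
    by (rule integrable_const_bound[of _ 1]) (auto intro!: meas)
  show ?thesis
  proof (rule complex_eqI)
    show "Re (char m t) = Re (complex_of_real (\<integral>x. cos (x * t) \<partial>m))"
      unfolding char_def using integral_Re[OF int] by (simp add: mult.commute Re_exp)
    show "Im (char m t) = Im (complex_of_real (\<integral>x. cos (x * t) \<partial>m))"
      unfolding char_def using integral_Im[OF int] s by (simp add: Im_exp)
  qed
qed

text \<open>
  The symmetrised measures \<open>\<tau> + Re \<rho>\<close> and \<open>\<tau>\<close> differ in their characteristic functions by twice the
  real part of the cosine transform of \<open>\<rho>\<close>. If that is zero they coincide.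
\<close>
lemma cosine_transform_zero_imp_Re_zero:
  assumes \<rho>: "complex_measure \<rho>" and zero: "\<And>t. cosine_transform \<rho> t = 0"
    and B: "B \<in> sets borel" and sym: "\<And>t. t \<in> B \<longleftrightarrow> - t \<in> B"
  shows "Re (\<rho> B) = 0"
proof -
  define \<tau> where "\<tau> = measure (total_variation \<rho>)"
  obtain m1 :: "real measure" where m1: "finite_measure m1" "sets m1 = sets borel"
    "\<And>B. B \<in> sets borel \<Longrightarrow> measure m1 B = \<tau> B + \<tau> (uminus -` B) + 1 * (Re (\<rho> B) + Re (\<rho> (uminus -` B)))"
    using symmetrised_measure_exists[OF \<rho>, of 1] unfolding \<tau>_def by auto
  obtain m0 :: "real measure" where m0: "finite_measure m0" "sets m0 = sets borel"
    "\<And>B. B \<in> sets borel \<Longrightarrow> measure m0 B = \<tau> B + \<tau> (uminus -` B) + 0 * (Re (\<rho> B) + Re (\<rho> (uminus -` B)))"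
    using symmetrised_measure_exists[OF \<rho>, of 0] unfolding \<tau>_def by auto
  have um: "uminus -` B \<in> sets borel" if "B \<in> sets borel" for B :: "real set"
    using measurable_sets[of uminus borel borel B] that by simp
  have inv: "uminus -` uminus -` B = B" for B :: "real set" by auto
  have symm: "measure m (uminus -` B) = measure m B" if "m = m0 \<or> m = m1" "B \<in> sets borel" for m B
    using that m0(3) m1(3) um by (auto simp: inv)
  have cell: "uminus -` (grid n -` A) = grid n -` A" for n A using cell_symmetric by blast
  have "(\<integral>x. cos (x * t) \<partial>m1) - (\<integral>x. cos (x * t) \<partial>m0) = 2 * Re (cosine_transform \<rho> t)" for t
  proof (rule LIMSEQ_unique)
    have h: "even_bcont (\<lambda>x. cos (x * t))"
      unfolding even_bcont_def by (auto intro!: continuous_intros boundedI[of _ 1])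
    have cc: "sample (\<lambda>s. complex_of_real (cos (s * t))) c = complex_of_real (sample (\<lambda>s. cos (s * t)) c)" for c
      by (auto simp: sample_def split: option.split)
    have "(\<Sum>c\<in>cells n. measure m1 (grid n -` {c}) * sample (\<lambda>x. cos (x * t)) c)
        - (\<Sum>c\<in>cells n. measure m0 (grid n -` {c}) * sample (\<lambda>x. cos (x * t)) c)
        = 2 * Re (\<Sum>c\<in>cells n. \<rho> (grid n -` {c}) * sample (\<lambda>s. complex_of_real (cos (s * t))) c)" for n
      unfolding sum_subtractf[symmetric] m1(3)[OF cell_borel] m0(3)[OF cell_borel] cell Re_sum sum_distrib_left cc
      by (intro sum.cong refl) (simp add: algebra_simps)
    then show "(\<lambda>n. 2 * Re (\<Sum>c\<in>cells n. \<rho> (grid n -` {c}) * sample (\<lambda>s. complex_of_real (cos (s * t))) c))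
        \<longlonglongrightarrow> (\<integral>x. cos (x * t) \<partial>m1) - (\<integral>x. cos (x * t) \<partial>m0)"
      using tendsto_diff[OF integral_sample_tendsto[OF m1(1,2) h] integral_sample_tendsto[OF m0(1,2) h]] by simp
    show "(\<lambda>n. 2 * Re (\<Sum>c\<in>cells n. \<rho> (grid n -` {c}) * sample (\<lambda>s. complex_of_real (cos (s * t))) c))
        \<longlonglongrightarrow> 2 * Re (cosine_transform \<rho> t)"
      by (intro tendsto_intros cosine_transform_tendsto[OF \<rho>])
  qed
  then have "char m1 = char m0"
    using zero symm by (intro ext) (simp add: symmetric_measure_char[OF m1(1,2)] symmetric_measure_char[OF m0(1,2)])
  then have "m1 = m0" by (rule finite_measure_eqI_char[OF m1(1,2) m0(1,2)])
  moreover have "uminus -` B = B" using sym by auto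
  ultimately show ?thesis using m1(3)[OF B] m0(3)[OF B] by simp
qed

theorem cosine_transform_determines_symmetric_part:
  assumes \<mu>: "complex_measure \<mu>" and \<nu>: "complex_measure \<nu>"
    and eq: "cosine_transform \<mu> = cosine_transform \<nu>"
    and B: "B \<in> sets borel" and sym: "\<And>t. t \<in> B \<longleftrightarrow> - t \<in> B"
  shows "\<mu> B = \<nu> B"
proof -
  define \<rho> where "\<rho> B = \<mu> B - \<nu> B" for B
  have \<rho>: "complex_measure \<rho>" unfolding \<rho>_def by (rule complex_measure_diff[OF \<mu> \<nu>])
  have zero: "cosine_transform \<rho> t = 0" for t
  proof (rule LIMSEQ_unique[OF cosine_transform_tendsto[OF \<rho>]])
    show "(\<lambda>n. \<Sum>c\<in>cells n. \<rho> (grid n -` {c}) * sample (\<lambda>s. complex_of_real (cos (s * t))) c) \<longlonglongrightarrow> 0"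
      using tendsto_diff[OF cosine_transform_tendsto[OF \<mu>, of t] cosine_transform_tendsto[OF \<nu>, of t]] eq
      by (simp add: \<rho>_def left_diff_distrib sum_subtractf)
  qed
  \<comment> \<open>the imaginary part of \<open>\<rho>\<close> is the real part of \<open>- i \<rho>\<close>\<close>
  have i\<rho>: "complex_measure (\<lambda>B. - \<i> * \<rho> B)" by (rule complex_measure_cmult[OF \<rho>])
  have "cosine_transform (\<lambda>B. - \<i> * \<rho> B) t = 0" for t
  proof (rule LIMSEQ_unique[OF cosine_transform_tendsto[OF i\<rho>]])
    show "(\<lambda>n. \<Sum>c\<in>cells n. - \<i> * \<rho> (grid n -` {c}) * sample (\<lambda>s. complex_of_real (cos (s * t))) c) \<longlonglongrightarrow> 0"
      using tendsto_mult[OF tendsto_const cosine_transform_tendsto[OF \<rho>, of t], of "- \<i>"] zero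
      by (simp add: sum_distrib_left mult.assoc del: mult_minus_left)
  qed
  then have "Re (- \<i> * \<rho> B) = 0" by (intro cosine_transform_zero_imp_Re_zero[OF i\<rho> _ B sym])
  moreover have "Re (\<rho> B) = 0" by (rule cosine_transform_zero_imp_Re_zero[OF \<rho> zero B sym])
  ultimately have "\<rho> B = 0" by (simp add: complex_eq_iff)
  then show ?thesis by (simp add: \<rho>_def)
qed

section \<open>Measures with densities\<close>

definition density_measure :: "(real \<Rightarrow> complex) \<Rightarrow> real set \<Rightarrow> complex"
  where "density_measure g B = (LINT s:B|lborel. g s)"

lemma set_integrable_lborel_subset:
  "integrable lborel g \<Longrightarrow> B \<in> sets borel \<Longrightarrow> set_integrable lborel B (g :: real \<Rightarrow> complex)"
  unfolding set_integrable_def by (rule integrable_mult_indicator) auto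

lemma complex_measure_density:
  assumes g: "integrable lborel g"
  shows "complex_measure (density_measure g)"
  unfolding complex_measure_def
proof (intro allI impI)
  fix E :: "nat \<Rightarrow> real set" assume E: "range E \<subseteq> sets borel" "disjoint_family E"
  then have E': "E n \<in> sets borel" for n by auto
  have "density_measure g (\<Union>i<n. E i) = (\<Sum>i<n. density_measure g (E i))" for n
    unfolding density_measure_def
    by (rule set_integral_finite_Union)
      (use E E' g set_integrable_lborel_subset in \<open>auto simp: disjoint_family_on_def\<close>)
  moreover have "incseq (\<lambda>n. \<Union>i<n. E i)" unfolding incseq_def by (intro allI impI UN_mono) auto
  then have "(\<lambda>n. density_measure g (\<Union>i<n. E i)) \<longlonglongrightarrow> density_measure g (\<Union>n. \<Union>i<n. E i)"
    unfolding density_measure_def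
    by (intro set_integral_cont_up set_integrable_lborel_subset g) (use E' in auto)
  moreover have "(\<Union>n. \<Union>i<n. E i) = (\<Union>n. E n)" by auto
  ultimately show "(\<lambda>n. density_measure g (E n)) sums density_measure g (\<Union>n. E n)"
    by (simp add: sums_def)
qed

lemma integrable_mult_bounded:
  fixes g h :: "'b \<Rightarrow> complex"
  assumes g: "integrable N g" and h: "h \<in> borel_measurable N" and K: "\<And>t. cmod (h t) \<le> K"
  shows "integrable N (\<lambda>t. g t * h t)"
proof (rule Bochner_Integration.integrable_bound)
  show "integrable N (\<lambda>t. K * cmod (g t))" using g by simp
  show "(\<lambda>t. g t * h t) \<in> borel_measurable N" using g h by measurable
  have "K \<ge> 0" using K norm_ge_zero order_trans by blast
  then show "AE t in N. norm (g t * h t) \<le> norm (K * cmod (g t))"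
    using K by (intro AE_I2) (simp add: norm_mult mult.commute[of K] mult_left_mono)
qed

lemma cintegral_density_measure:
  fixes h :: "real \<Rightarrow> complex"
  assumes g: "integrable lborel g" and h: "even_bcont h"
  shows "cintegral (density_measure g) h = (\<integral>s. g s * h s \<partial>lborel)"
proof (rule LIMSEQ_unique[OF cintegral_sample_tendsto[OF complex_measure_density[OF g] h]])
  obtain K where K: "K \<ge> 0" "\<And>t. norm (h t) \<le> K" using even_bcontE[OF h] by metis
  have gm: "g \<in> borel_measurable lborel" using g by simp
  have hm: "h \<in> borel_measurable lborel" using even_bcont_measurable[OF h] by simp
  have sm: "(\<lambda>t. sample h (grid n t)) \<in> borel_measurable lborel" for n
    using borel_measurable_simple_function[OF simple_function_sample[of h n]] by simp
  have "(\<Sum>c\<in>cells n. density_measure g (grid n -` {c}) *\<^sub>C sample h c) = (\<integral>s. g s * sample h (grid n s) \<partial>lborel)" for n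
  proof -
    have "(\<Sum>c\<in>cells n. density_measure g (grid n -` {c}) *\<^sub>C sample h c)
        = (\<Sum>c\<in>cells n. (\<integral>s. (indicat_real (grid n -` {c}) s *\<^sub>R g s) * sample h c \<partial>lborel))"
      unfolding density_measure_def set_lebesgue_integral_def scaleC_complex_def integral_mult_left_zero ..
    also have "\<dots> = (\<integral>s. (\<Sum>c\<in>cells n. (indicat_real (grid n -` {c}) s *\<^sub>R g s) * sample h c) \<partial>lborel)"
      using cell_borel g
      by (intro Bochner_Integration.integral_sum[symmetric] integrable_mult_left integrable_mult_indicator) auto
    also have "\<dots> = (\<integral>s. g s * sample h (grid n s) \<partial>lborel)"
    proof (rule Bochner_Integration.integral_cong[OF refl])
      fix s
      have "(\<Sum>c\<in>cells n. (indicat_real (grid n -` {c}) s *\<^sub>R g s) * sample h c)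
          = (\<Sum>c\<in>cells n. if c = grid n s then g s * sample h c else 0)"
        by (intro sum.cong refl) auto
      then show "(\<Sum>c\<in>cells n. (indicat_real (grid n -` {c}) s *\<^sub>R g s) * sample h c) = g s * sample h (grid n s)"
        using finite_cells[of n] by simp
    qed
    finally show ?thesis .
  qed
  moreover have "(\<lambda>n. \<integral>s. g s * sample h (grid n s) \<partial>lborel) \<longlonglongrightarrow> (\<integral>s. g s * h s \<partial>lborel)"
  proof (rule integral_dominated_convergence[where w = "\<lambda>s. cmod (g s) * K"])
    show "AE s in lborel. norm (g s * sample h (grid n s)) \<le> cmod (g s) * K" for n
      by (intro AE_I2) (simp add: norm_mult mult_left_mono norm_sample_le K)
    show "AE s in lborel. (\<lambda>n. g s * sample h (grid n s)) \<longlonglongrightarrow> g s * h s"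
      by (intro AE_I2 tendsto_intros sample_grid_tendsto[OF h])
  qed (use gm hm sm g in auto)
  ultimately show "(\<lambda>n. \<Sum>c\<in>cells n. density_measure g (grid n -` {c}) *\<^sub>C sample h c) \<longlonglongrightarrow> (\<integral>s. g s * h s \<partial>lborel)"
    by simp
qed

lemma sum_cells_density_le:
  assumes g: "integrable lborel g"
  shows "(\<Sum>c\<in>cells n. cmod (density_measure g (grid n -` {c}))) \<le> (\<integral>s. cmod (g s) \<partial>lborel)"
proof -
  have "(\<Sum>c\<in>cells n. cmod (density_measure g (grid n -` {c}))) \<le> (\<Sum>c\<in>cells n. \<integral>s. indicat_real (grid n -` {c}) s * cmod (g s) \<partial>lborel)"
    unfolding density_measure_def set_lebesgue_integral_def
    by (intro sum_mono order_trans[OF integral_norm_bound]) simp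
  also have "\<dots> = (\<integral>s. (\<Sum>c\<in>cells n. indicat_real (grid n -` {c}) s * cmod (g s)) \<partial>lborel)"
    using integrable_mult_indicator[OF _ integrable_norm[OF g]] cell_borel
    by (intro Bochner_Integration.integral_sum[symmetric]) auto
  also have "\<dots> = (\<integral>s. cmod (g s) \<partial>lborel)"
  proof (rule Bochner_Integration.integral_cong[OF refl])
    fix s
    have "(\<Sum>c\<in>cells n. indicat_real (grid n -` {c}) s * cmod (g s)) = (\<Sum>c\<in>cells n. if c = grid n s then cmod (g s) else 0)"
      by (intro sum.cong refl) auto
    then show "(\<Sum>c\<in>cells n. indicat_real (grid n -` {c}) s * cmod (g s)) = cmod (g s)"
      using finite_cells[of n] by simp
  qed
  finally show ?thesis .
qed

lemma cosine_transform_density_measure: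
  "integrable lborel g \<Longrightarrow>
    cosine_transform (density_measure g) t = (\<integral>s. g s * complex_of_real (cos (s * t)) \<partial>lborel)"
  unfolding cosine_transform_def by (rule cintegral_density_measure[OF _ even_bcont_cos])

section \<open>Convolution and cosine kernels\<close>

definition convolve :: "(real \<Rightarrow> complex) \<Rightarrow> (real \<Rightarrow> complex) \<Rightarrow> real \<Rightarrow> complex"
  where "convolve g h u = (\<integral>s. g s * h (u - s) \<partial>lborel)"

lemma integrable_shift:
  fixes h :: "real \<Rightarrow> complex"
  assumes "integrable lborel h"
  shows "integrable lborel (\<lambda>u. h (u - s))"
  using lborel_integrable_real_affine[OF assms, of 1 "- s"] by (simp add: add.commute)

lemma integral_shift:
  fixes h :: "real \<Rightarrow> 'a::{banach, second_countable_topology}"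
  shows "(\<integral>u. h (u - s) \<partial>lborel) = (\<integral>u. h u \<partial>lborel)"
  using lborel_integral_real_affine[of 1 h "- s"] by (simp add: add.commute)

lemma integral_reflect_lborel:
  fixes h :: "real \<Rightarrow> 'a::{banach, second_countable_topology}"
  shows "(\<integral>u. h (- u) \<partial>lborel) = (\<integral>u. h u \<partial>lborel)"
  using lborel_integral_real_affine[of "-1" h 0] by simp

text \<open>
  Integrated over \<open>u\<close> first, the absolute value gives \<open>|g(s)|\<close> times the norm of \<open>h\<close>.
\<close>
lemma integrable_convolution_integrand:
  fixes g h :: "real \<Rightarrow> complex"
  assumes g: "integrable lborel g" and h: "integrable lborel h"
  shows "integrable (lborel \<Otimes>\<^sub>M lborel) (\<lambda>(s, u). g s * h (u - s))"
proof (rule lborel_pair.Fubini_integrable)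
  have [measurable]: "g \<in> borel_measurable borel" "h \<in> borel_measurable borel" using g h by auto
  show "(\<lambda>(s, u). g s * h (u - s)) \<in> borel_measurable (lborel \<Otimes>\<^sub>M lborel)" by measurable
  have "(\<integral>u. norm (case (s, u) of (s, u) \<Rightarrow> g s * h (u - s)) \<partial>lborel) = cmod (g s) * (\<integral>u. cmod (h u) \<partial>lborel)" for s
    using integral_shift[of "\<lambda>u. cmod (h u)" s] by (simp add: norm_mult)
  then show "integrable lborel (\<lambda>s. \<integral>u. norm (case (s, u) of (s, u) \<Rightarrow> g s * h (u - s)) \<partial>lborel)"
    using g by simp
  show "AE s in lborel. integrable lborel (\<lambda>u. case (s, u) of (s, u) \<Rightarrow> g s * h (u - s))"
    by (intro AE_I2) (simp add: integrable_shift[OF h])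
qed

lemma integrable_convolve:
  fixes g h :: "real \<Rightarrow> complex"
  assumes "integrable lborel g" "integrable lborel h"
  shows "integrable lborel (convolve g h)"
  using lborel_pair.integrable_snd[OF integrable_convolution_integrand[OF assms]]
  by (simp add: convolve_def[abs_def])

lemma integral_convolve:
  fixes g h c :: "real \<Rightarrow> complex"
  assumes g: "integrable lborel g" and h: "integrable lborel h"
    and c: "c \<in> borel_measurable borel" "\<And>u. cmod (c u) \<le> K"
  shows "(\<integral>u. convolve g h u * c u \<partial>lborel) = (\<integral>s. g s * (\<integral>t. h t * c (s + t) \<partial>lborel) \<partial>lborel)"
proof -
  have "integrable (lborel \<Otimes>\<^sub>M lborel) (\<lambda>p. (case p of (s, u) \<Rightarrow> g s * h (u - s)) * c (snd p))"
    by (rule integrable_mult_bounded[OF integrable_convolution_integrand[OF g h] _ c(2)]) (use c(1) in measurable)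
  then have int: "integrable (lborel \<Otimes>\<^sub>M lborel) (\<lambda>(s, u). g s * h (u - s) * c u)"
    by (simp add: split_def)
  have "(\<integral>u. convolve g h u * c u \<partial>lborel) = (\<integral>u. (\<integral>s. g s * h (u - s) * c u \<partial>lborel) \<partial>lborel)"
    by (simp add: convolve_def)
  also have "\<dots> = (\<integral>s. (\<integral>u. g s * h (u - s) * c u \<partial>lborel) \<partial>lborel)"
    by (rule lborel_pair.Fubini_integral[OF int])
  also have "\<dots> = (\<integral>s. g s * (\<integral>t. h t * c (s + t) \<partial>lborel) \<partial>lborel)"
  proof (rule Bochner_Integration.integral_cong[OF refl])
    fix s
    have "(\<integral>u. g s * h (u - s) * c u \<partial>lborel) = g s * (\<integral>u. h (u - s) * c (s + (u - s)) \<partial>lborel)"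
      by (simp add: mult.assoc)
    also have "(\<integral>u. h (u - s) * c (s + (u - s)) \<partial>lborel) = (\<integral>t. h t * c (s + t) \<partial>lborel)"
      by (rule integral_shift[of "\<lambda>t. h t * c (s + t)"])
    finally show "(\<integral>u. g s * h (u - s) * c u \<partial>lborel) = g s * (\<integral>t. h t * c (s + t) \<partial>lborel)" .
  qed
  finally show ?thesis .
qed

lemma integral_even_shift:
  fixes h c :: "real \<Rightarrow> complex"
  assumes h: "integrable lborel h" "\<And>s. h (- s) = h s"
    and c: "c \<in> borel_measurable borel" "\<And>u. cmod (c u) \<le> K"
  shows "(\<integral>t. h t * c (s + t) \<partial>lborel) = (\<integral>t. h t * ((c (s + t) + c (s - t)) / 2) \<partial>lborel)"
proof -
  have [measurable]: "c \<in> borel_measurable borel" by (rule c)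
  have i: "integrable lborel (\<lambda>t. h t * c (s + t))" "integrable lborel (\<lambda>t. h t * c (s - t))"
    by (rule integrable_mult_bounded[OF h(1) _ c(2)]; measurable)+
  have "(\<integral>t. h t * c (s - t) \<partial>lborel) = (\<integral>t. h t * c (s + t) \<partial>lborel)"
    using integral_reflect_lborel[of "\<lambda>t. h t * c (s + t)"] h(2) by simp
  moreover have "(\<integral>t. h t * ((c (s + t) + c (s - t)) / 2) \<partial>lborel)
      = (\<integral>t. (h t * c (s + t) + h t * c (s - t)) / 2 \<partial>lborel)"
    by (intro Bochner_Integration.integral_cong refl) (simp add: field_simps)
  ultimately show ?thesis using i by simp
qed

text \<open>
  Evenness of the density is part of the notion because the product rule for cosine transforms,
  \<open>cosine_kernel_mult\<close>, rests on it.
\<close>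
definition cosine_kernel :: "(real \<Rightarrow> complex) \<Rightarrow> (real \<Rightarrow> complex) \<Rightarrow> bool"
  where "cosine_kernel g F \<longleftrightarrow> integrable lborel g \<and> (\<forall>s. g (- s) = g s)
    \<and> (\<forall>t. (\<integral>s. g s * complex_of_real (cos (s * t)) \<partial>lborel) = F t)"

lemma cosine_kernelD:
  assumes "cosine_kernel g F"
  shows "integrable lborel g" "g (- s) = g s" "(\<integral>s. g s * complex_of_real (cos (s * t)) \<partial>lborel) = F t"
  using assms by (auto simp: cosine_kernel_def)

lemma cosine_kernel_transform:
  assumes "cosine_kernel g F"
  shows "cosine_transform (density_measure g) = F"
  using cosine_kernelD[OF assms] by (auto simp: fun_eq_iff cosine_transform_density_measure)

lemma integrable_mult_cos:
  "integrable lborel (g :: real \<Rightarrow> complex) \<Longrightarrow> integrable lborel (\<lambda>s. g s * complex_of_real (cos (s * t)))"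
  by (rule integrable_mult_bounded[where K = 1]) (auto simp: norm_of_real)

lemma cosine_kernel_add:
  assumes "cosine_kernel g F" "cosine_kernel h G"
  shows "cosine_kernel (\<lambda>s. g s + h s) (\<lambda>t. F t + G t)"
  using assms integrable_mult_cos unfolding cosine_kernel_def by (auto simp: distrib_right)

lemma cosine_kernel_cmult:
  assumes "cosine_kernel g F"
  shows "cosine_kernel (\<lambda>s. c * g s) (\<lambda>t. c * F t)"
  using assms unfolding cosine_kernel_def by (auto simp: mult.assoc)

text \<open>
  Against an even density \<open>cos ((s + r)t)\<close> may be replaced by
  \<open>(cos ((s + r)t) + cos ((s - r)t))/2 = cos (st) cos (rt)\<close>.
\<close>
lemma cosine_kernel_mult:
  assumes g: "cosine_kernel g F" and h: "cosine_kernel h G"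
  shows "cosine_kernel (convolve g h) (\<lambda>t. F t * G t)"
  unfolding cosine_kernel_def
proof (intro conjI allI)
  show "integrable lborel (convolve g h)"
    using g h by (intro integrable_convolve cosine_kernelD(1))
  fix u
  have "convolve g h (- u) = (\<integral>s. g (- s) * h (- u - - s) \<partial>lborel)"
    unfolding convolve_def by (rule integral_reflect_lborel[symmetric])
  also have "\<dots> = (\<integral>s. g s * h (- (u - s)) \<partial>lborel)" using cosine_kernelD(2)[OF g] by simp
  also have "\<dots> = convolve g h u" unfolding cosine_kernelD(2)[OF h] convolve_def ..
  finally show "convolve g h (- u) = convolve g h u" .
next
  fix t
  let ?c = "\<lambda>u. complex_of_real (cos (u * t))"
  have c: "?c \<in> borel_measurable borel" "\<And>u. cmod (?c u) \<le> 1" by (auto simp: norm_of_real)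
  have "(\<integral>u. convolve g h u * ?c u \<partial>lborel) = (\<integral>s. g s * (\<integral>r. h r * ?c (s + r) \<partial>lborel) \<partial>lborel)"
    by (rule integral_convolve[OF cosine_kernelD(1)[OF g] cosine_kernelD(1)[OF h] c])
  also have "\<dots> = (\<integral>s. g s * (?c s * G t) \<partial>lborel)"
  proof (rule Bochner_Integration.integral_cong[OF refl])
    fix s
    have "(\<integral>r. h r * ?c (s + r) \<partial>lborel) = (\<integral>r. h r * ((?c (s + r) + ?c (s - r)) / 2) \<partial>lborel)"
      by (rule integral_even_shift[OF cosine_kernelD(1)[OF h] cosine_kernelD(2)[OF h] c])
    also have "\<dots> = (\<integral>r. ?c s * (h r * ?c r) \<partial>lborel)"
      by (intro Bochner_Integration.integral_cong refl) (simp add: distrib_right left_diff_distrib cos_add cos_diff)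
    also have "\<dots> = ?c s * G t" using cosine_kernelD(3)[OF h] by simp
    finally show "g s * (\<integral>r. h r * ?c (s + r) \<partial>lborel) = g s * (?c s * G t)" by simp
  qed
  also have "\<dots> = F t * G t" using cosine_kernelD(3)[OF g] by (simp add: mult.assoc[symmetric])
  finally show "(\<integral>u. convolve g h u * ?c u \<partial>lborel) = F t * G t" .
qed

lemma cosine_kernel_scale:
  assumes g: "cosine_kernel g F" and r: "r > 0"
  shows "cosine_kernel (\<lambda>s. complex_of_real r * g (r * s)) (\<lambda>t. F (t / r))"
  unfolding cosine_kernel_def
proof (intro conjI allI)
  show "integrable lborel (\<lambda>s. complex_of_real r * g (r * s))"
    using lborel_integrable_real_affine[OF cosine_kernelD(1)[OF g], of r 0] r by simp
  show "complex_of_real r * g (r * - s) = complex_of_real r * g (r * s)" for s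
    using cosine_kernelD(2)[OF g, of "r * s"] by simp
  fix t
  have "F (t / r) = (\<integral>s. g s * complex_of_real (cos (s * (t / r))) \<partial>lborel)"
    by (rule cosine_kernelD(3)[OF g, symmetric])
  also have "\<dots> = r *\<^sub>R (\<integral>s. g (r * s) * complex_of_real (cos (s * t)) \<partial>lborel)"
    using r lborel_integral_real_affine[of r "\<lambda>s. g s * complex_of_real (cos (s * (t / r)))" 0] by simp
  also have "\<dots> = (\<integral>s. complex_of_real r * g (r * s) * complex_of_real (cos (s * t)) \<partial>lborel)"
    by (simp add: scaleR_conv_of_real mult.assoc)
  finally show "(\<integral>s. complex_of_real r * g (r * s) * complex_of_real (cos (s * t)) \<partial>lborel) = F (t / r)" ..
qed

section \<open>The cosine calculus\<close>

lemma cfunctional_bounded_linear: "cfunctional \<psi> \<Longrightarrow> bounded_linear \<psi>"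
  and cfunctional_scaleC: "cfunctional \<psi> \<Longrightarrow> \<psi> (c *\<^sub>C x) = c * \<psi> x"
  by (auto simp: cfunctional_def)

lemma cfunctional_add: "cfunctional \<psi> \<Longrightarrow> \<psi> (x + y) = \<psi> x + \<psi> y"
  and cfunctional_diff: "cfunctional \<psi> \<Longrightarrow> \<psi> (x - y) = \<psi> x - \<psi> y"
  using linear_add linear_diff bounded_linear.linear cfunctional_bounded_linear by blast+

lemma cfunctional_compose:
  assumes "cfunctional \<psi>" "complex_linear T"
  shows "cfunctional (\<lambda>x. \<psi> (blinfun_apply T x))"
  using assms unfolding cfunctional_def complex_linear_def
  by (auto intro: bounded_linear_compose[OF _ blinfun.bounded_linear_right])

locale bounded_cosine =
  fixes Cos :: "real \<Rightarrow> 'a::complex_banach \<Rightarrow>\<^sub>L 'a" and M :: real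
  assumes cosine: "cosine_function Cos" and norm_Cos: "norm (Cos t) \<le> M"
begin

lemma M_nonneg: "M \<ge> 0"
  using norm_Cos norm_ge_zero order_trans by blast

lemma Cos_complex_linear: "complex_linear (Cos t)"
  using cosine by (auto simp: cosine_function_def)

lemma Cos_add_diff: "blinfun_apply (Cos (t + s)) x + blinfun_apply (Cos (t - s)) x
    = 2 *\<^sub>R blinfun_apply (Cos t) (blinfun_apply (Cos s) x)"
proof -
  have "Cos (t + s) + Cos (t - s) = 2 *\<^sub>R (Cos t o\<^sub>L Cos s)"
    using cosine by (auto simp: cosine_function_def)
  then have "blinfun_apply (Cos (t + s) + Cos (t - s)) x = blinfun_apply (2 *\<^sub>R (Cos t o\<^sub>L Cos s)) x" by simp
  then show ?thesis by (simp add: blinfun.add_left blinfun.scaleR_left)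
qed

lemma Cos_0: "Cos 0 = id_blinfun" using cosine by (simp add: cosine_function_def)

lemma Cos_even: "blinfun_apply (Cos (- t)) x = blinfun_apply (Cos t) x"
proof -
  have "blinfun_apply (Cos t) x + blinfun_apply (Cos (- t)) x = blinfun_apply (Cos t) x + blinfun_apply (Cos t) x"
    using Cos_add_diff[of 0 t x] by (simp add: Cos_0 scaleR_2)
  then show ?thesis by simp
qed

lemma norm_Cos_apply: "norm (blinfun_apply (Cos t) x) \<le> M * norm x"
  using norm_blinfun[of "Cos t" x] norm_Cos[of t] by (meson mult_right_mono norm_ge_zero order_trans)

lemma even_bcont_Cos: "even_bcont (\<lambda>s. blinfun_apply (Cos s) x)"
  unfolding even_bcont_def
proof (intro conjI)
  show "continuous_on UNIV (\<lambda>s. blinfun_apply (Cos s) x)" using cosine by (auto simp: cosine_function_def)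
  show "bounded (range (\<lambda>s. blinfun_apply (Cos s) x))"
    using norm_Cos_apply[of _ x] by (auto intro!: boundedI[of _ "M * norm x"])
qed (simp add: Cos_even)

lemma T_op_apply:
  assumes \<mu>: "complex_measure \<mu>"
  shows "blinfun_apply (T_op Cos \<mu>) x = cintegral \<mu> (\<lambda>s. blinfun_apply (Cos s) x)"
    and "cintegral \<mu> (\<lambda>s. blinfun_apply (Cos s) (c *\<^sub>C x)) = c *\<^sub>C cintegral \<mu> (\<lambda>s. blinfun_apply (Cos s) x)"
proof -
  let ?I = "\<lambda>x. cintegral \<mu> (\<lambda>s. blinfun_apply (Cos s) x)"
  let ?s = "\<lambda>x n. \<Sum>c\<in>cells n. \<mu> (grid n -` {c}) *\<^sub>C sample (\<lambda>s. blinfun_apply (Cos s) x) c"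
  note lim = cintegral_sample_tendsto[OF \<mu> even_bcont_Cos]
  have smul: "?I (c *\<^sub>C x) = c *\<^sub>C ?I x" for c x
  proof (rule LIMSEQ_unique[OF lim])
    have "sample (\<lambda>s. blinfun_apply (Cos s) (c *\<^sub>C x)) p = c *\<^sub>C sample (\<lambda>s. blinfun_apply (Cos s) x) p" for p
      using Cos_complex_linear by (auto simp: sample_def complex_linear_def split: option.split)
    then have "?s (c *\<^sub>C x) n = c *\<^sub>C ?s x n" for n
      by (simp add: scaleC_sum_right scaleC_scaleC mult.commute)
    then show "?s (c *\<^sub>C x) \<longlonglongrightarrow> c *\<^sub>C ?I x"
      using bounded_linear.tendsto[OF bounded_linear_scaleC_right lim[of x], of c] by simp
  qed
  then show "?I (c *\<^sub>C x) = c *\<^sub>C ?I x" .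
  have "bounded_linear ?I"
  proof (rule bounded_linear_intro[where K = "enn2real (variation \<mu> UNIV) * M"])
    show "?I (x + y) = ?I x + ?I y" for x y
    proof (rule LIMSEQ_unique[OF lim])
      have "sample (\<lambda>s. blinfun_apply (Cos s) (x + y)) p
          = sample (\<lambda>s. blinfun_apply (Cos s) x) p + sample (\<lambda>s. blinfun_apply (Cos s) y) p" for p
        by (auto simp: sample_def blinfun.add_right split: option.split)
      then have "?s (x + y) n = ?s x n + ?s y n" for n
        by (simp add: scaleC_add_right sum.distrib)
      then show "?s (x + y) \<longlonglongrightarrow> ?I x + ?I y"
        using tendsto_add[OF lim[of x] lim[of y]] by simp
    qed
    show "?I (r *\<^sub>R x) = r *\<^sub>R ?I x" for r x using smul[of "complex_of_real r" x] by (simp add: scaleR_scaleC)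
    show "norm (?I x) \<le> norm x * (enn2real (variation \<mu> UNIV) * M)" for x
      using norm_cintegral_le[OF \<mu> even_bcont_Cos norm_Cos_apply sum_cells_le_variation[OF \<mu>], of x]
      by (simp add: mult_ac)
  qed
  then show "blinfun_apply (T_op Cos \<mu>) x = ?I x"
    unfolding T_op_def by (simp add: bounded_linear_Blinfun_apply)
qed

text \<open>
  This makes \<open>\<Phi>\<close> well defined on all of \<open>E_space\<close>.
\<close>
lemma T_op_eqI:
  assumes \<mu>: "complex_measure \<mu>" and \<nu>: "complex_measure \<nu>"
    and eq: "cosine_transform \<mu> = cosine_transform \<nu>"
  shows "T_op Cos \<mu> = T_op Cos \<nu>"
proof (rule blinfun_eqI)
  fix x
  show "blinfun_apply (T_op Cos \<mu>) x = blinfun_apply (T_op Cos \<nu>) x"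
    unfolding T_op_apply(1)[OF \<mu>] T_op_apply(1)[OF \<nu>]
    by (rule cintegral_cong_symmetric[OF \<mu> \<nu> even_bcont_Cos])
      (rule cosine_transform_determines_symmetric_part[OF \<mu> \<nu> eq])
qed

lemma Phi_eqI:
  assumes "complex_measure \<mu>" "cosine_transform \<mu> = F"
  shows "Phi Cos F = T_op Cos \<mu>"
  unfolding Phi_def using assms by (intro the_equality) (auto intro: T_op_eqI)

context
  fixes g F assumes ker: "cosine_kernel g F"
begin

lemma Phi_kernel: "Phi Cos F = T_op Cos (density_measure g)"
  by (intro Phi_eqI complex_measure_density cosine_kernelD(1)[OF ker] cosine_kernel_transform[OF ker])

lemma Phi_apply: "blinfun_apply (Phi Cos F) x = cintegral (density_measure g) (\<lambda>s. blinfun_apply (Cos s) x)"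
  unfolding Phi_kernel by (intro T_op_apply complex_measure_density cosine_kernelD(1)[OF ker])

lemma complex_linear_Phi: "complex_linear (Phi Cos F)"
  unfolding complex_linear_def Phi_apply
  by (intro allI T_op_apply(2) complex_measure_density cosine_kernelD(1)[OF ker])

lemma cfunctional_Phi:
  assumes \<psi>: "cfunctional \<psi>"
  shows "\<psi> (blinfun_apply (Phi Cos F) x) = (\<integral>s. g s * \<psi> (blinfun_apply (Cos s) x) \<partial>lborel)"
  unfolding Phi_apply cfunctional_cintegral[OF \<psi> complex_measure_density[OF cosine_kernelD(1)[OF ker]] even_bcont_Cos]
  by (rule cintegral_density_measure[OF cosine_kernelD(1)[OF ker]
        even_bcont_compose[OF cfunctional_bounded_linear[OF \<psi>] even_bcont_Cos]])

lemma norm_Phi_le: "norm (Phi Cos F) \<le> (\<integral>s. cmod (g s) \<partial>lborel) * M"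
proof (rule norm_blinfun_bound)
  show "0 \<le> (\<integral>s. cmod (g s) \<partial>lborel) * M" using M_nonneg by simp
  show "norm (blinfun_apply (Phi Cos F) x) \<le> (\<integral>s. cmod (g s) \<partial>lborel) * M * norm x" for x
    unfolding Phi_apply
    using norm_cintegral_le[OF complex_measure_density even_bcont_Cos norm_Cos_apply sum_cells_density_le, OF cosine_kernelD(1)[OF ker] cosine_kernelD(1)[OF ker], of x]
    by (simp add: mult.assoc)
qed

end

lemma cfunctional_Cos_bound:
  assumes "cfunctional \<psi>"
  obtains K where "\<And>s. cmod (\<psi> (blinfun_apply (Cos s) x)) \<le> K"
  using even_bcontE[OF even_bcont_compose[OF cfunctional_bounded_linear[OF assms] even_bcont_Cos]] by metis

lemma cfunctional_Cos_measurable: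
  "cfunctional \<psi> \<Longrightarrow> (\<lambda>s. \<psi> (blinfun_apply (Cos s) x)) \<in> borel_measurable borel"
  by (rule even_bcont_measurable[OF even_bcont_compose[OF cfunctional_bounded_linear even_bcont_Cos]])

lemma integrable_kernel_Cos:
  assumes \<psi>: "cfunctional \<psi>" and g: "integrable lborel g"
  shows "integrable lborel (\<lambda>s. g s * \<psi> (blinfun_apply (Cos s) x))"
proof -
  obtain K where "\<And>s. cmod (\<psi> (blinfun_apply (Cos s) x)) \<le> K" using cfunctional_Cos_bound[OF \<psi>] by blast
  then show ?thesis
    using cfunctional_Cos_measurable[OF \<psi>] by (intro integrable_mult_bounded[OF g]) auto
qed

lemma Phi_add:
  assumes g: "cosine_kernel g F" and h: "cosine_kernel h G"
  shows "Phi Cos (\<lambda>t. F t + G t) = Phi Cos F + Phi Cos G"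
proof (rule blinfun_eqI, rule cfunctionals_separate_points)
  fix x and \<psi> :: "'a \<Rightarrow> complex" assume \<psi>: "cfunctional \<psi>"
  show "\<psi> (blinfun_apply (Phi Cos (\<lambda>t. F t + G t)) x) = \<psi> (blinfun_apply (Phi Cos F + Phi Cos G) x)"
    using integrable_kernel_Cos[OF \<psi> cosine_kernelD(1)[OF g]] integrable_kernel_Cos[OF \<psi> cosine_kernelD(1)[OF h]]
    by (simp add: blinfun.add_left cfunctional_add[OF \<psi>] cfunctional_Phi[OF _ \<psi>, OF g] cfunctional_Phi[OF _ \<psi>, OF h]
        cfunctional_Phi[OF _ \<psi>, OF cosine_kernel_add[OF g h]] distrib_right)
qed

lemma Phi_cmult:
  assumes g: "cosine_kernel g F"
  shows "Phi Cos (\<lambda>t. c * F t) = c *\<^sub>C Phi Cos F"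
proof (rule blinfun_eqI, rule cfunctionals_separate_points)
  fix x and \<psi> :: "'a \<Rightarrow> complex" assume \<psi>: "cfunctional \<psi>"
  show "\<psi> (blinfun_apply (Phi Cos (\<lambda>t. c * F t)) x) = \<psi> (blinfun_apply (c *\<^sub>C Phi Cos F) x)"
    by (simp add: blinfun_apply_scaleC cfunctional_scaleC[OF \<psi>] cfunctional_Phi[OF _ \<psi>, OF g]
        cfunctional_Phi[OF _ \<psi>, OF cosine_kernel_cmult[OF g]] mult.assoc)
qed

text \<open>
  The computation of \<open>cosine_kernel_mult\<close> with \<open>\<psi>(Cos(s)x)\<close> in place of the cosine: the functional
  equation of \<open>Cos\<close> is the addition theorem that is needed.
\<close>
lemma Phi_mult:
  assumes g: "cosine_kernel g F" and h: "cosine_kernel h G"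
  shows "Phi Cos (\<lambda>t. F t * G t) = Phi Cos F o\<^sub>L Phi Cos G"
proof (rule blinfun_eqI, rule cfunctionals_separate_points)
  fix x and \<psi> :: "'a \<Rightarrow> complex" assume \<psi>: "cfunctional \<psi>"
  let ?c = "\<lambda>s. \<psi> (blinfun_apply (Cos s) x)"
  obtain K where K: "\<And>s. cmod (?c s) \<le> K" using cfunctional_Cos_bound[OF \<psi>] by blast
  note c = cfunctional_Cos_measurable[OF \<psi>, of x] K
  have "\<psi> (blinfun_apply (Phi Cos (\<lambda>t. F t * G t)) x) = (\<integral>u. convolve g h u * ?c u \<partial>lborel)"
    by (rule cfunctional_Phi[OF cosine_kernel_mult[OF g h] \<psi>])
  also have "\<dots> = (\<integral>s. g s * (\<integral>r. h r * ?c (s + r) \<partial>lborel) \<partial>lborel)"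
    by (rule integral_convolve[OF cosine_kernelD(1)[OF g] cosine_kernelD(1)[OF h] c])
  also have "\<dots> = (\<integral>s. g s * \<psi> (blinfun_apply (Cos s) (blinfun_apply (Phi Cos G) x)) \<partial>lborel)"
  proof (rule Bochner_Integration.integral_cong[OF refl])
    fix s
    have half: "(?c (s + r) + ?c (s - r)) / 2 = \<psi> (blinfun_apply (Cos s) (blinfun_apply (Cos r) x))" for r
      using arg_cong[OF Cos_add_diff[of s r x], of \<psi>]
      by (simp add: cfunctional_add[OF \<psi>] scaleR_scaleC cfunctional_scaleC[OF \<psi>])
    have "(\<integral>r. h r * ?c (s + r) \<partial>lborel) = (\<integral>r. h r * ((?c (s + r) + ?c (s - r)) / 2) \<partial>lborel)"
      by (rule integral_even_shift[OF cosine_kernelD(1)[OF h] cosine_kernelD(2)[OF h] c])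
    also have "\<dots> = \<psi> (blinfun_apply (Cos s) (blinfun_apply (Phi Cos G) x))"
      unfolding half
      by (rule cfunctional_Phi[OF h cfunctional_compose[OF \<psi> Cos_complex_linear], symmetric])
    finally show "g s * (\<integral>r. h r * ?c (s + r) \<partial>lborel) = g s * \<psi> (blinfun_apply (Cos s) (blinfun_apply (Phi Cos G) x))"
      by simp
  qed
  also have "\<dots> = \<psi> (blinfun_apply (Phi Cos F o\<^sub>L Phi Cos G) x)"
    by (simp add: cfunctional_Phi[OF g \<psi>])
  finally show "\<psi> (blinfun_apply (Phi Cos (\<lambda>t. F t * G t)) x) = \<psi> (blinfun_apply (Phi Cos F o\<^sub>L Phi Cos G) x)" .
qed

end

section \<open>Cosine kernels of the resolvent functions\<close>

lemma LBINT_exp_halfline: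
  fixes a :: complex
  assumes a: "Re a > 0"
  shows "set_integrable lborel {0<..} (\<lambda>s. exp (- (a * complex_of_real s)))"
    and "(LBINT s:{0<..}. exp (- (a * complex_of_real s))) = 1 / a"
proof -
  have n: "norm (exp (- (a * complex_of_real s))) = exp (- (s * Re a))" for s
    by (simp add: norm_exp_eq_Re mult.commute)
  show int: "set_integrable lborel {0<..} (\<lambda>s. exp (- (a * complex_of_real s)))"
    by (rule set_integrable_bound[OF integrable_I0i_exp_mscale[OF a]])
      (auto simp: n set_borel_measurable_def)
  have a0: "a \<noteq> 0" using a by auto
  have "(LBINT s=0..\<infinity>. exp (- (a * complex_of_real s))) = 0 - (- (1 / a))"
  proof (rule interval_integral_FTC_integrable[where F = "\<lambda>s. - exp (- (a * complex_of_real s)) / a"])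
    fix x
    have "((\<lambda>z. - exp (- (a * z)) / a) has_field_derivative exp (- (a * complex_of_real x))) (at (complex_of_real x))"
      using a0 by (auto intro!: derivative_eq_intros)
    then show "((\<lambda>s. - exp (- (a * complex_of_real s)) / a) has_vector_derivative exp (- (a * complex_of_real x))) (at x)"
      by (rule has_vector_derivative_real_field)
    show "isCont (\<lambda>s. exp (- (a * complex_of_real s))) x" by (intro continuous_intros)
  next
    show "set_integrable lborel (einterval 0 \<infinity>) (\<lambda>s. exp (- (a * complex_of_real s)))"
      using int by (simp add: zero_ereal_def)
    have "((\<lambda>s. - exp (- (a * complex_of_real s)) / a) \<longlongrightarrow> - exp (- (a * complex_of_real 0)) / a) (at_right 0)"
      using a0 by (intro tendsto_intros) auto
    then show "(((\<lambda>s. - exp (- (a * complex_of_real s)) / a) \<circ> real_of_ereal) \<longlongrightarrow> - (1 / a)) (at_right 0)"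
      unfolding zero_ereal_def ereal_tendsto_simps by simp
    have "((\<lambda>s. exp (- (Re a * s)) / cmod a) \<longlongrightarrow> 0) at_top"
      using a a0 by real_asymp
    then have "((\<lambda>s. - exp (- (a * complex_of_real s)) / a) \<longlongrightarrow> 0) at_top"
      by (intro tendsto_norm_zero_cancel[of "\<lambda>s. - exp (- (a * complex_of_real s)) / a"]) (simp add: norm_exp_eq_Re norm_divide)
    then show "(((\<lambda>s. - exp (- (a * complex_of_real s)) / a) \<circ> real_of_ereal) \<longlongrightarrow> 0) (at_left \<infinity>)"
      unfolding ereal_tendsto_simps .
  qed simp
  then show "(LBINT s:{0<..}. exp (- (a * complex_of_real s))) = 1 / a"
    by (simp add: interval_lebesgue_integral_0_infty)
qed

lemma integral_even_lborel:
  fixes g :: "real \<Rightarrow> 'a::{banach, second_countable_topology}"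
  assumes even: "\<And>s. g (- s) = g s" and int: "set_integrable lborel {0<..} g" and meas: "g \<in> borel_measurable borel"
  shows "integrable lborel g" "(\<integral>s. g s \<partial>lborel) = 2 *\<^sub>R (LBINT s:{0<..}. g s)"
proof -
  let ?h = "\<lambda>s. indicat_real {0<..} s *\<^sub>R g s"
  have h: "integrable lborel ?h" using int by (simp add: set_integrable_def)
  then have h': "integrable lborel (\<lambda>s. ?h (- s))"
    using lborel_integrable_real_affine[of ?h "-1" 0] by simp
  have [measurable]: "g \<in> borel_measurable borel" by (rule meas)
  have ae: "AE s in lborel. g s = ?h s + ?h (- s)"
    using AE_lborel_singleton[of 0] by eventually_elim (auto simp: even indicator_def)
  show "integrable lborel g"
    using integrable_cong_AE[OF _ _ ae] h h' by simp
  have "(\<integral>s. g s \<partial>lborel) = (\<integral>s. ?h s + ?h (- s) \<partial>lborel)"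
    by (rule integral_cong_AE[OF _ _ ae]) measurable
  also have "\<dots> = (\<integral>s. ?h s \<partial>lborel) + (\<integral>s. ?h (- s) \<partial>lborel)"
    by (rule Bochner_Integration.integral_add[OF h h'])
  also have "\<dots> = 2 *\<^sub>R (LBINT s:{0<..}. g s)"
    using integral_reflect_lborel[of ?h] by (simp add: set_lebesgue_integral_def scaleR_2)
  finally show "(\<integral>s. g s \<partial>lborel) = 2 *\<^sub>R (LBINT s:{0<..}. g s)" .
qed

lemma exp_abs_cos_integral:
  fixes u :: complex
  assumes u: "Re u > 0"
  shows "integrable lborel (\<lambda>s. exp (- (u * complex_of_real \<bar>s\<bar>)))"
    and "(\<integral>s. exp (- (u * complex_of_real \<bar>s\<bar>)) * complex_of_real (cos (s * t)) \<partial>lborel)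
      = 2 * u / (u\<^sup>2 + (complex_of_real t)\<^sup>2)"
    and "(\<integral>s. cmod (exp (- (u * complex_of_real \<bar>s\<bar>))) \<partial>lborel) = 2 / Re u"
proof -
  show "integrable lborel (\<lambda>s. exp (- (u * complex_of_real \<bar>s\<bar>)))"
  proof (rule integral_even_lborel(1))
    show "set_integrable lborel {0<..} (\<lambda>s. exp (- (u * complex_of_real \<bar>s\<bar>)))"
      by (rule iffD1[OF set_integrable_cong LBINT_exp_halfline(1)[OF u]]) auto
  qed auto
  let ?c = "\<lambda>s. exp (- (u * complex_of_real \<bar>s\<bar>)) * complex_of_real (cos (s * t))"
  let ?p = "u - \<i> * complex_of_real t" and ?q = "u + \<i> * complex_of_real t"
  have pq: "Re ?p > 0" "Re ?q > 0" using u by auto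
  have eq: "?c s = (exp (- (?p * complex_of_real s)) + exp (- (?q * complex_of_real s))) / 2" if "s > 0" for s
  proof -
    have "complex_of_real (cos (s * t)) = (exp (\<i> * (s * t)) + exp (- (\<i> * (s * t)))) / 2"
      by (simp add: cos_exp_eq flip: cos_of_real)
    then have "?c s = exp (- (u * complex_of_real s)) * ((exp (\<i> * (s * t)) + exp (- (\<i> * (s * t)))) / 2)"
      using that by simp
    also have "\<dots> = (exp (- (u * complex_of_real s)) * exp (\<i> * (s * t)) + exp (- (u * complex_of_real s)) * exp (- (\<i> * (s * t)))) / 2"
      by (simp add: distrib_left)
    finally show ?thesis unfolding exp_add[symmetric] by (simp add: algebra_simps)
  qed
  note int = LBINT_exp_halfline[OF pq(1)] LBINT_exp_halfline[OF pq(2)]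
  have i: "set_integrable lborel {0<..} (\<lambda>s. (exp (- (?p * complex_of_real s)) + exp (- (?q * complex_of_real s))) / 2)"
    using set_integral_add(1)[OF int(1,3)] by simp
  have "(\<integral>s. ?c s \<partial>lborel) = 2 *\<^sub>R (LBINT s:{0<..}. ?c s)"
  proof (rule integral_even_lborel(2))
    show "set_integrable lborel {0<..} ?c"
      by (rule iffD1[OF set_integrable_cong i]) (simp_all only: greaterThan_iff eq)
  qed auto
  also have "(LBINT s:{0<..}. ?c s) = (LBINT s:{0<..}. (exp (- (?p * complex_of_real s)) + exp (- (?q * complex_of_real s))) / 2)"
    by (rule set_lebesgue_integral_cong, simp, intro allI impI, rule eq, simp)
  also have "\<dots> = (1 / ?p + 1 / ?q) / 2"
    using set_integral_add(2)[OF int(1,3)] int(2,4) by simp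
  also have "2 *\<^sub>R ((1 / ?p + 1 / ?q) / 2) = 2 * u / (?p * ?q)"
  proof -
    have "?p \<noteq> 0" "?q \<noteq> 0" using pq by (metis less_irrefl zero_complex.sel(1))+
    then show ?thesis by (subst add_frac_eq) (auto simp: scaleR_conv_of_real)
  qed
  also have "?p * ?q = u\<^sup>2 + (complex_of_real t)\<^sup>2" by (simp add: algebra_simps power2_eq_square)
  finally show "(\<integral>s. ?c s \<partial>lborel) = 2 * u / (u\<^sup>2 + (complex_of_real t)\<^sup>2)" .
  have n: "cmod (exp (- (u * complex_of_real \<bar>s\<bar>))) = exp (- (\<bar>s\<bar> * Re u))" for s
    by (simp add: norm_exp_eq_Re mult.commute)
  have "(\<integral>s. exp (- (\<bar>s\<bar> * Re u)) \<partial>lborel) = 2 *\<^sub>R (LBINT s:{0<..}. exp (- (\<bar>s\<bar> * Re u)))"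
  proof (rule integral_even_lborel(2))
    show "set_integrable lborel {0<..} (\<lambda>s. exp (- (\<bar>s\<bar> * Re u)))"
      by (rule iffD1[OF set_integrable_cong integrable_I0i_exp_mscale[OF u]]) auto
  qed auto
  also have "(LBINT s:{0<..}. exp (- (\<bar>s\<bar> * Re u))) = (LBINT s:{0<..}. exp (- (s * Re u)))"
    by (rule set_lebesgue_integral_cong) auto
  also have "\<dots> = 1 / Re u"
    using LBINT_I0i_exp_mscale[OF u] by (simp add: interval_lebesgue_integral_0_infty)
  finally show "(\<integral>s. cmod (exp (- (u * complex_of_real \<bar>s\<bar>))) \<partial>lborel) = 2 / Re u"
    unfolding n by simp
qed

lemma square_plus_square_nonzero:
  assumes "Re u > 0" shows "u\<^sup>2 + (complex_of_real t)\<^sup>2 \<noteq> 0"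
proof -
  have "u\<^sup>2 + (complex_of_real t)\<^sup>2 = (u - \<i> * t) * (u + \<i> * t)" by (simp add: algebra_simps power2_eq_square)
  moreover have "u - \<i> * t \<noteq> 0" "u + \<i> * t \<noteq> 0" using assms by (auto simp: complex_eq_iff)
  ultimately show ?thesis by simp
qed

lemma cosine_kernel_square_resolvent:
  assumes u: "Re u > 0"
  shows "cosine_kernel (\<lambda>s. 1 / (2 * u) * exp (- (u * complex_of_real \<bar>s\<bar>))) (\<lambda>t. 1 / (u\<^sup>2 + (complex_of_real t)\<^sup>2))"
    and "(\<integral>s. cmod (1 / (2 * u) * exp (- (u * complex_of_real \<bar>s\<bar>))) \<partial>lborel) = 1 / (cmod u * Re u)"
proof -
  have u0: "u \<noteq> 0" using u by auto
  show "cosine_kernel (\<lambda>s. 1 / (2 * u) * exp (- (u * complex_of_real \<bar>s\<bar>))) (\<lambda>t. 1 / (u\<^sup>2 + (complex_of_real t)\<^sup>2))"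
    unfolding cosine_kernel_def using exp_abs_cos_integral(1,2)[OF u] u0
    by (auto simp del: mult_eq_0_iff simp: mult.assoc)
  show "(\<integral>s. cmod (1 / (2 * u) * exp (- (u * complex_of_real \<bar>s\<bar>))) \<partial>lborel) = 1 / (cmod u * Re u)"
    using exp_abs_cos_integral(3)[OF u] unfolding norm_mult by (simp add: norm_divide norm_mult)
qed

text \<open>
  For \<open>t\<close> different from \<open>0\<close> and \<open>1\<close> this is the partial fraction decomposition
  \<open>u\<^sup>2/((1 + u\<^sup>2)(u\<^sup>2 + t\<^sup>2)) = (1/(1 + u\<^sup>2) - t\<^sup>2/(u\<^sup>2 + t\<^sup>2))/(1 - t\<^sup>2)\<close>; the two remaining values of \<open>t\<close> need
  their own antiderivatives.
\<close>
lemma LBINT_halfline_rational: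
  fixes t :: real
  assumes t: "t \<ge> 0"
  shows "set_integrable lborel {0<..} (\<lambda>u. u\<^sup>2 / ((1 + u\<^sup>2) * (u\<^sup>2 + t\<^sup>2)))"
    and "(LBINT u:{0<..}. u\<^sup>2 / ((1 + u\<^sup>2) * (u\<^sup>2 + t\<^sup>2))) = pi / 2 / (1 + t)"
proof -
  define F where "F u = (if t = 1 then (arctan u - u / (1 + u\<^sup>2)) / 2
    else if t = 0 then arctan u else (arctan u - t * arctan (u / t)) / (1 - t\<^sup>2))" for u
  have t1: "1 - t\<^sup>2 \<noteq> 0" if "t \<noteq> 1"
    using that t by (simp add: power2_eq_1_iff)
  have t2: "t\<^sup>2 \<noteq> 1" if "t \<noteq> 1" using t1[OF that] by auto
  have pos: "1 + u\<^sup>2 > 0" for u :: real by (simp add: add_pos_nonneg)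
  have D: "(F has_real_derivative u\<^sup>2 / ((1 + u\<^sup>2) * (u\<^sup>2 + t\<^sup>2))) (at u)" if u: "u > 0" for u
  proof -
    consider "t = 1" | "t = 0" | "t \<noteq> 1" "t \<noteq> 0" by blast
    then show ?thesis
    proof cases
      case 1
      have "((\<lambda>u. (arctan u - u / (1 + u\<^sup>2)) / 2) has_real_derivative
          (inverse (1 + u\<^sup>2) - (1 * (1 + u\<^sup>2) - u * (2 * u)) / ((1 + u\<^sup>2) * (1 + u\<^sup>2))) / 2) (at u)"
        using pos[of u] by (auto intro!: derivative_eq_intros)
      also have "(inverse (1 + u\<^sup>2) - (1 * (1 + u\<^sup>2) - u * (2 * u)) / ((1 + u\<^sup>2) * (1 + u\<^sup>2))) / 2
          = u\<^sup>2 / ((1 + u\<^sup>2) * (u\<^sup>2 + t\<^sup>2))"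
        using pos[of u] 1 by (simp add: divide_simps power2_eq_square)
      finally show ?thesis using 1 by (simp add: F_def[abs_def])
    next
      case 2
      have "(arctan has_real_derivative inverse (1 + u\<^sup>2)) (at u)" by (rule DERIV_arctan)
      also have "inverse (1 + u\<^sup>2) = u\<^sup>2 / ((1 + u\<^sup>2) * (u\<^sup>2 + t\<^sup>2))"
        using pos[of u] 2 u by (simp add: divide_simps)
      finally show ?thesis using 2 by (simp add: F_def[abs_def])
    next
      case 3
      have pt: "u\<^sup>2 + t\<^sup>2 > 0" using u by (simp add: add_pos_nonneg)
      have h: "((\<lambda>u. u / t) has_real_derivative 1 / t) (at u)"
        by (rule DERIV_cdivide[OF DERIV_ident])
      have "((\<lambda>u. (arctan u - t * arctan (u / t)) / (1 - t\<^sup>2)) has_real_derivative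
          (inverse (1 + u\<^sup>2) - t * (inverse (1 + (u / t)\<^sup>2) * (1 / t))) / (1 - t\<^sup>2)) (at u)"
        by (rule DERIV_cdivide[OF DERIV_diff[OF DERIV_arctan DERIV_cmult[OF DERIV_chain2[OF DERIV_arctan h]]]])
      also have "inverse (1 + (u / t)\<^sup>2) = t\<^sup>2 / (u\<^sup>2 + t\<^sup>2)"
        using 3 pt by (simp add: field_simps)
      also have "(inverse (1 + u\<^sup>2) - t * (t\<^sup>2 / (u\<^sup>2 + t\<^sup>2) * (1 / t))) / (1 - t\<^sup>2) = u\<^sup>2 / ((1 + u\<^sup>2) * (u\<^sup>2 + t\<^sup>2))"
      proof -
        have "inverse (1 + u\<^sup>2) - t * (t\<^sup>2 / (u\<^sup>2 + t\<^sup>2) * (1 / t)) = u\<^sup>2 * (1 - t\<^sup>2) / ((1 + u\<^sup>2) * (u\<^sup>2 + t\<^sup>2))"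
          using 3 pos[of u] pt by (simp add: divide_simps) (simp add: algebra_simps)
        then show ?thesis using t1[OF 3(1)] by simp
      qed
      finally show ?thesis using 3 by (simp add: F_def[abs_def])
    qed
  qed
  have L0: "(F \<longlongrightarrow> 0) (at_right 0)"
  proof -
    have "isCont F 0"
      by (cases "t = 1"; cases "t = 0") (auto intro!: continuous_intros simp: t1 t2 F_def[abs_def])
    then have "(F \<longlongrightarrow> F 0) (at_right 0)"
      unfolding isCont_def by (rule tendsto_mono[OF at_le, rotated]) simp
    moreover have "F 0 = 0" by (simp add: F_def)
    ultimately show ?thesis by simp
  qed
  have L1: "(F \<longlongrightarrow> pi / 2 / (1 + t)) at_top"
  proof -
    consider "t = 1" | "t = 0" | "t \<noteq> 1" "t > 0" using t by fastforce
    then show ?thesis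
    proof cases
      case 1
      have "((\<lambda>u::real. u / (1 + u\<^sup>2)) \<longlongrightarrow> 0) at_top" by real_asymp
      then have "((\<lambda>u. (arctan u - u / (1 + u\<^sup>2)) / 2) \<longlongrightarrow> (pi / 2 - 0) / 2) at_top"
        by (intro tendsto_intros tendsto_arctan_at_top) auto
      then show ?thesis using 1 by (simp add: F_def[abs_def])
    next
      case 2
      then show ?thesis using tendsto_arctan_at_top by (simp add: F_def[abs_def])
    next
      case 3
      have "filterlim (\<lambda>u. u / t) at_top at_top" using 3 by real_asymp
      then have "((\<lambda>u. arctan (u / t)) \<longlongrightarrow> pi / 2) at_top"
        using filterlim_compose[OF tendsto_arctan_at_top] by blast
      then have "((\<lambda>u. (arctan u - t * arctan (u / t)) / (1 - t\<^sup>2)) \<longlongrightarrow> (pi / 2 - t * (pi / 2)) / (1 - t\<^sup>2)) at_top"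
        by (intro tendsto_intros tendsto_arctan_at_top) (use t1 3 in auto)
      also have "(pi / 2 - t * (pi / 2)) / (1 - t\<^sup>2) = pi / 2 / (1 + t)"
      proof -
        have "1 - t\<^sup>2 = (1 - t) * (1 + t)" by (simp add: algebra_simps power2_eq_square)
        moreover have "pi / 2 - t * (pi / 2) = (1 - t) * (pi / 2)" by (simp add: algebra_simps)
        ultimately have "(pi / 2 - t * (pi / 2)) / (1 - t\<^sup>2) = ((1 - t) * (pi / 2)) / ((1 - t) * (1 + t))"
          by (simp only:)
        then show ?thesis using 3 by (simp only: nonzero_mult_divide_mult_cancel_left[of "1 - t"] diff_eq_eq)
      qed
      finally show ?thesis using 3 by (simp add: F_def[abs_def])
    qed
  qed
  have ne: "1 + u\<^sup>2 \<noteq> 0" for u :: real using pos by (metis less_irrefl)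
  have prem: "0 < ereal x \<Longrightarrow> ereal x < \<infinity> \<Longrightarrow> DERIV F x :> x\<^sup>2 / ((1 + x\<^sup>2) * (x\<^sup>2 + t\<^sup>2))"
      "0 < ereal x \<Longrightarrow> ereal x < \<infinity> \<Longrightarrow> isCont (\<lambda>u. u\<^sup>2 / ((1 + u\<^sup>2) * (u\<^sup>2 + t\<^sup>2))) x" for x
    using D[of x] ne[of x] by (auto intro!: continuous_intros simp: sum_power2_eq_zero_iff)
  have lim: "((F \<circ> real_of_ereal) \<longlongrightarrow> 0) (at_right 0)" "((F \<circ> real_of_ereal) \<longlongrightarrow> pi / 2 / (1 + t)) (at_left \<infinity>)"
    unfolding zero_ereal_def ereal_tendsto_simps using L0 L1 by auto
  have nn: "AE x in lborel. 0 < ereal x \<longrightarrow> ereal x < \<infinity> \<longrightarrow> 0 \<le> x\<^sup>2 / ((1 + x\<^sup>2) * (x\<^sup>2 + t\<^sup>2))"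
    by (intro AE_I2) (auto intro!: divide_nonneg_nonneg mult_nonneg_nonneg)
  note ftc = interval_integral_FTC_nonneg[of 0 \<infinity> F "\<lambda>u. u\<^sup>2 / ((1 + u\<^sup>2) * (u\<^sup>2 + t\<^sup>2))", OF _ prem nn lim]
  show "set_integrable lborel {0<..} (\<lambda>u. u\<^sup>2 / ((1 + u\<^sup>2) * (u\<^sup>2 + t\<^sup>2)))"
    using ftc(1) by (simp add: zero_ereal_def)
  show "(LBINT u:{0<..}. u\<^sup>2 / ((1 + u\<^sup>2) * (u\<^sup>2 + t\<^sup>2))) = pi / 2 / (1 + t)"
    using ftc(2) by (simp add: interval_lebesgue_integral_0_infty)
qed

text \<open>
  The kernel of \<open>1/(1 + |t|)\<close>. The formula is the inverse cosine transform after the contour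
  has been turned to the imaginary axis: it writes \<open>1/(1 + |t|)\<close> as
  \<open>(2/\<pi>) \<integral> u\<^sup>2/((1 + u\<^sup>2)(u\<^sup>2 + t\<^sup>2)) du\<close>, a superposition of the transforms of \<open>exp (- u|s|)\<close>.
\<close>
definition first_order_kernel :: "real \<Rightarrow> complex"
  where "first_order_kernel s = (\<integral>u. indicat_real {0<..} u *\<^sub>R (complex_of_real (u / (1 + u\<^sup>2) / pi)
    * exp (- (complex_of_real u * complex_of_real \<bar>s\<bar>))) \<partial>lborel)"

lemma cosine_kernel_first_order:
  "cosine_kernel first_order_kernel (\<lambda>t. 1 / (1 + complex_of_real \<bar>t\<bar>))"
proof -
  define f where "f u s = indicat_real {0<..} u *\<^sub>R (complex_of_real (u / (1 + u\<^sup>2) / pi)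
    * exp (- (complex_of_real u * complex_of_real \<bar>s\<bar>)))" for u s
  have int: "integrable (lborel \<Otimes>\<^sub>M lborel) (\<lambda>(u, s). f u s)"
  proof (rule lborel_pair.Fubini_integrable)
    show "(\<lambda>(u, s). f u s) \<in> borel_measurable (lborel \<Otimes>\<^sub>M lborel)" unfolding f_def by measurable
    show "AE u in lborel. integrable lborel (\<lambda>s. case (u, s) of (u, s) \<Rightarrow> f u s)"
    proof (intro AE_I2)
      fix u :: real
      show "integrable lborel (\<lambda>s. case (u, s) of (u, s) \<Rightarrow> f u s)"
        using exp_abs_cos_integral(1)[of "complex_of_real u"]
        by (cases "u > 0") (auto simp: f_def)
    qed
    have "(\<integral>s. norm (case (u, s) of (u, s) \<Rightarrow> f u s) \<partial>lborel)
        = 2 / pi * (indicat_real {0<..} u *\<^sub>R (u\<^sup>2 / ((1 + u\<^sup>2) * (u\<^sup>2 + 0\<^sup>2))))" for u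
    proof (cases "u > 0")
      case True
      have "cmod (f u s) = u / (1 + u\<^sup>2) / pi * cmod (exp (- (complex_of_real u * complex_of_real \<bar>s\<bar>)))" for s
        using True by (simp add: f_def norm_mult norm_divide add_nonneg_nonneg del: of_real_mult of_real_add of_real_divide of_real_power)
      then show ?thesis
        using True exp_abs_cos_integral(3)[of "complex_of_real u"] by (simp add: power2_eq_square)
    qed (simp add: f_def)
    then show "integrable lborel (\<lambda>u. \<integral>s. norm (case (u, s) of (u, s) \<Rightarrow> f u s) \<partial>lborel)"
      by (simp only:) (intro integrable_mult_right LBINT_halfline_rational(1)[unfolded set_integrable_def] order_refl)
  qed
  show ?thesis
    unfolding cosine_kernel_def
  proof (intro conjI allI)
    show "integrable lborel first_order_kernel"
      using lborel_pair.integrable_snd[OF int] by (simp add: first_order_kernel_def[abs_def] f_def)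
    show "first_order_kernel (- s) = first_order_kernel s" for s by (simp add: first_order_kernel_def)
    fix t :: real
    let ?c = "\<lambda>s. complex_of_real (cos (s * t))"
    have "integrable (lborel \<Otimes>\<^sub>M lborel) (\<lambda>p. (case p of (u, s) \<Rightarrow> f u s) * ?c (snd p))"
      by (rule integrable_mult_bounded[OF int, where K = 1]) (auto simp: norm_of_real)
    then have int': "integrable (lborel \<Otimes>\<^sub>M lborel) (\<lambda>(u, s). f u s * ?c s)" by (simp add: split_def)
    have inner: "(\<integral>s. f u s * ?c s \<partial>lborel)
        = complex_of_real (2 / pi * (indicat_real {0<..} u * (u\<^sup>2 / ((1 + u\<^sup>2) * (u\<^sup>2 + \<bar>t\<bar>\<^sup>2)))))" for u
    proof (cases "u > 0")
      case True
      have "(\<integral>s. f u s * ?c s \<partial>lborel) = complex_of_real (u / (1 + u\<^sup>2) / pi)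
          * (\<integral>s. exp (- (complex_of_real u * complex_of_real \<bar>s\<bar>)) * ?c s \<partial>lborel)"
        using True unfolding f_def by (simp add: mult.assoc)
      also have "\<dots> = complex_of_real (u / (1 + u\<^sup>2) / pi) * (2 * complex_of_real u / ((complex_of_real u)\<^sup>2 + (complex_of_real t)\<^sup>2))"
        using exp_abs_cos_integral(2)[of "complex_of_real u" t] True by simp
      also have "\<dots> = complex_of_real (u / (1 + u\<^sup>2) / pi * (2 * u / (u\<^sup>2 + t\<^sup>2)))" by simp
      also have "u / (1 + u\<^sup>2) / pi * (2 * u / (u\<^sup>2 + t\<^sup>2)) = 2 / pi * (u\<^sup>2 / ((1 + u\<^sup>2) * (u\<^sup>2 + \<bar>t\<bar>\<^sup>2)))"
        by (simp add: power2_eq_square mult_ac)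
      finally show ?thesis using True by simp
    qed (simp add: f_def)
    have "(\<integral>s. first_order_kernel s * ?c s \<partial>lborel) = (\<integral>s. (\<integral>u. f u s * ?c s \<partial>lborel) \<partial>lborel)"
      unfolding first_order_kernel_def f_def[symmetric] integral_mult_left_zero ..
    also have "\<dots> = (\<integral>u. (\<integral>s. f u s * ?c s \<partial>lborel) \<partial>lborel)"
      by (rule lborel_pair.Fubini_integral[OF int'])
    also have "\<dots> = complex_of_real (2 / pi * (LBINT u:{0<..}. u\<^sup>2 / ((1 + u\<^sup>2) * (u\<^sup>2 + \<bar>t\<bar>\<^sup>2))))"
      unfolding inner set_lebesgue_integral_def integral_complex_of_real integral_mult_right_zero real_scaleR_def ..
    also have "(LBINT u:{0<..}. u\<^sup>2 / ((1 + u\<^sup>2) * (u\<^sup>2 + \<bar>t\<bar>\<^sup>2))) = pi / 2 / (1 + \<bar>t\<bar>)"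
      by (rule LBINT_halfline_rational(2)) simp
    also have "2 / pi * (pi / 2 / (1 + \<bar>t\<bar>)) = 1 / (1 + \<bar>t\<bar>)" by (simp add: divide_simps)
    finally show "(\<integral>s. first_order_kernel s * ?c s \<partial>lborel) = 1 / (1 + complex_of_real \<bar>t\<bar>)" by simp
  qed
qed

text \<open>
  Scaling shows that the norm of the kernel of \<open>1/(l + |t|)\<close> is of order \<open>1/l\<close>, which is what
  sectoriality of the square root requires.
\<close>
lemma cosine_kernel_first_order_scaled:
  assumes l: "l > 0"
  shows "cosine_kernel (\<lambda>s. first_order_kernel (l * s)) (\<lambda>t. 1 / (complex_of_real l + complex_of_real \<bar>t\<bar>))"
    and "(\<integral>s. cmod (first_order_kernel (l * s)) \<partial>lborel) = (\<integral>s. cmod (first_order_kernel s) \<partial>lborel) / l"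
proof -
  have "(\<lambda>t. 1 / complex_of_real l * (1 / (1 + complex_of_real \<bar>t / l\<bar>))) = (\<lambda>t. 1 / (complex_of_real l + complex_of_real \<bar>t\<bar>))"
    using l by (auto simp: fun_eq_iff field_simps)
  then show "cosine_kernel (\<lambda>s. first_order_kernel (l * s)) (\<lambda>t. 1 / (complex_of_real l + complex_of_real \<bar>t\<bar>))"
    using cosine_kernel_cmult[OF cosine_kernel_scale[OF cosine_kernel_first_order l], of "1 / complex_of_real l"] l by simp
  show "(\<integral>s. cmod (first_order_kernel (l * s)) \<partial>lborel) = (\<integral>s. cmod (first_order_kernel s) \<partial>lborel) / l"
    using lborel_integral_real_affine[of l "\<lambda>s. cmod (first_order_kernel s)" 0] l by (simp add: field_simps)
qed

section \<open>Resolvents of operators given by graphs\<close>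

lemma blinfun_graph_iff: "(x, y) \<in> blinfun_graph T \<longleftrightarrow> y = blinfun_apply T x"
  by (auto simp: blinfun_graph_def)

lemma blinfun_graph_inject: "blinfun_graph S = blinfun_graph T \<Longrightarrow> S = T"
  by (rule blinfun_eqI) (metis blinfun_graph_iff)

lemma resolvent_eqI:
  assumes "(shift_op z C)\<inverse> = blinfun_graph R"
  shows "resolvent z C = R" "z \<in> resolvent_set C"
  unfolding resolvent_def resolvent_set_def using assms
  by (auto intro!: the_equality dest: blinfun_graph_inject)

lemma shift_op_graph_iff:
  "(shift_op z C)\<inverse> = blinfun_graph R \<longleftrightarrow> (\<forall>w x. (x, z *\<^sub>C x - w) \<in> C \<longleftrightarrow> x = blinfun_apply R w)"
proof -
  have "(w, x) \<in> (shift_op z C)\<inverse> \<longleftrightarrow> (x, z *\<^sub>C x - w) \<in> C" for w x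
    unfolding shift_op_def by (auto, metis add_diff_cancel_left' diff_diff_eq2 diff_add_cancel)
  then show ?thesis by (auto simp: set_eq_iff blinfun_graph_iff)
qed

lemma resolvent_iff:
  assumes "z \<in> resolvent_set C"
  shows "(x, z *\<^sub>C x - w) \<in> C \<longleftrightarrow> x = blinfun_apply (resolvent z C) w"
proof -
  obtain R where R: "(shift_op z C)\<inverse> = blinfun_graph R" using assms by (auto simp: resolvent_set_def)
  then show ?thesis using resolvent_eqI(1)[OF R] R unfolding shift_op_graph_iff by blast
qed

lemma scaleC_minus_left: "(- c) *\<^sub>C x = - (c *\<^sub>C (x::'a::complex_banach))"
proof -
  have "(- c) *\<^sub>C x + c *\<^sub>C x = 0" by (simp flip: scaleC_add_left)
  then show ?thesis by (simp add: eq_neg_iff_add_eq_0)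
qed

lemma scaleC_minus_right: "c *\<^sub>C (- x) = - (c *\<^sub>C (x::'a::complex_banach))"
proof -
  have "c *\<^sub>C (- x) + c *\<^sub>C x = 0" by (simp flip: scaleC_add_right)
  then show ?thesis by (simp add: eq_neg_iff_add_eq_0)
qed

lemma scaleC_diff_left: "(c - d) *\<^sub>C x = c *\<^sub>C x - d *\<^sub>C (x::'a::complex_banach)"
  using scaleC_add_left[of c "- d" x] by (simp add: scaleC_minus_left)

lemma scaleC_diff_right: "c *\<^sub>C (x - y) = c *\<^sub>C x - c *\<^sub>C (y::'a::complex_banach)"
  using scaleC_add_right[of c x "- y"] by (simp add: scaleC_minus_right)

lemmas scaleC_algebra = scaleC_add_left scaleC_add_right scaleC_diff_left scaleC_diff_right
  scaleC_minus_left scaleC_minus_right scaleC_scaleC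

lemma linear_operatorD:
  assumes "linear_operator C"
  shows "(x, y) \<in> C \<Longrightarrow> (x, y') \<in> C \<Longrightarrow> y = y'" "(0, 0) \<in> C"
    "(x, y) \<in> C \<Longrightarrow> (u, v) \<in> C \<Longrightarrow> (x + u, y + v) \<in> C"
    "(x, y) \<in> C \<Longrightarrow> (c *\<^sub>C x, c *\<^sub>C y) \<in> C"
    "(x, y) \<in> C \<Longrightarrow> (u, v) \<in> C \<Longrightarrow> (x - u, y - v) \<in> C"
proof -
  show "(x, y) \<in> C \<Longrightarrow> (x, y') \<in> C \<Longrightarrow> y = y'" using assms by (auto simp: linear_operator_def single_valued_def)
  show "(0, 0) \<in> C" using assms by (simp add: linear_operator_def)
  show a: "(x, y) \<in> C \<Longrightarrow> (u, v) \<in> C \<Longrightarrow> (x + u, y + v) \<in> C" for x y u v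
    using assms by (auto simp: linear_operator_def)
  show s: "(x, y) \<in> C \<Longrightarrow> (c *\<^sub>C x, c *\<^sub>C y) \<in> C" for x y c using assms by (auto simp: linear_operator_def)
  show "(x, y) \<in> C \<Longrightarrow> (u, v) \<in> C \<Longrightarrow> (x - u, y - v) \<in> C"
    using a[of x y "- u" "- v"] s[of u v "- 1"] by (simp add: scaleC_minus_left)
qed

lemma resolvent_identity:
  assumes C: "linear_operator C" and z: "z \<in> resolvent_set C" and w: "w \<in> resolvent_set C"
  shows "resolvent z C - resolvent w C = (w - z) *\<^sub>C (resolvent z C o\<^sub>L resolvent w C)"
proof (rule blinfun_eqI)
  fix x
  define y where "y = blinfun_apply (resolvent w C) x"
  define v where "v = blinfun_apply (resolvent z C) ((w - z) *\<^sub>C y)"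
  have y: "(y, w *\<^sub>C y - x) \<in> C" using resolvent_iff[OF w] y_def by blast
  have v: "(v, z *\<^sub>C v - (w - z) *\<^sub>C y) \<in> C" using resolvent_iff[OF z] v_def by blast
  have "(y + v, (w *\<^sub>C y - x) + (z *\<^sub>C v - (w - z) *\<^sub>C y)) \<in> C" by (rule linear_operatorD(3)[OF C y v])
  also have "(w *\<^sub>C y - x) + (z *\<^sub>C v - (w - z) *\<^sub>C y) = z *\<^sub>C (y + v) - x" by (simp add: scaleC_algebra)
  finally have "y + v = blinfun_apply (resolvent z C) x" using resolvent_iff[OF z] by blast
  moreover have "v = (w - z) *\<^sub>C blinfun_apply (resolvent z C) y"
  proof -
    have y': "(blinfun_apply (resolvent z C) y, z *\<^sub>C blinfun_apply (resolvent z C) y - y) \<in> C"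
      using resolvent_iff[OF z] by blast
    have "((w - z) *\<^sub>C blinfun_apply (resolvent z C) y, (w - z) *\<^sub>C (z *\<^sub>C blinfun_apply (resolvent z C) y - y)) \<in> C"
      by (rule linear_operatorD(4)[OF C y'])
    also have "(w - z) *\<^sub>C (z *\<^sub>C blinfun_apply (resolvent z C) y - y)
        = z *\<^sub>C (w - z) *\<^sub>C blinfun_apply (resolvent z C) y - (w - z) *\<^sub>C y"
      by (simp add: scaleC_algebra left_diff_distrib right_diff_distrib mult.commute)
    finally show ?thesis using resolvent_iff[OF z] v_def by metis
  qed
  ultimately show "blinfun_apply (resolvent z C - resolvent w C) x
      = blinfun_apply ((w - z) *\<^sub>C (resolvent z C o\<^sub>L resolvent w C)) x"
    by (simp add: blinfun.diff_left blinfun_apply_scaleC y_def algebra_simps)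
qed

text \<open>
  The resolvents of an operator and the operators \<open>\<Phi>(1/(z - |t|))\<close> are both of this kind. Continuity
  and holomorphy only depend on the identity.
\<close>
definition pseudo_resolvent :: "complex set \<Rightarrow> (complex \<Rightarrow> 'a::complex_banach \<Rightarrow>\<^sub>L 'a) \<Rightarrow> bool"
  where "pseudo_resolvent U R \<longleftrightarrow> (\<forall>z\<in>U. \<forall>w\<in>U. R z - R w = (w - z) *\<^sub>C (R z o\<^sub>L R w))"

text \<open>
  The identity bounds \<open>R w\<close> by \<open>R z\<close> plus half of \<open>R w\<close>.
\<close>
lemma pseudo_resolvent_local_bound:
  assumes R: "pseudo_resolvent U R" and z: "z \<in> U" and w: "w \<in> U" and close: "cmod (w - z) * norm (R z) \<le> 1 / 2"
  shows "norm (R w) \<le> 2 * norm (R z)"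
proof -
  have "R w = R z + (z - w) *\<^sub>C (R w o\<^sub>L R z)"
    using R z w unfolding pseudo_resolvent_def by (metis add.commute diff_add_cancel)
  then have "norm (R w) \<le> norm (R z) + norm ((z - w) *\<^sub>C (R w o\<^sub>L R z))" by (metis norm_triangle_ineq)
  also have "norm ((z - w) *\<^sub>C (R w o\<^sub>L R z)) \<le> cmod (w - z) * (norm (R w) * norm (R z))"
    by (simp add: norm_scaleC norm_minus_commute mult_left_mono norm_blinfun_compose)
  also have "\<dots> = (cmod (w - z) * norm (R z)) * norm (R w)" by simp
  also have "\<dots> \<le> 1 / 2 * norm (R w)" by (rule mult_right_mono[OF close]) simp
  finally show ?thesis by simp
qed

lemma pseudo_resolvent_tendsto:
  assumes R: "pseudo_resolvent U R" and z: "z \<in> U"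
  shows "(R \<longlongrightarrow> R z) (at z within U)"
proof -
  have "((\<lambda>w. cmod (w - z) * norm (R z)) \<longlongrightarrow> cmod (z - z) * norm (R z)) (at z within U)"
    by (intro tendsto_intros)
  then have small: "\<forall>\<^sub>F w in at z within U. cmod (w - z) * norm (R z) < 1 / 2"
    by (intro order_tendstoD(2)[of _ 0]) auto
  have inU: "\<forall>\<^sub>F w in at z within U. w \<in> U" by (simp add: eventually_at_filter)
  have "((\<lambda>w. R w - R z) \<longlongrightarrow> 0) (at z within U)"
  proof (rule Lim_null_comparison)
    show "\<forall>\<^sub>F w in at z within U. norm (R w - R z) \<le> cmod (w - z) * (2 * norm (R z) * norm (R z))"
      using small inU
    proof (eventually_elim)
      case (elim w)
      show ?case
      proof (cases "w \<in> U")
        case True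
        have "R w - R z = (z - w) *\<^sub>C (R w o\<^sub>L R z)" using R z True by (auto simp: pseudo_resolvent_def)
        then have "norm (R w - R z) \<le> cmod (w - z) * (norm (R w) * norm (R z))"
          by (simp add: norm_scaleC norm_minus_commute mult_left_mono norm_blinfun_compose)
        also have "\<dots> \<le> cmod (w - z) * (2 * norm (R z) * norm (R z))"
          using pseudo_resolvent_local_bound[OF R z True] elim
          by (intro mult_left_mono mult_right_mono) auto
        finally show ?thesis .
      qed (use elim in auto)
    qed
    have "((\<lambda>w. cmod (w - z) * (2 * norm (R z) * norm (R z))) \<longlongrightarrow> cmod (z - z) * (2 * norm (R z) * norm (R z))) (at z within U)"
      by (intro tendsto_intros)
    then show "((\<lambda>w. cmod (w - z) * (2 * norm (R z) * norm (R z))) \<longlongrightarrow> 0) (at z within U)" by simp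
  qed
  then show ?thesis by (simp add: LIM_zero_iff)
qed

lemma pseudo_resolvent_continuous: "pseudo_resolvent U R \<Longrightarrow> continuous_on U R"
  by (simp add: continuous_on_def pseudo_resolvent_tendsto)

lemma pseudo_resolvent_holomorphic:
  assumes R: "pseudo_resolvent U R" and U: "open U" and \<psi>: "cfunctional \<psi>"
  shows "(\<lambda>z. \<psi> (blinfun_apply (R z) x)) holomorphic_on U"
  unfolding holomorphic_on_open[OF U]
proof
  fix z assume z: "z \<in> U"
  have lim: "((\<lambda>w. - \<psi> (blinfun_apply (R w) (blinfun_apply (R z) x))) \<longlongrightarrow> - \<psi> (blinfun_apply (R z) (blinfun_apply (R z) x))) (at z)"
  proof (rule tendsto_minus, rule bounded_linear.tendsto[OF cfunctional_bounded_linear[OF \<psi>]])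
    have "(R \<longlongrightarrow> R z) (at z)" using pseudo_resolvent_tendsto[OF R z] at_within_open[OF z U] by simp
    then show "((\<lambda>w. blinfun_apply (R w) (blinfun_apply (R z) x)) \<longlongrightarrow> blinfun_apply (R z) (blinfun_apply (R z) x)) (at z)"
      by (rule bounded_linear.tendsto[OF blinfun.bounded_linear_left])
  qed
  have "\<forall>\<^sub>F w in at z. w \<in> U \<and> w \<noteq> z"
    using eventually_at_in_open[OF U z] by (auto elim: eventually_mono)
  then have "((\<lambda>w. (\<psi> (blinfun_apply (R w) x) - \<psi> (blinfun_apply (R z) x)) / (w - z))
      \<longlongrightarrow> - \<psi> (blinfun_apply (R z) (blinfun_apply (R z) x))) (at z)"
  proof (intro Lim_transform_eventually[OF lim], eventually_elim)
    case (elim w)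
    have "R w - R z = (z - w) *\<^sub>C (R w o\<^sub>L R z)" using R z elim by (auto simp: pseudo_resolvent_def)
    then have "blinfun_apply (R w - R z) x = blinfun_apply ((z - w) *\<^sub>C (R w o\<^sub>L R z)) x" by simp
    then have "\<psi> (blinfun_apply (R w) x - blinfun_apply (R z) x)
        = \<psi> ((z - w) *\<^sub>C blinfun_apply (R w) (blinfun_apply (R z) x))"
      by (simp add: blinfun.diff_left blinfun_apply_scaleC)
    then have "\<psi> (blinfun_apply (R w) x) - \<psi> (blinfun_apply (R z) x)
        = (z - w) * \<psi> (blinfun_apply (R w) (blinfun_apply (R z) x))"
      by (simp add: cfunctional_diff[OF \<psi>] cfunctional_scaleC[OF \<psi>])
    then show ?case using elim by (simp add: field_simps)
  qed
  then show "\<exists>f'. ((\<lambda>z. \<psi> (blinfun_apply (R z) x)) has_field_derivative f') (at z)"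
    unfolding has_field_derivative_iff by blast
qed

section \<open>Uniqueness of square roots\<close>

text \<open>
  The function \<open>zG(z)\<close> extends from \<open>U\<close> to the punctured plane as an odd function. It is bounded, so
  the singularity at \<open>0\<close> is removable and Liouville's theorem makes it constant.
\<close>
lemma bounded_odd_holomorphic_zero:
  fixes G :: "complex \<Rightarrow> complex"
  assumes U: "open U" and cover: "\<And>z. z \<noteq> 0 \<Longrightarrow> z \<in> U \<or> - z \<in> U" and zero: "0 \<notin> U"
    and hol: "G holomorphic_on U" and bdd: "\<And>z. z \<in> U \<Longrightarrow> cmod (z * G z) \<le> K"
    and even: "\<And>z. z \<in> U \<Longrightarrow> - z \<in> U \<Longrightarrow> G (- z) = G z" and z: "z \<in> U"
  shows "G z = 0"
proof -
  define F where "F z = (if z \<in> U then z * G z else z * G (- z))" for z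
  have F: "F z = z * G z" "F (- z) = - (z * G z)" if "z \<in> U" for z
    using that even[of z] by (auto simp: F_def)
  have "F holomorphic_on U"
    by (rule holomorphic_transform[of "\<lambda>z. z * G z"]) (auto intro!: holomorphic_intros hol simp: F)
  moreover have "F holomorphic_on (uminus ` U)"
  proof (rule holomorphic_transform[of "\<lambda>z. z * G (- z)"])
    have "(G \<circ> uminus) holomorphic_on (uminus ` U)"
      by (intro holomorphic_on_compose_gen[OF _ hol]) (auto intro!: holomorphic_intros)
    then show "(\<lambda>z. z * G (- z)) holomorphic_on (uminus ` U)"
      by (intro holomorphic_intros) (simp add: comp_def)
  qed (use F in auto)
  moreover have "open (uminus ` U)" using U by (rule open_negations)
  ultimately have "F holomorphic_on (U \<union> uminus ` U)" using U by (intro holomorphic_on_Un)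
  moreover have "UNIV - {0} \<subseteq> U \<union> uminus ` U" using cover by (auto simp: image_iff) (metis minus_minus)
  ultimately have FH: "F holomorphic_on UNIV - {0}" by (rule holomorphic_on_subset)
  have Fb: "cmod (F z) \<le> K" if "z \<noteq> 0" for z
    using cover[OF that] F[of z] F[of "- z"] bdd[of z] bdd[of "- z"] by auto
  have "\<forall>\<^sub>F z in at 0. norm (F z) \<le> K" using Fb by (auto simp: eventually_at intro!: exI[of _ 1])
  then obtain H where H: "H holomorphic_on UNIV" "\<And>z. z \<in> UNIV - {0} \<Longrightarrow> H z = F z"
    using holomorphic_on_extend_bounded[OF FH] by auto
  have "bounded (range H)"
  proof (rule boundedI)
    fix y assume "y \<in> range H"
    then obtain z where "y = H z" by auto
    then show "norm y \<le> max K (cmod (H 0))" using H(2)[of z] Fb[of z] by (cases "z = 0") auto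
  qed
  then obtain c where c: "\<And>z. H z = c" using Liouville_theorem[OF H(1)] by (auto simp: constant_on_def)
  have z0: "z \<noteq> 0" using z zero by auto
  have "F z = F (- z)" using H(2)[of z] H(2)[of "- z"] c z0 by auto
  then have "z * G z = 0" using F[OF z] by simp
  then show ?thesis using z0 by simp
qed

text \<open>
  Uniqueness rests on the fact that the conclusion involves \<open>C\<close> only through its square: the
  vector \<open>y\<close> is the value of \<open>R(z\<^sup>2, C\<^sup>2)\<close> at \<open>x\<close>.
\<close>
lemma square_root_resolvent_jump:
  assumes C: "linear_operator C" and z: "z \<in> resolvent_set C" "- z \<in> resolvent_set C" and z0: "z \<noteq> 0"
    and y: "y = (1 / (2 * z)) *\<^sub>C (blinfun_apply (resolvent z C) x - blinfun_apply (resolvent (- z) C) x)"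
  shows "(y, (z\<^sup>2) *\<^sub>C y - x) \<in> C O C"
proof -
  define a where "a = blinfun_apply (resolvent z C) x"
  define b where "b = blinfun_apply (resolvent (- z) C) x"
  have a: "(a, z *\<^sub>C a - x) \<in> C" using resolvent_iff[OF z(1)] a_def by blast
  have b: "(b, (- z) *\<^sub>C b - x) \<in> C" using resolvent_iff[OF z(2)] b_def by blast
  have "(a - b, (z *\<^sub>C a - x) - ((- z) *\<^sub>C b - x)) \<in> C" by (rule linear_operatorD(5)[OF C a b])
  also have "(z *\<^sub>C a - x) - ((- z) *\<^sub>C b - x) = z *\<^sub>C (a + b)" by (simp add: scaleC_algebra)
  finally have "((1 / (2 * z)) *\<^sub>C (a - b), (1 / (2 * z)) *\<^sub>C z *\<^sub>C (a + b)) \<in> C" by (rule linear_operatorD(4)[OF C])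
  moreover have "(1 / (2 * z)) *\<^sub>C z *\<^sub>C (a + b) = (1 / 2) *\<^sub>C (a + b)" using z0 by (simp add: scaleC_scaleC)
  ultimately have 1: "(y, (1 / 2) *\<^sub>C (a + b)) \<in> C" unfolding y a_def b_def by simp
  have "(a + b, (z *\<^sub>C a - x) + ((- z) *\<^sub>C b - x)) \<in> C" by (rule linear_operatorD(3)[OF C a b])
  then have "((1 / 2) *\<^sub>C (a + b), (1 / 2) *\<^sub>C ((z *\<^sub>C a - x) + ((- z) *\<^sub>C b - x))) \<in> C" by (rule linear_operatorD(4)[OF C])
  moreover have "(1 / 2) *\<^sub>C ((z *\<^sub>C a - x) + ((- z) *\<^sub>C b - x)) = (z\<^sup>2) *\<^sub>C y - x"
  proof -
    have "(1 / 2) *\<^sub>C x + (1 / 2) *\<^sub>C x = x" by (simp flip: scaleC_add_left)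
    then show ?thesis using z0 unfolding y a_def[symmetric] b_def[symmetric]
      by (simp add: scaleC_algebra power2_eq_square algebra_simps)
  qed
  ultimately have 2: "((1 / 2) *\<^sub>C (a + b), (z\<^sup>2) *\<^sub>C y - x) \<in> C" by simp
  show ?thesis using 1 2 by blast
qed

lemma square_minus_operator_injective:
  assumes C: "linear_operator C" and z: "z \<in> resolvent_set C" "- z \<in> resolvent_set C"
    and y: "(y, (z\<^sup>2) *\<^sub>C y) \<in> C O C"
  shows "y = 0"
proof -
  obtain v where v: "(y, v) \<in> C" "(v, (z\<^sup>2) *\<^sub>C y) \<in> C" using y by blast
  have inj: "x = 0" if "(x, w *\<^sub>C x - 0) \<in> C" "w \<in> resolvent_set C" for x w
    using that resolvent_iff[of w C x 0] by simp
  have "(z *\<^sub>C y + v, z *\<^sub>C v + (z\<^sup>2) *\<^sub>C y) \<in> C"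
    by (rule linear_operatorD(3)[OF C linear_operatorD(4)[OF C v(1)] v(2)])
  also have "z *\<^sub>C v + (z\<^sup>2) *\<^sub>C y = z *\<^sub>C (z *\<^sub>C y + v) - 0" by (simp add: scaleC_algebra power2_eq_square)
  finally have "z *\<^sub>C y + v = 0" using inj z(1) by blast
  then have "v = (- z) *\<^sub>C y - 0" by (simp add: scaleC_minus_left eq_neg_iff_add_eq_0 add.commute)
  then show "y = 0" using inj v(1) z(2) by metis
qed

lemma square_root_resolvent_jump_unique:
  fixes C D :: "'a::complex_banach operator"
  assumes C: "linear_operator C" and D: "linear_operator D" and sq: "C O C = D O D" and z0: "z \<noteq> 0"
    and z: "z \<in> resolvent_set C" "- z \<in> resolvent_set C" "z \<in> resolvent_set D" "- z \<in> resolvent_set D"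
  shows "resolvent z C - resolvent (- z) C = resolvent z D - resolvent (- z) D"
proof (rule blinfun_eqI)
  fix x :: 'a
  let ?y = "\<lambda>C :: 'a operator. (1 / (2 * z)) *\<^sub>C (blinfun_apply (resolvent z C) x - blinfun_apply (resolvent (- z) C) x)"
  have A: "linear_operator (C O C)"
  proof -
    have "single_valued (C O C)" using C unfolding linear_operator_def by (intro single_valued_relcomp) auto
    moreover have "(0, 0) \<in> C O C" using linear_operatorD(2)[OF C] by blast
    moreover have "(x + u, y + v) \<in> C O C" if "(x, y) \<in> C O C" "(u, v) \<in> C O C" for x y u v
      using that linear_operatorD(3)[OF C] by blast
    moreover have "(c *\<^sub>C x, c *\<^sub>C y) \<in> C O C" if "(x, y) \<in> C O C" for c x y
      using that linear_operatorD(4)[OF C] by blast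
    ultimately show ?thesis unfolding linear_operator_def by blast
  qed
  have "(?y C, (z\<^sup>2) *\<^sub>C ?y C - x) \<in> C O C" by (rule square_root_resolvent_jump[OF C z(1,2) z0 refl])
  moreover have "(?y D, (z\<^sup>2) *\<^sub>C ?y D - x) \<in> C O C"
    unfolding sq by (rule square_root_resolvent_jump[OF D z(3,4) z0 refl])
  ultimately have "(?y C - ?y D, ((z\<^sup>2) *\<^sub>C ?y C - x) - ((z\<^sup>2) *\<^sub>C ?y D - x)) \<in> C O C"
    by (rule linear_operatorD(5)[OF A])
  also have "((z\<^sup>2) *\<^sub>C ?y C - x) - ((z\<^sup>2) *\<^sub>C ?y D - x) = (z\<^sup>2) *\<^sub>C (?y C - ?y D)" by (simp add: scaleC_diff_right)
  finally have "?y C - ?y D = 0" by (rule square_minus_operator_injective[OF C z(1,2)])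
  then have "(2 * z) *\<^sub>C ?y C = (2 * z) *\<^sub>C ?y D" by simp
  then show "blinfun_apply (resolvent z C - resolvent (- z) C) x = blinfun_apply (resolvent z D - resolvent (- z) D) x"
    using z0 by (simp add: scaleC_scaleC blinfun.diff_left)
qed

text \<open>
  The difference of the two resolvents is even on \<open>U \<inter> -U\<close> since both have the same jump
  \<open>R(z) - R(-z)\<close>.
\<close>
lemma square_root_unique:
  fixes C D :: "'a::complex_banach operator"
  assumes C: "linear_operator C" and D: "linear_operator D" and sq: "C O C = D O D"
    and U: "open U" and cover: "\<And>z. z \<noteq> 0 \<Longrightarrow> z \<in> U \<or> - z \<in> U" and zero: "0 \<notin> U" and ne: "U \<noteq> {}"
    and UC: "U \<subseteq> resolvent_set C" and UD: "U \<subseteq> resolvent_set D"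
    and bC: "\<And>z. z \<in> U \<Longrightarrow> norm (z *\<^sub>C resolvent z C) \<le> K" and bD: "\<And>z. z \<in> U \<Longrightarrow> norm (z *\<^sub>C resolvent z D) \<le> K"
  shows "C = D"
proof -
  have pC: "pseudo_resolvent U (\<lambda>z. resolvent z C)" and pD: "pseudo_resolvent U (\<lambda>z. resolvent z D)"
    unfolding pseudo_resolvent_def using resolvent_identity C D UC UD by blast+
  have eq: "resolvent z C = resolvent z D" if z: "z \<in> U" for z
  proof (rule blinfun_eqI, rule cfunctionals_separate_points)
    fix x and \<psi> :: "'a \<Rightarrow> complex" assume \<psi>: "cfunctional \<psi>"
    define G where "G z = \<psi> (blinfun_apply (resolvent z C) x) - \<psi> (blinfun_apply (resolvent z D) x)" for z
    obtain L where L: "\<And>x. norm (\<psi> x) \<le> norm x * L" "L \<ge> 0"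
      using bounded_linear.nonneg_bounded[OF cfunctional_bounded_linear[OF \<psi>]] by blast
    have "G z = 0"
    proof (rule bounded_odd_holomorphic_zero[OF U cover zero _ _ _ z])
      show "G holomorphic_on U" unfolding G_def
        by (intro holomorphic_intros pseudo_resolvent_holomorphic[OF pC U \<psi>] pseudo_resolvent_holomorphic[OF pD U \<psi>])
      fix z assume z: "z \<in> U"
      have "z * G z = \<psi> (blinfun_apply (z *\<^sub>C resolvent z C) x) - \<psi> (blinfun_apply (z *\<^sub>C resolvent z D) x)"
        by (simp add: G_def blinfun_apply_scaleC cfunctional_scaleC[OF \<psi>] right_diff_distrib)
      moreover have "cmod (\<psi> (blinfun_apply (z *\<^sub>C resolvent z C) x)) \<le> K * norm x * L"
        using bC[OF z] norm_blinfun[of "z *\<^sub>C resolvent z C" x] L(2)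
        by (intro order_trans[OF L(1)] mult_right_mono) (meson mult_right_mono norm_ge_zero order_trans)+
      moreover have "cmod (\<psi> (blinfun_apply (z *\<^sub>C resolvent z D) x)) \<le> K * norm x * L"
        using bD[OF z] norm_blinfun[of "z *\<^sub>C resolvent z D" x] L(2)
        by (intro order_trans[OF L(1)] mult_right_mono) (meson mult_right_mono norm_ge_zero order_trans)+
      ultimately show "cmod (z * G z) \<le> K * norm x * L + K * norm x * L"
        using norm_triangle_ineq4[of "\<psi> (blinfun_apply (z *\<^sub>C resolvent z C) x)"] by (smt (verit, best))
    next
      fix z assume z: "z \<in> U" "- z \<in> U"
      have "z \<noteq> 0" using z zero by auto
      then have "resolvent z C - resolvent (- z) C = resolvent z D - resolvent (- z) D"
        using z UC UD by (intro square_root_resolvent_jump_unique[OF C D sq]) auto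
      then have "blinfun_apply (resolvent z C - resolvent (- z) C) x = blinfun_apply (resolvent z D - resolvent (- z) D) x"
        by simp
      then have "\<psi> (blinfun_apply (resolvent z C) x - blinfun_apply (resolvent (- z) C) x)
          = \<psi> (blinfun_apply (resolvent z D) x - blinfun_apply (resolvent (- z) D) x)"
        by (simp add: blinfun.diff_left)
      then show "G (- z) = G z" by (simp add: G_def cfunctional_diff[OF \<psi>] algebra_simps)
    qed
    then show "\<psi> (blinfun_apply (resolvent z C) x) = \<psi> (blinfun_apply (resolvent z D) x)" by (simp add: G_def)
  qed
  obtain z where z: "z \<in> U" using ne by blast
  have "(x, y) \<in> C \<longleftrightarrow> (x, y) \<in> D" for x y
    using resolvent_iff[of z C x "z *\<^sub>C x - y"] resolvent_iff[of z D x "z *\<^sub>C x - y"] UC UD z eq[OF z] by auto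
  then show ?thesis by auto
qed

section \<open>The square square_root as a function in the cosine calculus\<close>

definition slit_plane :: "complex set" where "slit_plane = {z. Im z \<noteq> 0 \<or> Re z < 0}"

definition resolvent_fun :: "complex \<Rightarrow> real \<Rightarrow> complex"
  where "resolvent_fun z t = 1 / (z - complex_of_real \<bar>t\<bar>)"

definition square_fun :: "complex \<Rightarrow> real \<Rightarrow> complex"
  where "square_fun u t = 1 / (u\<^sup>2 + (complex_of_real t)\<^sup>2)"

definition shift_fun :: "real \<Rightarrow> real \<Rightarrow> complex"
  where "shift_fun l t = 1 / (complex_of_real l + complex_of_real \<bar>t\<bar>)"

definition has_kernel :: "(real \<Rightarrow> complex) \<Rightarrow> bool" where "has_kernel F \<longleftrightarrow> (\<exists>g. cosine_kernel g F)"

lemma has_kernel_add: "has_kernel F \<Longrightarrow> has_kernel G \<Longrightarrow> has_kernel (\<lambda>t. F t + G t)"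
  and has_kernel_mult: "has_kernel F \<Longrightarrow> has_kernel G \<Longrightarrow> has_kernel (\<lambda>t. F t * G t)"
  and has_kernel_cmult: "has_kernel F \<Longrightarrow> has_kernel (\<lambda>t. c * F t)"
  unfolding has_kernel_def using cosine_kernel_add cosine_kernel_mult cosine_kernel_cmult by meson+

lemmas has_kernel_intros = has_kernel_add has_kernel_mult has_kernel_cmult

lemma slit_plane_nonzero:
  assumes "z \<in> slit_plane" shows "z - complex_of_real \<bar>t\<bar> \<noteq> 0"
  using assms by (auto simp: slit_plane_def complex_eq_iff)

lemma has_kernel_square_fun: "Re u > 0 \<Longrightarrow> has_kernel (square_fun u)"
  unfolding has_kernel_def square_fun_def[abs_def] using cosine_kernel_square_resolvent(1) by blast

lemma has_kernel_shift_fun: "l > 0 \<Longrightarrow> has_kernel (shift_fun l)"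
  unfolding has_kernel_def shift_fun_def[abs_def] using cosine_kernel_first_order_scaled(1) by blast

text \<open>
  The square root of \<open>- z\<^sup>2\<close> in the right half-plane, so that \<open>1/(z\<^sup>2 - t\<^sup>2) = - square_fun (right_half_root z) t\<close>.
\<close>
definition right_half_root :: "complex \<Rightarrow> complex"
  where "right_half_root z = (if Im z > 0 then - \<i> * z else \<i> * z)"

lemma right_half_root: "(right_half_root z)\<^sup>2 = - (z\<^sup>2)" "Re (right_half_root z) = \<bar>Im z\<bar>" "cmod (right_half_root z) = cmod z"
  by (auto simp: right_half_root_def power_mult_distrib norm_mult)

text \<open>
  With \<open>Q = 1/(z\<^sup>2 - t\<^sup>2)\<close> and any \<open>l\<close> one has
  \<open>1/(z - |t|) = (z + |t|)Q = (z + l)Q - (1 + (l\<^sup>2 - z\<^sup>2)Q)/(l + |t|)\<close>. Choosing \<open>l = |z|\<close> gives all terms the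
  size \<open>1/|z|\<close>.
\<close>
lemma resolvent_fun_decompose:
  fixes z :: complex
  assumes z: "Im z \<noteq> 0"
  shows "resolvent_fun z = (\<lambda>t. - (z + cmod z) * square_fun (right_half_root z) t
    + (- 1 * shift_fun (cmod z) t + (complex_of_real ((cmod z)\<^sup>2) - z\<^sup>2) * (shift_fun (cmod z) t * square_fun (right_half_root z) t)))"
proof
  fix t
  define \<tau> where "\<tau> = complex_of_real \<bar>t\<bar>"
  define l where "l = complex_of_real (cmod z)"
  have z0: "cmod z > 0" using z by auto
  have lt: "l + \<tau> \<noteq> 0" using z0 unfolding l_def \<tau>_def by (simp flip: of_real_add add: add_pos_nonneg less_imp_neq[symmetric])
  have m: "z - \<tau> \<noteq> 0" "z + \<tau> \<noteq> 0" using z unfolding \<tau>_def by (auto simp: complex_eq_iff)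
  have sq: "square_fun (right_half_root z) t = 1 / ((\<tau> - z) * (\<tau> + z))"
    unfolding square_fun_def right_half_root \<tau>_def by (simp add: algebra_simps power2_eq_square flip: of_real_mult)
  have m': "\<tau> - z \<noteq> 0" "\<tau> + z \<noteq> 0" using m by (auto simp: add.commute)
  have "- (z + l) * (1 / ((\<tau> - z) * (\<tau> + z))) + (- 1 * (1 / (l + \<tau>)) + (l\<^sup>2 - z\<^sup>2) * (1 / (l + \<tau>) * (1 / ((\<tau> - z) * (\<tau> + z)))))
      = (- (z + l) * (l + \<tau>) - (\<tau> - z) * (\<tau> + z) + (l\<^sup>2 - z\<^sup>2)) / ((l + \<tau>) * ((\<tau> - z) * (\<tau> + z)))"
    using lt m' by (simp add: divide_simps)
  also have "- (z + l) * (l + \<tau>) - (\<tau> - z) * (\<tau> + z) + (l\<^sup>2 - z\<^sup>2) = (z - \<tau>) * 0 - ((l + \<tau>) * (\<tau> + z))"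
    by (simp add: algebra_simps power2_eq_square)
  also have "((z - \<tau>) * 0 - ((l + \<tau>) * (\<tau> + z))) / ((l + \<tau>) * ((\<tau> - z) * (\<tau> + z))) = 1 / (z - \<tau>)"
    using lt m m' by (simp add: divide_simps)
  finally show "resolvent_fun z t = - (z + cmod z) * square_fun (right_half_root z) t
    + (- 1 * shift_fun (cmod z) t + (complex_of_real ((cmod z)\<^sup>2) - z\<^sup>2) * (shift_fun (cmod z) t * square_fun (right_half_root z) t))"
    unfolding sq resolvent_fun_def shift_fun_def \<tau>_def[symmetric] l_def[symmetric] of_real_power by (rule sym)
qed

lemma resolvent_fun_negative: "resolvent_fun (- complex_of_real l) = (\<lambda>t. - 1 * shift_fun l t)"
proof
  fix t
  have "- complex_of_real l - complex_of_real \<bar>t\<bar> = - (complex_of_real l + complex_of_real \<bar>t\<bar>)" by simp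
  then show "resolvent_fun (- complex_of_real l) t = - 1 * shift_fun l t"
    unfolding resolvent_fun_def shift_fun_def by (simp only: divide_minus_right mult_minus1)
qed

lemma has_kernel_resolvent_fun:
  assumes "z \<in> slit_plane" shows "has_kernel (resolvent_fun z)"
proof (cases "Im z = 0")
  case False
  then have "Re (right_half_root z) > 0" "cmod z > 0" by (auto simp: right_half_root)
  then show ?thesis
    unfolding resolvent_fun_decompose[OF False]
    by (intro has_kernel_intros has_kernel_square_fun has_kernel_shift_fun)
next
  case True
  then have "Re z < 0" "z = - complex_of_real (- Re z)" using assms by (auto simp: slit_plane_def complex_eq_iff)
  then show ?thesis
    using resolvent_fun_negative[of "- Re z"] has_kernel_cmult[OF has_kernel_shift_fun[of "- Re z"], of "- 1"] by simp
qed

context bounded_cosine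
begin

lemma Phi_plus: "has_kernel F \<Longrightarrow> has_kernel G \<Longrightarrow> Phi Cos (\<lambda>t. F t + G t) = Phi Cos F + Phi Cos G"
  and Phi_times: "has_kernel F \<Longrightarrow> has_kernel G \<Longrightarrow> Phi Cos (\<lambda>t. F t * G t) = Phi Cos F o\<^sub>L Phi Cos G"
  and Phi_scale: "has_kernel F \<Longrightarrow> Phi Cos (\<lambda>t. c * F t) = c *\<^sub>C Phi Cos F"
  unfolding has_kernel_def using Phi_add Phi_mult Phi_cmult by meson+

lemma Phi_complex_linear: "has_kernel F \<Longrightarrow> blinfun_apply (Phi Cos F) (c *\<^sub>C x) = c *\<^sub>C blinfun_apply (Phi Cos F) x"
  unfolding has_kernel_def using complex_linear_Phi by (auto simp: complex_linear_def)

lemma Phi_commute: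
  assumes "has_kernel F" "has_kernel G"
  shows "blinfun_apply (Phi Cos F) (blinfun_apply (Phi Cos G) x) = blinfun_apply (Phi Cos G) (blinfun_apply (Phi Cos F) x)"
proof -
  have "Phi Cos F o\<^sub>L Phi Cos G = Phi Cos G o\<^sub>L Phi Cos F"
    using Phi_times[OF assms] Phi_times[OF assms(2,1)] by (simp add: mult.commute)
  then show ?thesis by (metis blinfun_apply_blinfun_compose)
qed

abbreviation R where "R z \<equiv> Phi Cos (resolvent_fun z)"
abbreviation B where "B \<equiv> Phi Cos (shift_fun 1)"
abbreviation S where "S \<equiv> Phi Cos (square_fun 1)"

lemma kernel_B: "has_kernel (shift_fun 1)" and kernel_S: "has_kernel (square_fun 1)"
  by (simp_all add: has_kernel_shift_fun has_kernel_square_fun)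

lemma R_pseudo_resolvent: "pseudo_resolvent slit_plane R"
  unfolding pseudo_resolvent_def
proof (intro ballI)
  fix z w assume z: "z \<in> slit_plane" and w: "w \<in> slit_plane"
  note k = has_kernel_resolvent_fun[OF z] has_kernel_resolvent_fun[OF w]
  have "(\<lambda>t. resolvent_fun z t + (- 1) * resolvent_fun w t) = (\<lambda>t. (w - z) * (resolvent_fun z t * resolvent_fun w t))"
    using slit_plane_nonzero[OF z] slit_plane_nonzero[OF w]
    by (auto simp: fun_eq_iff resolvent_fun_def divide_simps)
  then have "R z + (- 1) *\<^sub>C R w = (w - z) *\<^sub>C (R z o\<^sub>L R w)"
    using Phi_plus[OF k(1) has_kernel_cmult[OF k(2)], of "- 1"] Phi_scale[OF has_kernel_mult[OF k], of "w - z"]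
      Phi_times[OF k] Phi_scale[OF k(2), of "- 1"] by simp
  then show "R z - R w = (w - z) *\<^sub>C (R z o\<^sub>L R w)" by (simp add: scaleC_minus_left)
qed

text \<open>
  This single identity is the resolvent equation between \<open>z\<close> and \<open>-1\<close>, as \<open>B = - R (-1)\<close>.
\<close>
lemma R_B_identity:
  assumes z: "z \<in> slit_plane"
  shows "R z + B = (1 + z) *\<^sub>C (B o\<^sub>L R z)"
proof -
  note k = has_kernel_resolvent_fun[OF z]
  have "1 + complex_of_real \<bar>t\<bar> \<noteq> 0" for t by (simp add: complex_eq_iff)
  then have "(\<lambda>t. resolvent_fun z t + shift_fun 1 t) = (\<lambda>t. (1 + z) * (shift_fun 1 t * resolvent_fun z t))"
    using slit_plane_nonzero[OF z] by (auto simp: fun_eq_iff resolvent_fun_def shift_fun_def divide_simps)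
  then show ?thesis
    using Phi_plus[OF k kernel_B] Phi_scale[OF has_kernel_mult[OF kernel_B k], of "1 + z"] Phi_times[OF kernel_B k] by simp
qed

text \<open>
  With \<open>S = 1/(1 + t\<^sup>2)\<close> and \<open>B = 1/(1 + |t|)\<close> it states \<open>S(1 - 2B + 2B\<^sup>2) = B\<^sup>2\<close>, that is, \<open>1 + C\<^sup>2 = B\<^sup>-\<^sup>2(1 - 2B + 2B\<^sup>2)\<close>
  for \<open>C = B\<^sup>-\<^sup>1 - 1\<close>. It links the resolvent \<open>S\<close> of \<open>-A\<close> with the resolvent \<open>B\<close> of the future root.
\<close>
lemma S_B_identity:
  "blinfun_apply S x + 2 *\<^sub>C blinfun_apply S (blinfun_apply B (blinfun_apply B x))
    = blinfun_apply B (blinfun_apply B x) + 2 *\<^sub>C blinfun_apply S (blinfun_apply B x)"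
proof -
  note k = has_kernel_mult[OF kernel_B kernel_B]
  have e: "square_fun 1 t + 2 * (square_fun 1 t * (shift_fun 1 t * shift_fun 1 t))
      = shift_fun 1 t * shift_fun 1 t + 2 * (square_fun 1 t * shift_fun 1 t)" for t
  proof -
    define \<tau> where "\<tau> = complex_of_real \<bar>t\<bar>"
    have sq: "square_fun 1 t = 1 / (1 + \<tau>\<^sup>2)" by (simp add: square_fun_def \<tau>_def flip: of_real_power)
    have "1 + \<tau> \<noteq> 0" by (simp add: \<tau>_def complex_eq_iff)
    moreover have "1 + \<tau>\<^sup>2 \<noteq> 0" using square_plus_square_nonzero[of 1 "\<bar>t\<bar>"] by (simp add: \<tau>_def)
    ultimately show ?thesis unfolding sq shift_fun_def \<tau>_def[symmetric] of_real_1
      by (simp add: divide_simps) (simp add: algebra_simps power2_eq_square)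
  qed
  have "S + 2 *\<^sub>C (S o\<^sub>L (B o\<^sub>L B)) = Phi Cos (\<lambda>t. square_fun 1 t + 2 * (square_fun 1 t * (shift_fun 1 t * shift_fun 1 t)))"
    by (simp add: Phi_plus Phi_scale Phi_times has_kernel_intros kernel_B kernel_S)
  also have "\<dots> = Phi Cos (\<lambda>t. shift_fun 1 t * shift_fun 1 t + 2 * (square_fun 1 t * shift_fun 1 t))"
    unfolding e ..
  also have "\<dots> = (B o\<^sub>L B) + 2 *\<^sub>C (S o\<^sub>L B)"
    by (simp add: Phi_plus Phi_scale Phi_times has_kernel_intros kernel_B kernel_S)
  finally have "blinfun_apply (S + 2 *\<^sub>C (S o\<^sub>L (B o\<^sub>L B))) x = blinfun_apply ((B o\<^sub>L B) + 2 *\<^sub>C (S o\<^sub>L B)) x" by simp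
  then show ?thesis by (simp add: blinfun.add_left blinfun_apply_scaleC)
qed

text \<open>
  The first bound degenerates at the real axis. The second one is the substitute on the negative axis.
\<close>
lemma norm_R_le:
  obtains K where "\<And>z. Im z \<noteq> 0 \<Longrightarrow> cmod z * norm (R z) \<le> K * (cmod z / \<bar>Im z\<bar>) + K"
    "\<And>l. l > 0 \<Longrightarrow> l * norm (R (- complex_of_real l)) \<le> K" "K \<ge> 0"
proof -
  define J where "J = (\<integral>s. cmod (first_order_kernel s) \<partial>lborel) * M"
  have J: "J \<ge> 0" unfolding J_def using M_nonneg by (intro mult_nonneg_nonneg integral_nonneg_AE) auto
  have nE: "norm (Phi Cos (shift_fun l)) \<le> J / l" if l: "l > 0" for l
    using norm_Phi_le[OF cosine_kernel_first_order_scaled(1)[OF l]] unfolding cosine_kernel_first_order_scaled(2)[OF l]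
    by (simp add: shift_fun_def[abs_def] J_def)
  have nQ: "norm (Phi Cos (square_fun u)) \<le> M / (cmod u * Re u)" if u: "Re u > 0" for u
    using norm_Phi_le[OF cosine_kernel_square_resolvent(1)[OF u]] unfolding cosine_kernel_square_resolvent(2)[OF u]
    by (simp add: square_fun_def[abs_def])
  define K where "K = 2 * M + 2 * J * M + J"
  have K: "K \<ge> 2 * M + 2 * J * M" "K \<ge> J" "K \<ge> 0" using J M_nonneg by (auto simp: K_def)
  show ?thesis
  proof (rule that[of K])
    fix z assume z: "Im z \<noteq> 0"
    define l where "l = cmod z"
    define q where "q = Phi Cos (square_fun (right_half_root z))"
    define e where "e = Phi Cos (shift_fun (cmod z))"
    have l: "l > 0" and u: "Re (right_half_root z) > 0" using z by (auto simp: l_def right_half_root)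
    have nq: "norm q \<le> M / (l * \<bar>Im z\<bar>)" using nQ[OF u] by (simp add: q_def right_half_root l_def)
    have ne: "norm e \<le> J / l" using nE[OF l] by (simp add: e_def l_def)
    have kq: "has_kernel (square_fun (right_half_root z))" and ke: "has_kernel (shift_fun (cmod z))"
      using u l has_kernel_square_fun has_kernel_shift_fun by (auto simp: l_def)
    have "R z = - (z + l) *\<^sub>C q + ((- 1) *\<^sub>C e + (complex_of_real (l\<^sup>2) - z\<^sup>2) *\<^sub>C (e o\<^sub>L q))"
      unfolding resolvent_fun_decompose[OF z] q_def e_def l_def
      by (simp only: Phi_plus Phi_scale Phi_times has_kernel_intros kq ke)
    then have "norm (R z) \<le> cmod (z + l) * norm q + (norm e + cmod (complex_of_real (l\<^sup>2) - z\<^sup>2) * (norm e * norm q))"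
      by (auto intro!: order_trans[OF norm_triangle_ineq] add_mono mult_left_mono norm_blinfun_compose simp: norm_scaleC
          simp flip: minus_add_distrib)
    also have "\<dots> \<le> (2 * l) * (M / (l * \<bar>Im z\<bar>)) + (J / l + (2 * l\<^sup>2) * (J / l * (M / (l * \<bar>Im z\<bar>))))"
    proof (intro add_mono mult_mono nq ne)
      show "cmod (z + complex_of_real l) \<le> 2 * l"
        using norm_triangle_ineq[of z "complex_of_real l"] by (simp add: l_def)
      show "cmod (complex_of_real (l\<^sup>2) - z\<^sup>2) \<le> 2 * l\<^sup>2"
        using norm_triangle_ineq4[of "complex_of_real (l\<^sup>2)" "z\<^sup>2"] by (simp add: l_def norm_power)
    qed (use l J M_nonneg in auto)
    finally have "l * norm (R z) \<le> l * ((2 * l) * (M / (l * \<bar>Im z\<bar>)) + (J / l + (2 * l\<^sup>2) * (J / l * (M / (l * \<bar>Im z\<bar>)))))"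
      using l by (intro mult_left_mono) auto
    also have "\<dots> = (2 * M + 2 * J * M) * (l / \<bar>Im z\<bar>) + J"
      using l z by (simp add: field_simps power2_eq_square)
    also have "\<dots> \<le> K * (l / \<bar>Im z\<bar>) + K"
      using K l by (intro add_mono mult_right_mono) auto
    finally show "cmod z * norm (R z) \<le> K * (cmod z / \<bar>Im z\<bar>) + K" by (simp add: l_def)
  next
    fix l :: real assume l: "l > 0"
    have "norm (R (- complex_of_real l)) = norm (Phi Cos (shift_fun l))"
      unfolding resolvent_fun_negative Phi_scale[OF has_kernel_shift_fun[OF l]] by (simp add: norm_scaleC)
    then show "l * norm (R (- complex_of_real l)) \<le> K" using nE[OF l] l K by (simp add: field_simps)
  qed (rule K)
qed

text \<open>
  Close to the negative axis the bound on the axis is propagated by the resolvent identity.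
\<close>
lemma R_sectorial_bound:
  assumes c: "c > 0"
  obtains K where "\<And>z. z \<in> slit_plane \<Longrightarrow> Re z < 0 \<or> \<bar>Im z\<bar> \<ge> c * cmod z \<Longrightarrow> cmod z * norm (R z) \<le> K"
proof -
  obtain K where K: "\<And>z. Im z \<noteq> 0 \<Longrightarrow> cmod z * norm (R z) \<le> K * (cmod z / \<bar>Im z\<bar>) + K"
    "\<And>l. l > 0 \<Longrightarrow> l * norm (R (- complex_of_real l)) \<le> K" "K \<ge> 0"
    by (rule norm_R_le) (rule that; blast)
  \<comment> \<open>opening of the sector around the negative axis in which \<open>pseudo_resolvent_local_bound\<close> applies\<close>
  define d where "d = min c (1 / (4 * (K + 1)))"
  have d: "d > 0" "d \<le> c" "d * (K + 1) \<le> 1 / 4"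
  proof -
    show "d > 0" "d \<le> c" using c K(3) by (auto simp: d_def)
    have "d * (K + 1) \<le> 1 / (4 * (K + 1)) * (K + 1)" using K(3) by (intro mult_right_mono) (auto simp: d_def)
    also have "\<dots> = 1 / 4" using K(3) by (simp add: field_simps)
    finally show "d * (K + 1) \<le> 1 / 4" .
  qed
  show ?thesis
  proof (rule that[of "max (K * (1 / d) + K) (2 * K)"])
    fix z assume z: "z \<in> slit_plane" and or: "Re z < 0 \<or> \<bar>Im z\<bar> \<ge> c * cmod z"
    have z0: "cmod z > 0" using z by (auto simp: slit_plane_def)
    show "cmod z * norm (R z) \<le> max (K * (1 / d) + K) (2 * K)"
    proof (cases "\<bar>Im z\<bar> \<ge> d * cmod z")
      case True
      then have Im: "\<bar>Im z\<bar> > 0" using d(1) z0 by (meson less_le_trans mult_pos_pos)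
      then have "cmod z / \<bar>Im z\<bar> \<le> 1 / d" using True d(1) by (simp add: field_simps)
      then have "K * (cmod z / \<bar>Im z\<bar>) \<le> K * (1 / d)" using K(3) by (rule mult_left_mono)
      then show ?thesis using K(1)[of z] Im by auto
    next
      case False
      have "d * cmod z \<le> c * cmod z" using d(2) by (intro mult_right_mono) auto
      then have neg: "Re z < 0" using or False by linarith
      define l where "l = cmod z"
      have l: "l > 0" using z0 by (simp add: l_def)
      have "cmod z \<le> \<bar>Re z\<bar> + \<bar>Im z\<bar>" by (rule cmod_le)
      then have "\<bar>Re (z + complex_of_real l)\<bar> \<le> \<bar>Im z\<bar>" using neg abs_Re_le_cmod[of z] by (simp add: l_def)
      then have zl: "cmod (z + complex_of_real l) \<le> 2 * \<bar>Im z\<bar>"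
        using cmod_le[of "z + complex_of_real l"] by simp
      have m: "- complex_of_real l \<in> slit_plane" using l by (simp add: slit_plane_def)
      have Rl: "norm (R (- complex_of_real l)) \<le> K / l" using K(2)[OF l] l by (simp add: field_simps)
      have "cmod (z - - complex_of_real l) * norm (R (- complex_of_real l)) \<le> (2 * \<bar>Im z\<bar>) * (K / l)"
        using zl Rl by (intro mult_mono) auto
      also have "\<dots> \<le> (2 * (d * l)) * (K / l)"
        using False K(3) l by (intro mult_right_mono) (auto simp: l_def)
      also have "\<dots> = 2 * (d * K)" using l by simp
      also have "\<dots> \<le> 1 / 2" using d by (simp add: algebra_simps)
      finally have "norm (R z) \<le> 2 * norm (R (- complex_of_real l))"
        by (rule pseudo_resolvent_local_bound[OF R_pseudo_resolvent m z])
      then have "l * norm (R z) \<le> l * (2 * norm (R (- complex_of_real l)))" using l by (intro mult_left_mono) auto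
      also have "\<dots> \<le> 2 * K" using K(2)[OF l] by simp
      finally show ?thesis by (simp add: l_def)
    qed
  qed
qed

text \<open>
  The operator \<open>B\<^sup>-\<^sup>1 - 1\<close>, that is, the operator with \<open>(1 + C)\<^sup>-\<^sup>1 = B\<close>.
\<close>
definition square_root :: "'a operator" where "square_root = {(x, y). x = blinfun_apply B (x + y)}"

lemma square_root_resolvent_graph:
  assumes z: "z \<in> slit_plane"
  shows "(shift_op z square_root)\<inverse> = blinfun_graph (R z)"
  unfolding shift_op_graph_iff
proof (intro allI)
  fix w x :: 'a
  let ?B = "blinfun_apply B" and ?R = "blinfun_apply (R z)"
  note k = has_kernel_resolvent_fun[OF z]
  have id: "?R v + ?B v = (1 + z) *\<^sub>C ?B (?R v)" for v
    using arg_cong[OF R_B_identity[OF z], of "\<lambda>T. blinfun_apply T v"]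
    by (simp add: blinfun.add_left blinfun_apply_scaleC)
  have comm: "?R (?B v) = ?B (?R v)" for v by (rule Phi_commute[OF k kernel_B])
  have arg: "x + (z *\<^sub>C x - w) = (1 + z) *\<^sub>C x - w" by (simp add: scaleC_algebra)
  have Barg: "?B ((1 + z) *\<^sub>C x - w) = (1 + z) *\<^sub>C ?B x - ?B w"
    by (simp add: blinfun.diff_right Phi_complex_linear[OF kernel_B])
  have "(x, z *\<^sub>C x - w) \<in> square_root \<longleftrightarrow> x = (1 + z) *\<^sub>C ?B x - ?B w"
    unfolding square_root_def by (simp add: arg Barg)
  also have "\<dots> \<longleftrightarrow> x = ?R w"
  proof
    assume "x = ?R w"
    then show "x = (1 + z) *\<^sub>C ?B x - ?B w" using id[of w] by (metis add_diff_cancel_right')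
  next
    assume x: "x = (1 + z) *\<^sub>C ?B x - ?B w"
    have "?R x = ?R ((1 + z) *\<^sub>C ?B x - ?B w)" using x by simp
    also have "\<dots> = (1 + z) *\<^sub>C ?B (?R x) - ?B (?R w)"
      by (simp add: blinfun.diff_right Phi_complex_linear[OF k] comm)
    also have "\<dots> = ?R x + ?B x - ?B (?R w)" using id[of x] by simp
    finally have "?B x = ?B (?R w)" by simp
    then have "x = (1 + z) *\<^sub>C ?B (?R w) - ?B w" using x by simp
    also have "\<dots> = ?R w" using id[of w] by (metis add_diff_cancel_right')
    finally show "x = ?R w" .
  qed
  finally show "(x, z *\<^sub>C x - w) \<in> square_root \<longleftrightarrow> x = ?R w" .
qed

lemma square_root_resolvent:
  "z \<in> slit_plane \<Longrightarrow> resolvent z square_root = R z" "z \<in> slit_plane \<Longrightarrow> z \<in> resolvent_set square_root"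
  using resolvent_eqI[OF square_root_resolvent_graph] by auto

text \<open>
  The Laplace transform in \<open>generates_cosine\<close> at \<open>l = 1\<close> is the operator of the density
  \<open>exp (- |s|)/2\<close>, and one resolvent determines the graph of \<open>A\<close>.
\<close>
lemma resolvent_neg_generator:
  assumes gen: "generates_cosine (neg_op A) Cos"
  shows "(x, y) \<in> A \<longleftrightarrow> x = blinfun_apply S (x + y)"
proof -
  define T where "T = resolvent 1 (neg_op A)"
  have one: "(1::complex) \<in> resolvent_set (neg_op A)"
    and int: "\<And>x. ((\<lambda>t. exp (- t) *\<^sub>R blinfun_apply (Cos t) x) has_integral blinfun_apply T x) {0..}"
    using gen[unfolded generates_cosine_def, THEN conjunct2, rule_format, of 1] by (auto simp: T_def)
  have "T = S"
  proof (rule blinfun_eqI, rule cfunctionals_separate_points)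
    fix x and \<psi> :: "'a \<Rightarrow> complex" assume \<psi>: "cfunctional \<psi>"
    let ?c = "\<lambda>s. \<psi> (blinfun_apply (Cos s) x)"
    let ?g = "\<lambda>s. 1 / (2 * 1) * exp (- (1 * complex_of_real \<bar>s\<bar>))"
    have k: "cosine_kernel ?g (square_fun 1)"
      using cosine_kernel_square_resolvent(1)[of 1] by (simp add: square_fun_def[abs_def])
    have c_even: "?c (- s) = ?c s" for s by (simp add: Cos_even)
    have i: "integrable lborel (\<lambda>s. ?g s * ?c s)" by (rule integrable_kernel_Cos[OF \<psi> cosine_kernelD(1)[OF k]])
    then have si: "set_integrable lborel {0<..} (\<lambda>s. ?g s * ?c s)"
      unfolding set_integrable_def by (rule integrable_mult_indicator[rotated]) simp
    have "\<psi> (blinfun_apply S x) = (\<integral>s. ?g s * ?c s \<partial>lborel)" by (rule cfunctional_Phi[OF k \<psi>])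
    also have "\<dots> = 2 *\<^sub>R (LBINT s:{0<..}. ?g s * ?c s)"
      by (rule integral_even_lborel(2)[OF _ si]) (use i c_even in auto)
    also have "(LBINT s:{0<..}. ?g s * ?c s) = integral {0<..} (\<lambda>s. ?g s * ?c s)"
      by (rule set_borel_integral_eq_integral(2)[OF si])
    also have "((\<lambda>t. \<psi> (exp (- t) *\<^sub>R blinfun_apply (Cos t) x)) has_integral \<psi> (blinfun_apply T x)) {0..}"
      using has_integral_linear[OF int cfunctional_bounded_linear[OF \<psi>]] by (simp add: comp_def)
    then have "((\<lambda>t. \<psi> (exp (- t) *\<^sub>R blinfun_apply (Cos t) x)) has_integral \<psi> (blinfun_apply T x)) {0<..}"
      by (rule has_integral_spike_set_eq[THEN iffD1, rotated 2]) (auto intro: negligible_subset[of "{0}"])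
    then have "((\<lambda>s. 1 / 2 * \<psi> (exp (- s) *\<^sub>R blinfun_apply (Cos s) x)) has_integral 1 / 2 * \<psi> (blinfun_apply T x)) {0<..}"
      by (rule has_integral_mult_right)
    then have "((\<lambda>s. ?g s * ?c s) has_integral 1 / 2 * \<psi> (blinfun_apply T x)) {0<..}"
      by (rule has_integral_eq[rotated]) (simp add: scaleR_scaleC cfunctional_scaleC[OF \<psi>] exp_of_real flip: exp_of_real)
    then have "integral {0<..} (\<lambda>s. ?g s * ?c s) = 1 / 2 * \<psi> (blinfun_apply T x)" by (rule integral_unique)
    finally show "\<psi> (blinfun_apply T x) = \<psi> (blinfun_apply S x)" by (simp add: scaleR_conv_of_real)
  qed
  then have "(x, 1 *\<^sub>C x - w) \<in> neg_op A \<longleftrightarrow> x = blinfun_apply S w" for w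
    using resolvent_iff[OF one] by (simp add: T_def)
  from this[of "x + y"] show ?thesis by (auto simp: neg_op_def)
qed

lemma S_injective:
  assumes gen: "generates_cosine (neg_op A) Cos" and A: "linear_operator A" and v: "blinfun_apply S v = 0"
  shows "v = 0"
proof -
  have "(0, v) \<in> A" using resolvent_neg_generator[OF gen] v by simp
  then show ?thesis using linear_operatorD(1,2)[OF A] by blast
qed

lemma B_injective:
  assumes gen: "generates_cosine (neg_op A) Cos" and A: "linear_operator A" and v: "blinfun_apply B v = 0"
  shows "v = 0"
proof (rule S_injective[OF gen A])
  show "blinfun_apply S v = 0" using S_B_identity[of v] v by (simp add: blinfun.zero_right)
qed

lemma square_root_linear:
  assumes gen: "generates_cosine (neg_op A) Cos" and A: "linear_operator A"
  shows "linear_operator square_root"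
  unfolding linear_operator_def
proof (intro conjI allI impI)
  show "single_valued square_root"
  proof (rule single_valuedI)
    fix x y y' assume "(x, y) \<in> square_root" "(x, y') \<in> square_root"
    then have "blinfun_apply B ((x + y) - (x + y')) = 0"
      unfolding square_root_def blinfun.diff_right by simp
    then have "(x + y) - (x + y') = 0" by (rule B_injective[OF gen A])
    then show "y = y'" by simp
  qed
  show "(0, 0) \<in> square_root" by (simp add: square_root_def blinfun.zero_right)
  show "(x + u, y + v) \<in> square_root" if "(x, y) \<in> square_root" "(u, v) \<in> square_root" for x y u v
  proof -
    have "x + u + (y + v) = (x + y) + (u + v)" by simp
    moreover have "blinfun_apply B (x + y) = x" "blinfun_apply B (u + v) = u" using that by (simp_all add: square_root_def)
    ultimately have "blinfun_apply B (x + u + (y + v)) = x + u" by (simp only: blinfun.add_right[of B "x + y" "u + v"])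
    then show ?thesis by (simp add: square_root_def)
  qed
  show "(c *\<^sub>C x, c *\<^sub>C y) \<in> square_root" if "(x, y) \<in> square_root" for c x y
    using that Phi_complex_linear[OF kernel_B, of c "x + y"] unfolding square_root_def by (simp add: scaleC_add_right)
qed

text \<open>
  Both inclusions are computations with the commuting bounded operators \<open>S\<close> and \<open>B\<close>, based on
  \<open>S_B_identity\<close>: the graph of \<open>A\<close> is \<open>x = S(x + y)\<close> and that of the root is \<open>x = B(x + y)\<close>.
\<close>
lemma square_root_square:
  assumes gen: "generates_cosine (neg_op A) Cos" and A: "linear_operator A"
  shows "square_root O square_root = A"
proof -
  let ?B = "blinfun_apply B" and ?S = "blinfun_apply S"
  have comm: "?B (?S v) = ?S (?B v)" for v by (rule Phi_commute[OF kernel_B kernel_S])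
  have two: "2 *\<^sub>C v = v + v" for v :: 'a using scaleC_add_left[of 1 1 v] by simp
  note lin = blinfun.add_right[of B] blinfun.diff_right[of B] blinfun.add_right[of S] blinfun.diff_right[of S]
  have "(x, y) \<in> A" if xv: "(x, v) \<in> square_root" and vy: "(v, y) \<in> square_root" for x v y
  proof -
    have x: "x = ?B x + ?B v" and v: "v = ?B v + ?B y" using xv vy by (auto simp: square_root_def lin)
    have Bv: "?B v = x - ?B x" using x by (metis add_diff_cancel_left')
    have By: "?B y = v - ?B v" using v by (metis add_diff_cancel_left')
    have BBv: "?B (?B v) = ?B x - ?B (?B x)" using Bv by (simp add: lin)
    have "?B (?B y) = ?B v - ?B (?B v)" using By by (simp add: lin)
    then have BB: "?B (?B (x + y)) = x - 2 *\<^sub>C ?B x + 2 *\<^sub>C ?B (?B x)"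
      unfolding lin BBv Bv two by (simp add: algebra_simps)
    have "?B (?B (?S (x + y))) = ?S (?B (?B (x + y)))" by (simp only: comm)
    also have "\<dots> = ?S x - 2 *\<^sub>C ?S (?B x) + 2 *\<^sub>C ?S (?B (?B x))"
      unfolding BB unfolding lin Phi_complex_linear[OF kernel_S] ..
    also have "\<dots> = ?B (?B x)" using S_B_identity[of x] by (simp add: algebra_simps)
    finally have "?B (?B (?S (x + y) - x)) = 0" by (simp add: lin)
    then have "?S (x + y) - x = 0" using B_injective[OF gen A] by blast
    then show ?thesis using resolvent_neg_generator[OF gen] by simp
  qed
  moreover have "\<exists>v. (x, v) \<in> square_root \<and> (v, y) \<in> square_root" if xy: "(x, y) \<in> A" for x y
  proof -
    define w where "w = x + y"
    have x: "x = ?S w" using xy resolvent_neg_generator[OF gen] by (simp add: w_def)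
    have key: "x = ?B (?B w) + 2 *\<^sub>C ?B x - 2 *\<^sub>C ?B (?B x)"
      using S_B_identity[of w] unfolding x comm by (simp add: algebra_simps)
    \<comment> \<open>this is \<open>Cx\<close>, since \<open>S = B(B + 2S - 2BS)\<close> and \<open>C = B\<^sup>-\<^sup>1 - 1\<close>\<close>
    define v where "v = ?B w + x - 2 *\<^sub>C ?B x"
    have "?B (x + v) = ?B (?B w) + 2 *\<^sub>C ?B x - 2 *\<^sub>C ?B (?B x)"
      unfolding v_def lin Phi_complex_linear[OF kernel_B] by (simp add: two algebra_simps)
    then have "?B (x + v) = x" by (simp only: key[symmetric])
    moreover have "?B (v + y) = v"
    proof -
      have "y = w - x" by (simp add: w_def)
      then have "?B (v + y) = ?B (?B w) - 2 *\<^sub>C ?B (?B x) + ?B w"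
        unfolding v_def by (simp add: lin Phi_complex_linear[OF kernel_B])
      also have "\<dots> = (?B (?B w) + 2 *\<^sub>C ?B x - 2 *\<^sub>C ?B (?B x)) - 2 *\<^sub>C ?B x + ?B w" by simp
      also have "\<dots> = x - 2 *\<^sub>C ?B x + ?B w" by (simp only: key[symmetric])
      also have "\<dots> = v" by (simp add: v_def)
      finally show ?thesis .
    qed
    ultimately show ?thesis by (intro exI[of _ v]) (simp add: square_root_def)
  qed
  ultimately show ?thesis by (auto simp: relcomp_unfold)
qed

end

section \<open>Sectoriality of the square root\<close>

lemma not_slit_plane_in_closure_sector:
  assumes z: "z \<notin> slit_plane" and w: "0 \<le> \<omega>"
  shows "z \<in> closure (sector \<omega>)"
proof -
  have z: "z = complex_of_real (Re z)" "Re z \<ge> 0" using z by (auto simp: slit_plane_def complex_eq_iff)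
  have sec: "complex_of_real r \<in> sector \<omega>" if "r > 0" for r
    using that w by (auto simp: sector_def Arg_of_real)
  have "(\<lambda>n. complex_of_real (Re z + 1 / real (Suc n))) \<longlonglongrightarrow> complex_of_real (Re z + 0)"
    by (intro tendsto_intros LIMSEQ_Suc[OF lim_1_over_n])
  moreover have "complex_of_real (Re z + 1 / real (Suc n)) \<in> sector \<omega>" for n
    using z(2) by (intro sec) (simp add: add_nonneg_pos)
  ultimately show ?thesis using z(1) unfolding closure_sequential
    by (intro exI[of _ "\<lambda>n. complex_of_real (Re z + 1 / real (Suc n))"]) auto
qed

lemma outside_sector_Im_ge:
  assumes z: "z \<notin> closure (sector \<omega>)" and w: "0 < \<omega>" "\<omega> < pi"
  shows "Re z < 0 \<or> \<bar>Im z\<bar> \<ge> sin \<omega> * cmod z"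
proof (rule disjCI)
  assume "\<not> \<bar>Im z\<bar> \<ge> sin \<omega> * cmod z"
  then have lt: "\<bar>Im z\<bar> < sin \<omega> * cmod z" by simp
  have "z \<notin> sector \<omega>" using z closure_subset by blast
  moreover have z0: "z \<noteq> 0" using lt by auto
  ultimately have ge: "\<omega> \<le> \<bar>Arg z\<bar>" using w by (auto simp: sector_def)
  have le: "\<bar>Arg z\<bar> \<le> pi" using Arg_bounded[of z] by auto
  have a: "Re z = cmod z * cos (Arg z)" "Im z = cmod z * sin (Arg z)"
    using rcis_cmod_Arg[of z] by (metis Re_rcis, metis Im_rcis)
  have zr: "Re z = cmod z * cos \<bar>Arg z\<bar>" "\<bar>Im z\<bar> = cmod z * \<bar>sin \<bar>Arg z\<bar>\<bar>"
  proof -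
    have "\<bar>sin \<bar>Arg z\<bar>\<bar> = \<bar>sin (Arg z)\<bar>" by (simp add: abs_if)
    then show "\<bar>Im z\<bar> = cmod z * \<bar>sin \<bar>Arg z\<bar>\<bar>" using a(2) by (simp only: abs_mult abs_norm_cancel)
    show "Re z = cmod z * cos \<bar>Arg z\<bar>" using a(1) by (simp only: cos_abs_real)
  qed
  show "Re z < 0"
  proof (rule ccontr)
    assume "\<not> Re z < 0"
    then have c: "cos \<bar>Arg z\<bar> \<ge> 0" using zr(1) z0 by (metis mult_pos_neg not_le zero_less_norm_iff)
    have half: "\<bar>Arg z\<bar> \<le> pi / 2"
    proof (rule ccontr)
      assume "\<not> \<bar>Arg z\<bar> \<le> pi / 2"
      then have "cos \<bar>Arg z\<bar> < cos (pi / 2)" using le by (intro cos_monotone_0_pi) auto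
      then show False using c by simp
    qed
    then have "sin \<omega> \<le> sin \<bar>Arg z\<bar>" using ge w by (intro sin_monotone_2pi_le) auto
    then have "cmod z * sin \<omega> \<le> cmod z * \<bar>sin \<bar>Arg z\<bar>\<bar>" by (intro mult_left_mono) auto
    then show False using lt zr(2) by (simp add: mult.commute)
  qed
qed

lemma closure_sector_subset:
  assumes w: "0 < \<omega>" "\<omega> < pi / 2" and z: "z \<in> closure (sector \<omega>)"
  shows "cos \<omega> * \<bar>Im z\<bar> \<le> sin \<omega> * Re z"
proof -
  have "sector \<omega> \<subseteq> {z. cos \<omega> * \<bar>Im z\<bar> \<le> sin \<omega> * Re z}"
  proof
    fix z assume "z \<in> sector \<omega>"
    then have a: "\<bar>Arg z\<bar> < \<omega>" using w by (auto simp: sector_def)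
    have r: "Re z = cmod z * cos \<bar>Arg z\<bar>" "Im z = cmod z * sin (Arg z)"
      using rcis_cmod_Arg[of z] by (metis cos_abs_real Re_rcis, metis Im_rcis)
    have "\<bar>sin (Arg z)\<bar> = sin \<bar>Arg z\<bar>"
      using a w sin_ge_zero[of "\<bar>Arg z\<bar>"] by (auto simp: abs_if split: if_splits)
    then have "sin \<omega> * Re z - cos \<omega> * \<bar>Im z\<bar> = cmod z * sin (\<omega> - \<bar>Arg z\<bar>)"
      by (simp add: r abs_mult sin_diff algebra_simps)
    also have "\<dots> \<ge> 0" using a w by (intro mult_nonneg_nonneg sin_ge_zero) auto
    finally show "z \<in> {z. cos \<omega> * \<bar>Im z\<bar> \<le> sin \<omega> * Re z}" by simp
  qed
  moreover have "closed {z. cos \<omega> * \<bar>Im z\<bar> \<le> sin \<omega> * Re z}"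
    by (intro closed_Collect_le continuous_intros)
  ultimately show ?thesis using closure_minimal z by blast
qed

lemma sector_mono: "0 \<le> \<omega> \<Longrightarrow> \<omega> \<le> \<omega>' \<Longrightarrow> 0 < \<omega>' \<Longrightarrow> sector \<omega> \<subseteq> sector \<omega>'"
  by (auto simp: sector_def Arg_of_real split: if_splits)

context bounded_cosine
begin

lemma square_root_sectorial:
  assumes gen: "generates_cosine (neg_op A) Cos" and A: "linear_operator A"
  shows "sectorial 0 square_root"
  unfolding sectorial_def
proof (intro conjI allI impI)
  show "linear_operator square_root" by (rule square_root_linear[OF gen A])
  show "spectrum square_root \<subseteq> closure (sector 0)"
    using square_root_resolvent(2) not_slit_plane_in_closure_sector[of _ 0] by (auto simp: spectrum_def)
  fix \<omega>' assume w: "0 < \<omega>' \<and> \<omega>' < pi"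
  have "sin \<omega>' > 0" using w by (intro sin_gt_zero) auto
  then obtain K where K: "\<And>z. z \<in> slit_plane \<Longrightarrow> Re z < 0 \<or> \<bar>Im z\<bar> \<ge> sin \<omega>' * cmod z \<Longrightarrow> cmod z * norm (R z) \<le> K"
    by (rule R_sectorial_bound) (rule that; blast)
  show "bounded {z *\<^sub>C resolvent z square_root |z. z \<notin> closure (sector \<omega>')}"
  proof (rule boundedI[of _ K])
    fix T assume "T \<in> {z *\<^sub>C resolvent z square_root |z. z \<notin> closure (sector \<omega>')}"
    then obtain z where z: "T = z *\<^sub>C resolvent z square_root" "z \<notin> closure (sector \<omega>')" by blast
    have s: "z \<in> slit_plane" using not_slit_plane_in_closure_sector[of z \<omega>'] z(2) w by auto
    show "norm T \<le> K"
      using K[OF s outside_sector_Im_ge[OF z(2)]] w unfolding z(1) norm_scaleC square_root_resolvent(1)[OF s] by simp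
  qed
qed simp_all

text \<open>
  The uniqueness theorem is applied on the complement of a closed sector of angle between \<open>\<omega>\<close> and
  \<open>\<pi>/2\<close>: together with its negative it covers the punctured plane.
\<close>
lemma sqrt_op_eq_square_root:
  assumes gen: "generates_cosine (neg_op A) Cos" and A: "linear_operator A"
  shows "sqrt_op A = square_root"
  unfolding sqrt_op_def
proof (rule the_equality)
  show "(\<exists>\<omega><pi / 2. sectorial \<omega> square_root) \<and> square_root O square_root = A"
    using square_root_sectorial[OF gen A] square_root_square[OF gen A] by (auto intro: exI[of _ 0])
  fix D assume "(\<exists>\<omega><pi / 2. sectorial \<omega> D) \<and> D O D = A"
  then obtain \<omega> where w: "\<omega> < pi / 2" "sectorial \<omega> D" and sq: "D O D = A" by blast
  have w0: "0 \<le> \<omega>" using w(2) by (simp add: sectorial_def)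
  define \<omega>' where "\<omega>' = (\<omega> + pi / 2) / 2"
  have w': "\<omega> < \<omega>'" "0 < \<omega>'" "\<omega>' < pi / 2" "\<omega>' < pi" using w(1) w0 pi_gt_zero by (auto simp: \<omega>'_def)
  define U where "U = {z. sin \<omega>' * Re z < cos \<omega>' * \<bar>Im z\<bar>}"
  have sc: "sin \<omega>' > 0" "cos \<omega>' > 0" using w' by (auto intro: sin_gt_zero cos_gt_zero)
  have out: "z \<notin> closure (sector \<omega>')" "z \<notin> closure (sector \<omega>)" if "z \<in> U" for z
  proof -
    show 1: "z \<notin> closure (sector \<omega>')" using closure_sector_subset[OF w'(2,3), of z] that by (auto simp: U_def)
    show "z \<notin> closure (sector \<omega>)" using closure_mono[OF sector_mono[OF w0 less_imp_le[OF w'(1)] w'(2)]] 1 by blast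
  qed
  have "\<exists>K. \<forall>z\<in>U. norm (z *\<^sub>C resolvent z E) \<le> K" if E: "sectorial \<omega>0 E" "\<omega>0 < \<omega>'" for E :: "'a operator" and \<omega>0
  proof -
    have "bounded {z *\<^sub>C resolvent z E |z. z \<notin> closure (sector \<omega>')}" using E w' by (auto simp: sectorial_def)
    then obtain K where "\<forall>T\<in>{z *\<^sub>C resolvent z E |z. z \<notin> closure (sector \<omega>')}. norm T \<le> K"
      unfolding bounded_iff by blast
    then show ?thesis using out(1) by blast
  qed
  then obtain K1 K2 where K: "\<And>z. z \<in> U \<Longrightarrow> norm (z *\<^sub>C resolvent z D) \<le> K1" "\<And>z. z \<in> U \<Longrightarrow> norm (z *\<^sub>C resolvent z square_root) \<le> K2"
    using w(2) w'(1,2) square_root_sectorial[OF gen A] by meson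
  show "D = square_root"
  proof (rule square_root_unique[where U = U and K = "max K1 K2"])
    show "linear_operator D" using w(2) by (simp add: sectorial_def)
    show "linear_operator square_root" by (rule square_root_linear[OF gen A])
    show "D O D = square_root O square_root" using sq square_root_square[OF gen A] by simp
    show "open U" unfolding U_def by (intro open_Collect_less continuous_intros)
    show "z \<in> U \<or> - z \<in> U" if "z \<noteq> 0" for z
    proof (rule ccontr)
      assume "\<not> ?thesis"
      then have "cos \<omega>' * \<bar>Im z\<bar> \<le> sin \<omega>' * Re z" "cos \<omega>' * \<bar>Im z\<bar> \<le> - (sin \<omega>' * Re z)" by (auto simp: U_def)
      moreover have "0 \<le> cos \<omega>' * \<bar>Im z\<bar>" using sc by simp
      ultimately have "sin \<omega>' * Re z = 0" "cos \<omega>' * \<bar>Im z\<bar> = 0" by linarith+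
      then show False using sc that by (auto simp: complex_eq_iff)
    qed
    show "0 \<notin> U" by (simp add: U_def)
    have "- 1 \<in> U" using sc by (simp add: U_def)
    then show "U \<noteq> {}" by blast
    show "U \<subseteq> resolvent_set D" using out(2) w(2) by (auto simp: sectorial_def spectrum_def)
    show "U \<subseteq> resolvent_set square_root"
      using square_root_resolvent(2) not_slit_plane_in_closure_sector[OF _ less_imp_le[OF w'(2)]] out(1) by blast
  qed (use K in \<open>auto intro: le_max_iff_disj[THEN iffD2]\<close>)
qed

end

section \<open>Cauchy's integral formula on a sector\<close>

text \<open>
  A majorant of \<open>min(r\<^sup>s, r\<^sup>-\<^sup>s)/r\<close> with the antiderivative \<open>(2/s) arctan(r\<^sup>s)\<close>.
\<close>
definition decay :: "real \<Rightarrow> real \<Rightarrow> real"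
  where "decay s r = 2 * r powr (s - 1) / (1 + r powr (2 * s))"

lemma min_powr_le_decay:
  assumes s: "s > 0" and r: "r > 0"
  shows "min (r powr s) (r powr (- s)) / r \<le> decay s r"
proof -
  define a where "a = r powr s"
  have a: "a > 0" using r by (simp add: a_def)
  have e: "r powr (- s) = 1 / a" "r powr (s - 1) = a / r" "r powr (2 * s) = a * a"
    using r by (simp_all add: a_def powr_minus powr_diff field_simps flip: powr_add)
  have "min a (1 / a) * (1 + a * a) \<le> 2 * a"
  proof (cases "a \<le> 1")
    case True
    then have "a * a \<le> 1" using a by (simp add: mult_le_one)
    then have "a * (1 + a * a) \<le> a * 2" using a by (intro mult_left_mono) auto
    moreover have "min a (1 / a) * (1 + a * a) \<le> a * (1 + a * a)" by (intro mult_right_mono) auto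
    ultimately show ?thesis by linarith
  next
    case False
    then have "1 \<le> a * a" using mult_mono[of 1 a 1 a] by simp
    then have "1 / a * (1 + a * a) \<le> 2 * a" using a by (simp add: field_simps)
    moreover have "min a (1 / a) * (1 + a * a) \<le> 1 / a * (1 + a * a)" by (intro mult_right_mono) auto
    ultimately show ?thesis by linarith
  qed
  then have "min a (1 / a) \<le> 2 * a / (1 + a * a)"
    by (subst pos_le_divide_eq) (auto simp: add_pos_nonneg)
  then have "min a (1 / a) / r \<le> 2 * a / (1 + a * a) / r" using r by (intro divide_right_mono) auto
  then show ?thesis unfolding decay_def e by (simp add: a_def[symmetric] mult.commute)
qed

lemma decay_nonneg: "0 \<le> decay s r"
  by (simp add: decay_def add_nonneg_nonneg)

lemma set_integrable_decay:
  assumes s: "s > 0"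
  shows "set_integrable lborel {0<..} (decay s)"
proof -
  have "set_integrable lborel (einterval 0 \<infinity>) (decay s)"
  proof (rule interval_integral_FTC_nonneg(1)[where F = "\<lambda>r. 2 / s * arctan (r powr s)"])
    fix r :: real assume "0 < ereal r"
    then have r: "r > 0" by simp
    have "((\<lambda>r. 2 / s * arctan (r powr s)) has_real_derivative 2 / s * (inverse (1 + (r powr s)\<^sup>2) * (s * r powr (s - 1)))) (at r)"
      using r by (intro DERIV_cmult DERIV_chain2[OF DERIV_arctan] has_real_derivative_powr)
    also have "2 / s * (inverse (1 + (r powr s)\<^sup>2) * (s * r powr (s - 1))) = decay s r"
      using s r by (simp add: decay_def divide_inverse powr_powr power2_eq_square flip: powr_add)
    finally show "((\<lambda>r. 2 / s * arctan (r powr s)) has_real_derivative decay s r) (at r)" .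
    have "1 + r powr (2 * s) \<noteq> 0" by (smt (verit) powr_ge_zero)
    then show "isCont (decay s) r"
      unfolding decay_def[abs_def] using r by (intro continuous_intros) auto
  next
    show "AE r in lborel. 0 < ereal r \<longrightarrow> ereal r < \<infinity> \<longrightarrow> 0 \<le> decay s r" by (simp add: decay_nonneg)
    have "((\<lambda>r. r powr s) \<longlongrightarrow> 0) (at_right 0)" using s by real_asymp
    then have "((\<lambda>r. 2 / s * arctan (r powr s)) \<longlongrightarrow> 2 / s * arctan 0) (at_right 0)" by (intro tendsto_intros)
    then show "(((\<lambda>r. 2 / s * arctan (r powr s)) \<circ> real_of_ereal) \<longlongrightarrow> 0) (at_right 0)"
      unfolding zero_ereal_def ereal_tendsto_simps by simp
    have "filterlim (\<lambda>r. r powr s) at_top at_top" using s by real_asymp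
    then have "((\<lambda>r. 2 / s * arctan (r powr s)) \<longlongrightarrow> 2 / s * (pi / 2)) at_top"
      by (intro tendsto_intros filterlim_compose[OF tendsto_arctan_at_top])
    then show "(((\<lambda>r. 2 / s * arctan (r powr s)) \<circ> real_of_ereal) \<longlongrightarrow> 2 / s * (pi / 2)) (at_left \<infinity>)"
      unfolding ereal_tendsto_simps .
  qed simp
  then show ?thesis by (simp add: zero_ereal_def)
qed

text \<open>
  The integrand \<open>f(z)/(z - t) dz\<close> on the ray with angle \<open>\<alpha>\<close>.
\<close>
definition ray_integrand :: "(complex \<Rightarrow> complex) \<Rightarrow> real \<Rightarrow> real \<Rightarrow> real \<Rightarrow> complex"
  where "ray_integrand f t \<alpha> r = cis \<alpha> * f (complex_of_real r * cis \<alpha>) / (complex_of_real r * cis \<alpha> - complex_of_real t)"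

lemma ray_in_sector:
  assumes "\<bar>\<alpha>\<bar> < \<phi>" "\<phi> < pi" "r > 0"
  shows "complex_of_real r * cis \<alpha> \<in> sector \<phi>"
proof -
  have "Arg (complex_of_real r * cis \<alpha>) = \<alpha>"
    using assms by (subst Arg_times_of_real) (auto intro!: Arg_cis)
  then show ?thesis using assms by (auto simp: sector_def)
qed

locale sector_function =
  fixes f :: "complex \<Rightarrow> complex" and \<phi> \<theta> M s :: real
  assumes angles: "0 < \<theta>" "\<theta> < \<phi>" "\<phi> < pi" and hol: "f holomorphic_on sector \<phi>"
    and s: "s > 0" and M: "M > 0"
    and bound: "\<And>z. z \<in> sector \<phi> \<Longrightarrow> cmod (f z) \<le> M * min (cmod z powr s) (cmod z powr (- s))"
begin

lemma sin_pos: "sin \<theta> > 0" using angles by (intro sin_gt_zero) auto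

context
  fixes \<alpha> :: real assumes \<alpha>: "\<bar>\<alpha>\<bar> = \<theta>"
begin

lemma abs_sin_\<alpha>: "\<bar>sin \<alpha>\<bar> = sin \<theta>"
proof (cases "\<alpha> \<ge> 0")
  case True then show ?thesis using \<alpha> sin_pos by simp
next
  case False
  then have "\<alpha> = - \<theta>" using \<alpha> by simp
  then show ?thesis using sin_pos by simp
qed

lemma ray: "r > 0 \<Longrightarrow> complex_of_real r * cis \<alpha> \<in> sector \<phi>"
  using angles \<alpha> by (intro ray_in_sector) auto

lemma norm_f_ray_le: "r > 0 \<Longrightarrow> cmod (f (complex_of_real r * cis \<alpha>)) / r \<le> M * decay s r"
proof -
  assume r: "r > 0"
  have "cmod (f (complex_of_real r * cis \<alpha>)) \<le> M * min (r powr s) (r powr (- s))"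
    using bound[OF ray[OF r]] r by (simp add: norm_mult)
  then have "cmod (f (complex_of_real r * cis \<alpha>)) / r \<le> M * min (r powr s) (r powr (- s)) / r"
    using r by (intro divide_right_mono) auto
  also have "\<dots> = M * (min (r powr s) (r powr (- s)) / r)" by simp
  also have "\<dots> \<le> M * decay s r" using M min_powr_le_decay[OF s r] by (intro mult_left_mono) auto
  finally show ?thesis .
qed

lemma continuous_on_f_ray: "continuous_on {0<..} (\<lambda>r. f (complex_of_real r * cis \<alpha>))"
  by (rule continuous_on_compose2[OF holomorphic_on_imp_continuous_on[OF hol]])
    (auto intro!: continuous_intros ray)

lemma ray_denominator: "r * sin \<theta> \<le> cmod (complex_of_real r * cis \<alpha> - complex_of_real t)" if "r > 0"
proof -
  have "\<bar>Im (complex_of_real r * cis \<alpha> - complex_of_real t)\<bar> = r * sin \<theta>"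
    using that abs_sin_\<alpha> by (simp add: abs_mult)
  then show ?thesis by (metis abs_Im_le_cmod)
qed

lemma ray_denominator_nonzero: "r > 0 \<Longrightarrow> complex_of_real r * cis \<alpha> - complex_of_real t \<noteq> 0"
  using ray_denominator[of r t] sin_pos by (metis mult_pos_pos norm_zero not_le)

lemma continuous_on_ray_integrand: "continuous_on {0<..} (ray_integrand f t \<alpha>)"
  unfolding ray_integrand_def[abs_def]
  by (intro continuous_intros continuous_on_f_ray) (use ray_denominator_nonzero in auto)

lemma norm_ray_integrand_le: "r > 0 \<Longrightarrow> cmod (ray_integrand f t \<alpha> r) \<le> M / sin \<theta> * decay s r"
proof -
  assume r: "r > 0"
  have "cmod (ray_integrand f t \<alpha> r) \<le> cmod (f (complex_of_real r * cis \<alpha>)) / (r * sin \<theta>)"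
    unfolding ray_integrand_def norm_divide norm_mult norm_cis
    using ray_denominator[OF r, of t] r sin_pos by (simp add: frac_le)
  also have "\<dots> = cmod (f (complex_of_real r * cis \<alpha>)) / r / sin \<theta>" by simp
  also have "\<dots> \<le> M * decay s r / sin \<theta>" using norm_f_ray_le[OF r] sin_pos by (intro divide_right_mono) auto
  finally show ?thesis by simp
qed

lemma set_integrable_ray_integrand: "set_integrable lborel {0<..} (ray_integrand f t \<alpha>)"
proof (rule set_integrable_bound)
  show "set_integrable lborel {0<..} (\<lambda>r. M / sin \<theta> * decay s r)"
    using set_integrable_mult_right[OF set_integrable_decay[OF s]] by simp
  show "set_borel_measurable lborel {0<..} (ray_integrand f t \<alpha>)"
    using borel_measurable_continuous_on_indicator[OF _ continuous_on_ray_integrand]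
    by (simp add: set_borel_measurable_def)
  show "AE r in lborel. r \<in> {0<..} \<longrightarrow> norm (ray_integrand f t \<alpha> r) \<le> norm (M / sin \<theta> * decay s r)"
    using norm_ray_integrand_le M sin_pos decay_nonneg[of s] by (intro AE_I2) (auto simp: abs_mult)
qed

lemma ray_integral_tendsto:
  "(\<lambda>n. integral {exp (- real n)..exp (real n)} (ray_integrand f t \<alpha>)) \<longlonglongrightarrow> (LBINT r:{0<..}. ray_integrand f t \<alpha> r)"
proof -
  define I where "I n = {exp (- real n)..exp (real n)}" for n :: nat
  have U: "(\<Union>n. I n) = {0<..}"
  proof (rule set_eqI, rule iffI)
    fix r assume "r \<in> (\<Union>n. I n)"
    then show "r \<in> {0<..}" by (auto simp: I_def intro: less_le_trans[OF exp_gt_zero])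
  next
    fix r :: real assume r: "r \<in> {0<..}"
    obtain n where n: "\<bar>ln r\<bar> \<le> real n" using real_arch_simple by blast
    then have "exp (- real n) \<le> exp (ln r)" "exp (ln r) \<le> exp (real n)" unfolding exp_le_cancel_iff by linarith+
    moreover have "exp (ln r) = r" using r by simp
    ultimately have "r \<in> I n" unfolding I_def atLeastAtMost_iff by metis
    then show "r \<in> (\<Union>n. I n)" by blast
  qed
  have "(\<lambda>n. LBINT r:I n. ray_integrand f t \<alpha> r) \<longlonglongrightarrow> (LBINT r:(\<Union>n. I n). ray_integrand f t \<alpha> r)"
  proof (rule set_integral_cont_up)
    show "incseq I" unfolding I_def incseq_def by (auto intro: order_trans)
    show "set_integrable lborel (\<Union>n. I n) (ray_integrand f t \<alpha>)" unfolding U by (rule set_integrable_ray_integrand)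
  qed (simp add: I_def)
  moreover have "(LBINT r:I n. ray_integrand f t \<alpha> r) = integral (I n) (ray_integrand f t \<alpha>)" for n
  proof (rule set_borel_integral_eq_integral(2))
    have "I n \<subseteq> {0<..}" using U by blast
    then show "set_integrable lborel (I n) (ray_integrand f t \<alpha>)"
      by (rule set_integrable_subset[OF set_integrable_ray_integrand, rotated]) (simp add: I_def)
  qed
  ultimately show ?thesis unfolding U by (simp add: I_def)
qed

end

context
  fixes t :: real assumes t: "t > 0"
begin

text \<open>
  The Cauchy integrand in the coordinate \<open>w = log z\<close>, which turns the sector into a convex strip and
  the truncated sector boundary into a rectangle.
\<close>
definition strip_integrand :: "complex \<Rightarrow> complex"
  where "strip_integrand w = f (exp w) * exp w / (exp w - complex_of_real t)"

lemma exp_in_sector: "\<bar>Im w\<bar> < \<phi> \<Longrightarrow> exp w \<in> sector \<phi>"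
  using ray_in_sector[of "Im w" \<phi> "exp (Re w)"] angles by (simp add: exp_eq_polar)

lemma exp_minus_nonzero: "\<bar>Im w\<bar> < \<phi> \<Longrightarrow> w \<noteq> complex_of_real (ln t) \<Longrightarrow> exp w - complex_of_real t \<noteq> 0"
proof
  assume w: "\<bar>Im w\<bar> < \<phi>" "w \<noteq> complex_of_real (ln t)" and "exp w - complex_of_real t = 0"
  then have "exp w = exp (complex_of_real (ln t))" using t by (simp add: exp_of_real)
  then have "w = complex_of_real (ln t)"
    by (rule exp_complex_eqI[rotated]) (use w angles in auto)
  with w show False by simp
qed

text \<open>
  The pole at \<open>log t\<close> is split off by writing \<open>exp w - t = (w - log t) p(w)\<close> with \<open>p\<close> holomorphic; \<open>p\<close> has
  no zero in the strip because the strip is narrower than \<open>2\<pi>\<close>.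
\<close>
lemma strip_Cauchy:
  assumes N: "N > \<bar>ln t\<bar>"
  shows "(strip_integrand has_contour_integral (2 * pi * \<i> * f (complex_of_real t))) (rectpath (Complex (- N) (- \<theta>)) (Complex N \<theta>))"
proof -
  let ?\<tau> = "complex_of_real (ln t)"
  define S where "S = {w. \<bar>Im w\<bar> < \<phi>}"
  have S: "open S" "convex S"
  proof -
    show "open S" unfolding S_def by (intro open_Collect_less continuous_intros)
    have "S = {w. Im w < \<phi>} \<inter> {w. Im w > - \<phi>}" by (auto simp: S_def)
    then show "convex S" by (auto intro: convex_Int convex_halfspace_Im_lt convex_halfspace_Im_gt)
  qed
  have et: "exp ?\<tau> = complex_of_real t" using t by (simp add: exp_of_real)
  define p where "p w = (if w = ?\<tau> then deriv exp ?\<tau> else (exp w - exp ?\<tau>) / (w - ?\<tau>))" for w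
  have dexp: "deriv exp ?\<tau> = complex_of_real t" using et by (simp add: DERIV_imp_deriv[OF DERIV_exp])
  have ph: "p holomorphic_on S" unfolding p_def by (rule pole_lemma_open[OF _ S(1)]) (intro holomorphic_intros)
  have p0: "p w \<noteq> 0" if "w \<in> S" for w
    using that exp_minus_nonzero[of w] t et dexp by (auto simp: p_def S_def)
  have qh: "(\<lambda>w. f (exp w) * exp w / p w) holomorphic_on S"
  proof -
    have "(f \<circ> exp) holomorphic_on S"
      by (rule holomorphic_on_compose_gen[OF _ hol]) (auto intro!: holomorphic_intros exp_in_sector simp: S_def)
    then have "(\<lambda>w. f (exp w)) holomorphic_on S" by (simp add: comp_def)
    then show ?thesis by (intro holomorphic_intros ph) (use p0 in auto)
  qed
  let ?\<gamma> = "rectpath (Complex (- N) (- \<theta>)) (Complex N \<theta>)"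
  have \<tau>box: "?\<tau> \<in> box (Complex (- N) (- \<theta>)) (Complex N \<theta>)"
    using N angles by (auto simp: in_box_complex_iff)
  have "path_image ?\<gamma> = cbox (Complex (- N) (- \<theta>)) (Complex N \<theta>) - box (Complex (- N) (- \<theta>)) (Complex N \<theta>)"
    by (rule path_image_rectpath_cbox_minus_box) (use N angles in auto)
  moreover have "cbox (Complex (- N) (- \<theta>)) (Complex N \<theta>) \<subseteq> S"
    using angles by (auto simp: S_def in_cbox_complex_iff)
  ultimately have img: "path_image ?\<gamma> \<subseteq> S - {?\<tau>}" using \<tau>box by auto
  have "((\<lambda>w. f (exp w) * exp w / p w / (w - ?\<tau>)) has_contour_integral
      (2 * pi * \<i> * winding_number ?\<gamma> ?\<tau> * (f (exp ?\<tau>) * exp ?\<tau> / p ?\<tau>))) ?\<gamma>"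
    by (rule Cauchy_integral_formula_convex_simple[OF S(2) qh])
      (use S(1) angles img in \<open>auto simp: interior_open S_def\<close>)
  moreover have "winding_number ?\<gamma> ?\<tau> = 1" by (rule winding_number_rectpath[OF \<tau>box])
  moreover have "f (exp ?\<tau>) * exp ?\<tau> / p ?\<tau> = f (complex_of_real t)"
    using t et dexp by (simp add: p_def)
  ultimately have "((\<lambda>w. f (exp w) * exp w / p w / (w - ?\<tau>)) has_contour_integral (2 * pi * \<i> * f (complex_of_real t))) ?\<gamma>"
    by simp
  then show ?thesis
  proof (rule has_contour_integral_eq)
    fix w assume "w \<in> path_image ?\<gamma>"
    then have "w \<noteq> ?\<tau>" using img by auto
    then show "f (exp w) * exp w / p w / (w - ?\<tau>) = strip_integrand w"
      using et by (simp add: p_def strip_integrand_def)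
  qed
qed

lemma continuous_on_strip_integrand: "continuous_on {w. \<bar>Im w\<bar> < \<phi> \<and> w \<noteq> complex_of_real (ln t)} strip_integrand"
proof -
  have "continuous_on {w. \<bar>Im w\<bar> < \<phi> \<and> w \<noteq> complex_of_real (ln t)} (\<lambda>w. f (exp w))"
    by (rule continuous_on_compose2[OF holomorphic_on_imp_continuous_on[OF hol]])
      (auto intro!: continuous_intros exp_in_sector)
  then show ?thesis unfolding strip_integrand_def[abs_def]
    by (intro continuous_intros) (use exp_minus_nonzero in auto)
qed

text \<open>
  On a horizontal side the substitution \<open>r = exp x\<close> leads back to the ray.
\<close>
lemma strip_horizontal:
  assumes \<alpha>: "\<bar>\<alpha>\<bar> = \<theta>"
  shows "contour_integral (linepath (Complex (- real n) \<alpha>) (Complex (real n) \<alpha>)) strip_integrand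
    = integral {exp (- real n)..exp (real n)} (ray_integrand f t \<alpha>)"
proof -
  define g where "g x = exp (- real n + x * (2 * real n))" for x :: real
  have gd: "(g has_field_derivative (2 * real n) * g x) (at x within {0..1})" for x
    unfolding g_def by (auto intro!: derivative_eq_intros)
  have mono: "g x \<in> {exp (- real n)..exp (real n)}" if "x \<in> {0..1}" for x
    using that mult_left_le_one_le[of "2 * real n" x] by (auto simp: g_def)
  have c: "continuous_on {exp (- real n)..exp (real n)} (ray_integrand f t \<alpha>)"
    by (rule continuous_on_subset[OF continuous_on_ray_integrand[OF \<alpha>]]) (auto intro: less_le_trans[OF exp_gt_zero])
  have "((\<lambda>x. ((2 * real n) * g x) *\<^sub>R ray_integrand f t \<alpha> (g x)) has_integral (integral {g 0..g 1} (ray_integrand f t \<alpha>))) {0..1}"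
  proof (rule has_integral_substitution[OF _ _ _ c gd])
    show "g ` {0..1} \<subseteq> {exp (- real n)..exp (real n)}" using mono by blast
  qed (simp_all add: g_def)
  moreover have "strip_integrand (linepath (Complex (- real n) \<alpha>) (Complex (real n) \<alpha>) x) * (Complex (real n) \<alpha> - Complex (- real n) \<alpha>)
      = ((2 * real n) * g x) *\<^sub>R ray_integrand f t \<alpha> (g x)" for x
  proof -
    have w: "linepath (Complex (- real n) \<alpha>) (Complex (real n) \<alpha>) x = Complex (- real n + x * (2 * real n)) \<alpha>"
      by (simp add: linepath_def complex_eq_iff algebra_simps)
    have e: "exp (Complex (- real n + x * (2 * real n)) \<alpha>) = complex_of_real (g x) * cis \<alpha>"
      by (simp add: exp_eq_polar g_def)
    have d: "Complex (real n) \<alpha> - Complex (- real n) \<alpha> = complex_of_real (2 * real n)" by (simp add: complex_eq_iff)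
    show ?thesis unfolding w strip_integrand_def e d ray_integrand_def by (simp add: scaleR_conv_of_real)
  qed
  ultimately have "((\<lambda>x. strip_integrand (linepath (Complex (- real n) \<alpha>) (Complex (real n) \<alpha>) x) * (Complex (real n) \<alpha> - Complex (- real n) \<alpha>))
      has_integral (integral {exp (- real n)..exp (real n)} (ray_integrand f t \<alpha>))) {0..1}"
    by (simp add: g_def)
  then show ?thesis
    by (intro contour_integral_unique) (simp add: has_contour_integral_linepath)
qed

lemma strip_vertical_bound:
  assumes x: "\<bar>x\<bar> > \<bar>ln t\<bar>" and y: "\<bar>y\<bar> \<le> \<theta>"
  shows "cmod (strip_integrand (Complex x y)) \<le> M * exp (- (s * \<bar>x\<bar>)) * (exp x / \<bar>exp x - t\<bar>)"
proof -
  have w: "\<bar>Im (Complex x y)\<bar> < \<phi>" using y angles by simp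
  have n: "cmod (exp (Complex x y)) = exp x" by (simp add: norm_exp_eq_Re)
  have "cmod (f (exp (Complex x y))) \<le> M * min (exp x powr s) (exp x powr (- s))"
    using bound[OF exp_in_sector[OF w]] by (simp add: n)
  also have "min (exp x powr s) (exp x powr (- s)) = exp (- (s * \<bar>x\<bar>))"
    using s by (auto simp: powr_def min_def abs_if not_le mult_le_0_iff zero_le_mult_iff)
  finally have 1: "cmod (f (exp (Complex x y))) \<le> M * exp (- (s * \<bar>x\<bar>))" .
  have 2: "\<bar>exp x - t\<bar> \<le> cmod (exp (Complex x y) - complex_of_real t)"
    using norm_triangle_ineq3[of "exp (Complex x y)" "complex_of_real t"] t by (simp add: n)
  have "x \<noteq> ln t" using x by auto
  then have "exp x \<noteq> t" using t by (metis ln_exp)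
  then have 3: "\<bar>exp x - t\<bar> > 0" by simp
  show ?thesis
    unfolding strip_integrand_def norm_divide norm_mult n
    using mult_mono[OF 1 frac_le[OF _ order_refl 3 2, of "exp x"]] M by simp
qed

lemma strip_vertical_tendsto:
  fixes \<sigma> :: real assumes \<sigma>: "\<bar>\<sigma>\<bar> = 1" and a: "\<bar>a\<bar> = \<theta>"
  shows "(\<lambda>n. contour_integral (linepath (Complex (\<sigma> * real n) a) (Complex (\<sigma> * real n) (- a))) strip_integrand) \<longlonglongrightarrow> 0"
proof (rule Lim_null_comparison)
  let ?b = "\<lambda>n::nat. M * exp (- (s * real n)) * (exp (\<sigma> * real n) / \<bar>exp (\<sigma> * real n) - t\<bar>) * (2 * \<theta>)"
  show "\<forall>\<^sub>F n in sequentially. norm (contour_integral (linepath (Complex (\<sigma> * real n) a) (Complex (\<sigma> * real n) (- a))) strip_integrand) \<le> ?b n"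
    using eventually_gt_at_top[of "nat \<lceil>\<bar>ln t\<bar>\<rceil>"]
  proof eventually_elim
    case (elim n)
    then have n: "\<bar>ln t\<bar> < real n" by linarith
    let ?p = "linepath (Complex (\<sigma> * real n) a) (Complex (\<sigma> * real n) (- a))"
    have img: "\<exists>y. w = Complex (\<sigma> * real n) y \<and> \<bar>y\<bar> \<le> \<theta>" if w: "w \<in> path_image ?p" for w
    proof -
      obtain u where u: "0 \<le> u" "u \<le> 1" "w = (1 - u) *\<^sub>R Complex (\<sigma> * real n) a + u *\<^sub>R Complex (\<sigma> * real n) (- a)"
        using w unfolding path_image_linepath in_segment by blast
      have "w = Complex (\<sigma> * real n) ((1 - 2 * u) * a)" unfolding u(3) by (simp add: complex_eq_iff algebra_simps)
      moreover have "\<bar>(1 - 2 * u) * a\<bar> \<le> 1 * \<theta>" unfolding abs_mult a using u angles by (intro mult_right_mono) auto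
      ultimately show ?thesis by auto
    qed
    have ab: "\<bar>\<sigma> * real n\<bar> = real n" using \<sigma> by (simp add: abs_mult)
    have "norm (contour_integral ?p strip_integrand)
        \<le> M * exp (- (s * real n)) * (exp (\<sigma> * real n) / \<bar>exp (\<sigma> * real n) - t\<bar>) * norm (Complex (\<sigma> * real n) (- a) - Complex (\<sigma> * real n) a)"
    proof (rule contour_integral_bound_linepath)
      have "continuous_on (path_image ?p) strip_integrand"
      proof (rule continuous_on_subset[OF continuous_on_strip_integrand], rule subsetI)
        fix w assume "w \<in> path_image ?p"
        then obtain y where y: "w = Complex (\<sigma> * real n) y" "\<bar>y\<bar> \<le> \<theta>" using img by blast
        have "w \<noteq> complex_of_real (ln t)"
        proof
          assume "w = complex_of_real (ln t)"
          then have "\<sigma> * real n = ln t" using y by (simp add: complex_eq_iff)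
          then show False using n ab by simp
        qed
        then show "w \<in> {w. \<bar>Im w\<bar> < \<phi> \<and> w \<noteq> complex_of_real (ln t)}" using y angles by simp
      qed
      then show "strip_integrand contour_integrable_on ?p"
        by (intro contour_integrable_continuous_linepath) (simp add: path_image_linepath)
      show "0 \<le> M * exp (- (s * real n)) * (exp (\<sigma> * real n) / \<bar>exp (\<sigma> * real n) - t\<bar>)" using M by simp
      fix w assume "w \<in> closed_segment (Complex (\<sigma> * real n) a) (Complex (\<sigma> * real n) (- a))"
      then obtain y where y: "w = Complex (\<sigma> * real n) y" "\<bar>y\<bar> \<le> \<theta>" using img by (auto simp: path_image_linepath)
      show "norm (strip_integrand w) \<le> M * exp (- (s * real n)) * (exp (\<sigma> * real n) / \<bar>exp (\<sigma> * real n) - t\<bar>)"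
        using strip_vertical_bound[of "\<sigma> * real n" y] n y ab by simp
    qed
    also have "norm (Complex (\<sigma> * real n) (- a) - Complex (\<sigma> * real n) a) = 2 * \<theta>"
    proof -
      have "Complex (\<sigma> * real n) (- a) - Complex (\<sigma> * real n) a = \<i> * complex_of_real (- 2 * a)"
        by (simp add: complex_eq_iff)
      then show ?thesis using a by (simp add: norm_mult)
    qed
    finally show ?case .
  qed
  consider "\<sigma> = 1" | "\<sigma> = - 1" using \<sigma> by linarith
  then show "?b \<longlonglongrightarrow> 0"
  proof cases
    case 1
    have "(\<lambda>n::nat. M * exp (- (s * real n)) * (exp (real n) / \<bar>exp (real n) - t\<bar>) * (2 * \<theta>)) \<longlonglongrightarrow> 0"
      using s t by real_asymp
    then show ?thesis using 1 by simp
  next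
    case 2
    have e: "(\<lambda>n::nat. exp (- (s * real n))) \<longlonglongrightarrow> 0" "(\<lambda>n::nat. exp (- real n)) \<longlonglongrightarrow> 0"
      using s by real_asymp+
    have "(\<lambda>n::nat. M * exp (- (s * real n)) * (exp (- real n) / \<bar>exp (- real n) - t\<bar>) * (2 * \<theta>))
        \<longlonglongrightarrow> M * 0 * (0 / \<bar>0 - t\<bar>) * (2 * \<theta>)"
      by (intro tendsto_intros e) (use t in auto)
    then show ?thesis using 2 by simp
  qed
qed

lemma sector_Cauchy:
  "(LBINT r:{0<..}. ray_integrand f t (- \<theta>) r) - (LBINT r:{0<..}. ray_integrand f t \<theta> r) = 2 * pi * \<i> * f (complex_of_real t)"
proof (rule LIMSEQ_unique)
  let ?H = "\<lambda>\<alpha> n. integral {exp (- real n)..exp (real n)} (ray_integrand f t \<alpha>)"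
  let ?V = "\<lambda>\<sigma> a n. contour_integral (linepath (Complex (\<sigma> * real n) a) (Complex (\<sigma> * real n) (- a))) strip_integrand"
  have th: "\<bar>- \<theta>\<bar> = \<theta>" "\<bar>\<theta>\<bar> = \<theta>" using angles by auto
  have "(\<lambda>n. ?H (- \<theta>) n + (?V 1 (- \<theta>) n + (- ?H \<theta> n + ?V (- 1) \<theta> n)))
      \<longlonglongrightarrow> (LBINT r:{0<..}. ray_integrand f t (- \<theta>) r) + (0 + (- (LBINT r:{0<..}. ray_integrand f t \<theta> r) + 0))"
    by (intro tendsto_add tendsto_minus ray_integral_tendsto strip_vertical_tendsto th) auto
  then show "(\<lambda>n. ?H (- \<theta>) n + (?V 1 (- \<theta>) n + (- ?H \<theta> n + ?V (- 1) \<theta> n)))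
      \<longlonglongrightarrow> (LBINT r:{0<..}. ray_integrand f t (- \<theta>) r) - (LBINT r:{0<..}. ray_integrand f t \<theta> r)" by simp
  have "\<forall>\<^sub>F n in sequentially. ?H (- \<theta>) n + (?V 1 (- \<theta>) n + (- ?H \<theta> n + ?V (- 1) \<theta> n)) = 2 * pi * \<i> * f (complex_of_real t)"
    using eventually_gt_at_top[of "nat \<lceil>\<bar>ln t\<bar>\<rceil>"]
  proof eventually_elim
    case (elim n)
    then have n: "\<bar>ln t\<bar> < real n" by linarith
    note C = strip_Cauchy[OF n]
    have pts: "Complex (Re (Complex (real n) \<theta>)) (Im (Complex (- real n) (- \<theta>))) = Complex (real n) (- \<theta>)"
      "Complex (Re (Complex (- real n) (- \<theta>))) (Im (Complex (real n) \<theta>)) = Complex (- real n) \<theta>" by simp_all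
    let ?p1 = "linepath (Complex (- real n) (- \<theta>)) (Complex (real n) (- \<theta>))"
    let ?p2 = "linepath (Complex (real n) (- \<theta>)) (Complex (real n) \<theta>)"
    let ?p3 = "linepath (Complex (real n) \<theta>) (Complex (- real n) \<theta>)"
    let ?p4 = "linepath (Complex (- real n) \<theta>) (Complex (- real n) (- \<theta>))"
    have rp: "rectpath (Complex (- real n) (- \<theta>)) (Complex (real n) \<theta>) = ?p1 +++ ?p2 +++ ?p3 +++ ?p4"
      by (simp add: rectpath_def Let_def)
    have ci: "strip_integrand contour_integrable_on ?p1" "strip_integrand contour_integrable_on ?p2"
      "strip_integrand contour_integrable_on ?p3" "strip_integrand contour_integrable_on ?p4"
      using has_contour_integral_integrable[OF C] unfolding rp by (auto simp: contour_integrable_joinI)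
    have "2 * pi * \<i> * f (complex_of_real t) = contour_integral (?p1 +++ ?p2 +++ ?p3 +++ ?p4) strip_integrand"
      using contour_integral_unique[OF C] unfolding rp by simp
    also have "\<dots> = contour_integral ?p1 strip_integrand + (contour_integral ?p2 strip_integrand
        + (contour_integral ?p3 strip_integrand + contour_integral ?p4 strip_integrand))"
      using ci by simp
    also have "contour_integral ?p3 strip_integrand = - contour_integral (linepath (Complex (- real n) \<theta>) (Complex (real n) \<theta>)) strip_integrand"
      using contour_integral_reversepath[of ?p3 strip_integrand] by simp
    finally show ?case
      using strip_horizontal[OF th(1), of n] strip_horizontal[OF th(2), of n] by simp
  qed
  then show "(\<lambda>n. ?H (- \<theta>) n + (?V 1 (- \<theta>) n + (- ?H \<theta> n + ?V (- 1) \<theta> n))) \<longlonglongrightarrow> 2 * pi * \<i> * f (complex_of_real t)"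
    by (rule tendsto_eventually)
qed

end

end

section \<open>Improper integrals of Banach space valued functions\<close>

text \<open>
  The Riemann sums of \<open>f - h\<close> are dominated by those of \<open>g\<close>, so the Cauchy criterion for \<open>h\<close> passes
  to \<open>f\<close>. The values of \<open>f\<close> may lie in any Banach space.
\<close>
lemma integrable_on_dominated_approx:
  fixes f :: "real \<Rightarrow> 'b::banach"
  assumes approx: "\<And>e. e > 0 \<Longrightarrow> \<exists>h g. h integrable_on cbox a b \<and> (g :: real \<Rightarrow> real) integrable_on cbox a b \<and>
      (\<forall>x\<in>cbox a b. norm (f x - h x) \<le> g x) \<and> integral (cbox a b) g \<le> e"
  shows "f integrable_on cbox a b"
  unfolding integrable_Cauchy
proof (intro allI impI)
  fix e :: real assume e: "e > 0"
  obtain h g where h: "h integrable_on cbox a b" and g: "(g :: real \<Rightarrow> real) integrable_on cbox a b"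
    and le: "\<And>x. x \<in> cbox a b \<Longrightarrow> norm (f x - h x) \<le> g x" and small: "integral (cbox a b) g \<le> e / 6"
    using approx[of "e / 6"] e by (auto simp del: cbox_interval)
  have e6: "e / 6 > 0" using e by simp
  obtain \<gamma>1 where \<gamma>1: "gauge \<gamma>1" "\<And>D. D tagged_division_of cbox a b \<Longrightarrow> \<gamma>1 fine D \<Longrightarrow>
      norm ((\<Sum>(x,K)\<in>D. measure lborel K *\<^sub>R h x) - integral (cbox a b) h) < e / 6"
    by (rule has_integralD[OF integrable_integral[OF h] e6]) (rule that; assumption)
  obtain \<gamma>2 where \<gamma>2: "gauge \<gamma>2" "\<And>D. D tagged_division_of cbox a b \<Longrightarrow> \<gamma>2 fine D \<Longrightarrow>
      norm ((\<Sum>(x,K)\<in>D. measure lborel K *\<^sub>R g x) - integral (cbox a b) g) < e / 6"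
    by (rule has_integralD[OF integrable_integral[OF g] e6]) (rule that; assumption)
  have close: "norm ((\<Sum>(x,K)\<in>D. measure lborel K *\<^sub>R f x) - integral (cbox a b) h) < e / 2"
    if D: "D tagged_division_of cbox a b" and fine: "\<gamma>1 fine D" "\<gamma>2 fine D" for D
  proof -
    have "norm ((\<Sum>(x,K)\<in>D. measure lborel K *\<^sub>R f x) - (\<Sum>(x,K)\<in>D. measure lborel K *\<^sub>R h x))
        = norm (\<Sum>(x,K)\<in>D. measure lborel K *\<^sub>R (f x - h x))"
      by (simp add: sum_subtractf[symmetric] split_def scaleR_diff_right)
    also have "\<dots> \<le> (\<Sum>(x,K)\<in>D. measure lborel K *\<^sub>R g x)"
    proof (rule order_trans[OF norm_sum sum_mono])
      fix p assume p: "p \<in> D"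
      obtain x K where xK: "p = (x, K)" by (cases p)
      have "x \<in> cbox a b" using tagged_division_ofD(2,3)[OF D] p xK by blast
      then show "norm (case p of (x, K) \<Rightarrow> measure lborel K *\<^sub>R (f x - h x)) \<le> (case p of (x, K) \<Rightarrow> measure lborel K *\<^sub>R g x)"
        using le[of x] by (simp add: xK mult_left_mono del: cbox_interval)
    qed
    also have "\<dots> < e / 6 + e / 6" using \<gamma>2(2)[OF D fine(2)] small unfolding real_norm_def by linarith
    finally have 1: "norm ((\<Sum>(x,K)\<in>D. measure lborel K *\<^sub>R f x) - (\<Sum>(x,K)\<in>D. measure lborel K *\<^sub>R h x)) < e / 6 + e / 6" .
    have "norm ((\<Sum>(x,K)\<in>D. measure lborel K *\<^sub>R f x) - integral (cbox a b) h) < (e / 6 + e / 6) + e / 6"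
      by (rule norm_diff_triangle_less[OF 1 \<gamma>1(2)[OF D fine(1)]])
    then show ?thesis by simp
  qed
  show "\<exists>\<gamma>. gauge \<gamma> \<and> (\<forall>D1 D2. D1 tagged_division_of cbox a b \<and> \<gamma> fine D1 \<and>
      D2 tagged_division_of cbox a b \<and> \<gamma> fine D2 \<longrightarrow>
      norm ((\<Sum>(x,K)\<in>D1. measure lborel K *\<^sub>R f x) - (\<Sum>(x,K)\<in>D2. measure lborel K *\<^sub>R f x)) < e)"
  proof (intro exI[of _ "\<lambda>x. \<gamma>1 x \<inter> \<gamma>2 x"] conjI allI impI)
    show "gauge (\<lambda>x. \<gamma>1 x \<inter> \<gamma>2 x)" using \<gamma>1(1) \<gamma>2(1) by (rule gauge_Int)
    fix D1 D2
    assume D: "D1 tagged_division_of cbox a b \<and> (\<lambda>x. \<gamma>1 x \<inter> \<gamma>2 x) fine D1 \<and>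
      D2 tagged_division_of cbox a b \<and> (\<lambda>x. \<gamma>1 x \<inter> \<gamma>2 x) fine D2"
    then have "norm ((\<Sum>(x,K)\<in>D1. measure lborel K *\<^sub>R f x) - integral (cbox a b) h) < e / 2"
      "norm (integral (cbox a b) h - (\<Sum>(x,K)\<in>D2. measure lborel K *\<^sub>R f x)) < e / 2"
      using close by (auto simp: fine_Int norm_minus_commute)
    from norm_diff_triangle_less[OF this]
    show "norm ((\<Sum>(x,K)\<in>D1. measure lborel K *\<^sub>R f x) - (\<Sum>(x,K)\<in>D2. measure lborel K *\<^sub>R f x)) < e" by simp
  qed
qed

text \<open>
  Near \<open>0\<close>, where \<open>F\<close> may be unbounded, \<open>F\<close> is approximated by its restriction to \<open>[\<delta>,\<infinity>)\<close>; the integral of \<open>W\<close>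
  controls both the error at \<open>0\<close> and the tails.
\<close>
lemma integrable_on_halfline_dominated:
  fixes F :: "real \<Rightarrow> 'b::banach" and W :: "real \<Rightarrow> real"
  assumes F: "continuous_on {0<..} F" and W: "W integrable_on {0<..}" and le: "\<And>r. r > 0 \<Longrightarrow> norm (F r) \<le> W r"
  shows "F integrable_on {0<..}"
proof -
  define F0 where "F0 x = (if x \<in> {0<..} then F x else 0)" for x
  define W0 where "W0 x = (if x \<in> {0<..} then W x else 0)" for x
  have W0: "W0 x \<ge> 0" "norm (F0 x) \<le> W0 x" for x
    using le[of x] order_trans[OF norm_ge_zero le[of x]] by (auto simp: W0_def F0_def)
  have intW: "W0 integrable_on cbox a b" for a b
    using W unfolding integrable_alt[of W] W0_def by blast
  have subW: "W0 integrable_on {c..d}" for c d using intW[of c d] by simp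
  have intF: "F0 integrable_on cbox a b" for a b
  proof (rule integrable_on_dominated_approx)
    fix e :: real assume e: "e > 0"
    define c where "c = max b 1"
    have c: "c \<ge> 1" "b \<le> c" by (auto simp: c_def)
    have "continuous_on {0..c} (\<lambda>x. integral {0..x} W0)" by (rule indefinite_integral_continuous_1[OF subW])
    from bspec[OF this[unfolded continuous_on_def], of 0]
    have "((\<lambda>x. integral {0..x} W0) \<longlongrightarrow> 0) (at 0 within {0..c})" using c by simp
    then have "\<forall>\<^sub>F x in at 0 within {0..c}. integral {0..x} W0 < e" using e by (rule order_tendstoD(2))
    then obtain d0 where d0: "d0 > 0" "\<And>x. x \<in> {0..c} \<Longrightarrow> x \<noteq> 0 \<Longrightarrow> dist x 0 < d0 \<Longrightarrow> integral {0..x} W0 < e"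
      unfolding eventually_at by blast
    define \<delta> where "\<delta> = min (d0 / 2) 1"
    have \<delta>: "\<delta> > 0" "integral {0..\<delta>} W0 < e" using d0 c by (auto simp: \<delta>_def intro!: d0(2))
    define h where "h x = (if x \<in> {\<delta>..} then F x else 0)" for x
    define g where "g x = (if x \<in> {0..\<delta>} then W0 x else 0)" for x
    have "F integrable_on {max \<delta> a..b}"
      by (rule integrable_continuous_real, rule continuous_on_subset[OF F]) (use \<delta> in auto)
    moreover have "{\<delta>..} \<inter> cbox a b = {max \<delta> a..b}" by auto
    ultimately have h: "h integrable_on cbox a b" unfolding h_def integrable_restrict_Int by simp
    have gU: "g integrable_on UNIV" unfolding g_def integrable_restrict_UNIV by (rule subW)
    have "{0..\<delta>} \<inter> cbox a b = {max 0 a..min \<delta> b}" by auto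
    then have g: "g integrable_on cbox a b" unfolding g_def integrable_restrict_Int using subW by simp
    have "integral (cbox a b) g \<le> integral UNIV g"
      by (rule integral_subset_le[OF _ g gU]) (auto simp: g_def W0)
    also have "\<dots> = integral {0..\<delta>} W0" unfolding g_def by (rule integral_restrict_UNIV)
    finally have "integral (cbox a b) g \<le> e" using \<delta> by simp
    moreover have "norm (F0 x - h x) \<le> g x" for x
      using W0[of x] \<delta>(1) by (auto simp: F0_def h_def g_def)
    ultimately show "\<exists>h g. h integrable_on cbox a b \<and> (g :: real \<Rightarrow> real) integrable_on cbox a b \<and>
      (\<forall>x\<in>cbox a b. norm (F0 x - h x) \<le> g x) \<and> integral (cbox a b) g \<le> e" using h g by blast
  qed
  have subF: "F0 integrable_on {c..d}" for c d using intF[of c d] by simp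
  have cut: "integral {a..b} G = integral {0..b} G" if "a \<le> 0" "0 \<le> b" "\<And>x. x \<le> 0 \<Longrightarrow> G x = 0" "G integrable_on {a..b}"
    for a b and G :: "real \<Rightarrow> 'c::banach"
  proof -
    have "integral {a..0} G + integral {0..b} G = integral {a..b} G"
      by (rule Henstock_Kurzweil_Integration.integral_combine) (use that in auto)
    moreover have "integral {a..0} G = integral {a..0} (\<lambda>x. 0)" by (rule integral_cong) (use that in auto)
    ultimately show ?thesis by simp
  qed
  show ?thesis
    unfolding integrable_alt[of F] F0_def[symmetric]
  proof (intro conjI allI impI intF)
    fix e :: real assume e: "e > 0"
    have alt: "\<forall>e>0. \<exists>B>0. \<forall>a b c d. ball 0 B \<subseteq> cbox a b \<and> ball 0 B \<subseteq> cbox c d \<longrightarrow>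
        norm (integral (cbox a b) W0 - integral (cbox c d) W0) < e"
      using W unfolding integrable_alt[of W] W0_def[symmetric] by (rule conjunct2)
    obtain B where B: "B > 0" and all: "\<forall>a b c d. ball 0 B \<subseteq> cbox a b \<and> ball 0 B \<subseteq> cbox c d \<longrightarrow>
        norm (integral (cbox a b) W0 - integral (cbox c d) W0) < e"
      using mp[OF spec[OF alt, of e] e] by (elim exE conjE) (rule that; assumption)
    have box: "a \<le> - B \<and> B \<le> b" if "ball 0 B \<subseteq> cbox a b" for a b :: real
    proof -
      have "cball 0 B \<subseteq> cbox a b"
        using closure_minimal[OF that closed_cbox] B by (simp add: closure_ball)
      then have "B \<in> cbox a b" "- B \<in> cbox a b" using B by (auto simp: subset_iff)
      then show ?thesis by simp
    qed
    have half: "norm (integral {a..b} F0 - integral {c..d} F0) < e"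
      if ab: "ball 0 B \<subseteq> cbox a b" and cd: "ball 0 B \<subseteq> cbox c d" and bd: "b \<le> d" for a b c d
    proof -
      note ab' = box[OF ab] and cd' = box[OF cd]
      have cb: "ball 0 B \<subseteq> cbox c b" using ab' cd' by (auto simp: dist_real_def)
      have "integral {a..b} F0 = integral {0..b} F0" "integral {c..d} F0 = integral {0..d} F0"
        using ab' cd' B by (auto intro!: cut subF simp: F0_def)
      moreover have "integral {0..b} F0 + integral {b..d} F0 = integral {0..d} F0"
        by (rule Henstock_Kurzweil_Integration.integral_combine) (use ab' B bd subF in auto)
      ultimately have "norm (integral {a..b} F0 - integral {c..d} F0) = norm (integral {b..d} F0)"
        by (metis add_diff_cancel_left' norm_minus_commute)
      also have "\<dots> \<le> integral {b..d} W0" by (rule integral_norm_bound_integral[OF subF subW]) (rule W0)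
      also have "integral {c..b} W0 + integral {b..d} W0 = integral {c..d} W0"
        by (rule Henstock_Kurzweil_Integration.integral_combine) (use ab' cd' B bd subW in auto)
      then have "integral {b..d} W0 = integral {c..d} W0 - integral {c..b} W0" by simp
      also have "\<dots> < e" using mp[OF spec[OF spec[OF spec[OF spec[OF all]]]] conjI[OF cd cb]] by (simp add: abs_less_iff)
      finally show ?thesis .
    qed
    show "\<exists>B>0. \<forall>a b c d. ball 0 B \<subseteq> cbox a b \<and> ball 0 B \<subseteq> cbox c d \<longrightarrow>
        norm (integral (cbox a b) F0 - integral (cbox c d) F0) < e"
    proof (intro exI[of _ B] conjI B allI impI)
      fix a b c d :: real assume box2: "ball 0 B \<subseteq> cbox a b \<and> ball 0 B \<subseteq> cbox c d"
      show "norm (integral (cbox a b) F0 - integral (cbox c d) F0) < e"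
      proof (cases "b \<le> d")
        case True then show ?thesis using half box2 by simp
      next
        case False then show ?thesis using half[of c d a b] box2 by (simp add: norm_minus_commute)
      qed
    qed
  qed
qed

lemma bounded_bilinear_scaleC: "bounded_bilinear (\<lambda>c (x::'b::complex_banach). c *\<^sub>C x)"
proof
  fix r :: real and c :: complex and x y :: 'b
  show "(r *\<^sub>R c) *\<^sub>C x = r *\<^sub>R c *\<^sub>C x" by (simp add: scaleR_scaleC scaleC_scaleC scaleC_complex_def)
  show "c *\<^sub>C r *\<^sub>R x = r *\<^sub>R c *\<^sub>C x" by (simp add: scaleR_scaleC scaleC_scaleC mult.commute)
  show "\<exists>K. \<forall>c (x::'b). norm (c *\<^sub>C x) \<le> norm c * norm x * K"
    by (intro exI[of _ 1]) (simp add: norm_scaleC)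
qed (simp_all add: scaleC_algebra)

section \<open>The two calculi agree\<close>

lemma cosine_kernel_ray_scale:
  assumes g: "cosine_kernel g (resolvent_fun (cis \<alpha>))" and r: "r > 0"
  shows "cosine_kernel (\<lambda>s. g (r * s)) (resolvent_fun (complex_of_real r * cis \<alpha>))"
proof -
  have "(\<lambda>s. 1 / complex_of_real r * (complex_of_real r * g (r * s))) = (\<lambda>s. g (r * s))"
    using r by simp
  moreover have "(\<lambda>t. 1 / complex_of_real r * resolvent_fun (cis \<alpha>) (t / r)) = resolvent_fun (complex_of_real r * cis \<alpha>)"
  proof
    fix t
    have "complex_of_real r * cis \<alpha> - complex_of_real \<bar>t\<bar> = complex_of_real r * (cis \<alpha> - complex_of_real \<bar>t / r\<bar>)"
      using r by (simp add: right_diff_distrib)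
    then show "1 / complex_of_real r * resolvent_fun (cis \<alpha>) (t / r) = resolvent_fun (complex_of_real r * cis \<alpha>) t"
      unfolding resolvent_fun_def by simp
  qed
  ultimately show ?thesis using cosine_kernel_cmult[OF cosine_kernel_scale[OF g r], of "1 / complex_of_real r"] by simp
qed

text \<open>
  If \<open>g\<close> is the kernel of \<open>1/(cis \<alpha> - |t|)\<close>, this is the density of the part of the Cauchy integral of
  \<open>f\<close> that belongs to the ray with angle \<open>\<alpha>\<close>.
\<close>
definition superpose :: "(complex \<Rightarrow> complex) \<Rightarrow> real \<Rightarrow> (real \<Rightarrow> complex) \<Rightarrow> real \<Rightarrow> complex"
  where "superpose f \<alpha> g s = (LBINT r:{0<..}. cis \<alpha> * f (complex_of_real r * cis \<alpha>) * g (r * s))"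

context sector_function
begin

context
  fixes \<alpha> :: real and g :: "real \<Rightarrow> complex"
  assumes \<alpha>: "\<bar>\<alpha>\<bar> = \<theta>" and ker: "cosine_kernel g (resolvent_fun (cis \<alpha>))"
begin

text \<open>
  The norm of \<open>s \<mapsto> g(rs)\<close> is \<open>\<parallel>g\<parallel>/r\<close>, and \<open>|f(r cis \<alpha>)|/r\<close> is integrable.
\<close>
lemma superpose_integrable:
  "integrable (lborel \<Otimes>\<^sub>M lborel) (\<lambda>(r, s). indicat_real {0<..} r *\<^sub>R (cis \<alpha> * f (complex_of_real r * cis \<alpha>)) * g (r * s))"
proof (rule lborel_pair.Fubini_integrable)
  have [measurable]: "(\<lambda>r. indicat_real {0<..} r *\<^sub>R (cis \<alpha> * f (complex_of_real r * cis \<alpha>))) \<in> borel_measurable borel"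
    by (intro borel_measurable_continuous_on_indicator continuous_intros continuous_on_f_ray[OF \<alpha>]) simp
  have gi: "integrable lborel g" by (rule cosine_kernelD(1)[OF ker])
  then have [measurable]: "g \<in> borel_measurable borel" by auto
  show "(\<lambda>(r, s). indicat_real {0<..} r *\<^sub>R (cis \<alpha> * f (complex_of_real r * cis \<alpha>)) * g (r * s)) \<in> borel_measurable (lborel \<Otimes>\<^sub>M lborel)"
    by measurable
  have sc: "integrable lborel (\<lambda>s. g (r * s))" if "r > 0" for r
    using lborel_integrable_real_affine[OF gi, of r 0] that by simp
  show "AE r in lborel. integrable lborel (\<lambda>s. case (r, s) of (r, s) \<Rightarrow> indicat_real {0<..} r *\<^sub>R (cis \<alpha> * f (complex_of_real r * cis \<alpha>)) * g (r * s))"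
  proof (intro AE_I2)
    fix r :: real
    show "integrable lborel (\<lambda>s. case (r, s) of (r, s) \<Rightarrow> indicat_real {0<..} r *\<^sub>R (cis \<alpha> * f (complex_of_real r * cis \<alpha>)) * g (r * s))"
      using sc[of r] by (cases "r > 0") auto
  qed
  define L where "L = (\<integral>s. cmod (g s) \<partial>lborel)"
  have eq: "(\<integral>s. norm (case (r, s) of (r, s) \<Rightarrow> indicat_real {0<..} r *\<^sub>R (cis \<alpha> * f (complex_of_real r * cis \<alpha>)) * g (r * s)) \<partial>lborel)
      = indicat_real {0<..} r * (cmod (f (complex_of_real r * cis \<alpha>)) / r * L)" for r
  proof (cases "r > 0")
    case True
    have "L = r * (\<integral>s. cmod (g (r * s)) \<partial>lborel)"
      using lborel_integral_real_affine[of r "\<lambda>s. cmod (g s)" 0] True by (simp add: L_def)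
    then show ?thesis using True by (simp add: norm_mult)
  qed simp
  show "integrable lborel (\<lambda>r. \<integral>s. norm (case (r, s) of (r, s) \<Rightarrow> indicat_real {0<..} r *\<^sub>R (cis \<alpha> * f (complex_of_real r * cis \<alpha>)) * g (r * s)) \<partial>lborel)"
    unfolding eq
  proof (rule Bochner_Integration.integrable_bound)
    show "integrable lborel (\<lambda>r. indicat_real {0<..} r * (decay s r * (M * L)))"
      using integrable_mult_left[OF set_integrable_decay[OF s, unfolded set_integrable_def], of "M * L"]
      by (simp add: mult.assoc)
    have "(\<lambda>r. cmod (indicat_real {0<..} r *\<^sub>R (cis \<alpha> * f (complex_of_real r * cis \<alpha>))) / r * L) \<in> borel_measurable borel"
      by measurable
    then show "(\<lambda>r. indicat_real {0<..} r * (cmod (f (complex_of_real r * cis \<alpha>)) / r * L)) \<in> borel_measurable lborel"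
      by (simp add: norm_mult mult.assoc)
    have L0: "L \<ge> 0" by (simp add: L_def)
    show "AE r in lborel. norm (indicat_real {0<..} r * (cmod (f (complex_of_real r * cis \<alpha>)) / r * L))
        \<le> norm (indicat_real {0<..} r * (decay s r * (M * L)))"
    proof (intro AE_I2)
      fix r :: real
      show "norm (indicat_real {0<..} r * (cmod (f (complex_of_real r * cis \<alpha>)) / r * L))
        \<le> norm (indicat_real {0<..} r * (decay s r * (M * L)))"
      proof (cases "r > 0")
        case True
        have "cmod (f (complex_of_real r * cis \<alpha>)) / r * L \<le> M * decay s r * L"
          by (rule mult_right_mono[OF norm_f_ray_le[OF \<alpha> True] L0])
        then show ?thesis using True L0 M decay_nonneg[of s r] by (simp add: abs_mult mult_ac)
      qed simp
    qed
  qed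
qed

lemma integrable_superpose: "integrable lborel (superpose f \<alpha> g)"
  using lborel_pair.integrable_snd[OF superpose_integrable]
  by (simp add: superpose_def[abs_def] set_lebesgue_integral_def)

lemma integral_superpose:
  assumes c: "c \<in> borel_measurable borel" "\<And>u. cmod (c u) \<le> K"
  shows "(\<integral>s. superpose f \<alpha> g s * c s \<partial>lborel)
      = (LBINT r:{0<..}. cis \<alpha> * f (complex_of_real r * cis \<alpha>) * (\<integral>s. g (r * s) * c s \<partial>lborel))"
    and "set_integrable lborel {0<..} (\<lambda>r. cis \<alpha> * f (complex_of_real r * cis \<alpha>) * (\<integral>s. g (r * s) * c s \<partial>lborel))"
proof -
  let ?F = "\<lambda>r s. indicat_real {0<..} r *\<^sub>R (cis \<alpha> * f (complex_of_real r * cis \<alpha>)) * g (r * s)"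
  have "integrable (lborel \<Otimes>\<^sub>M lborel) (\<lambda>p. (case p of (r, s) \<Rightarrow> ?F r s) * c (snd p))"
    by (rule integrable_mult_bounded[OF superpose_integrable _ c(2)]) (use c(1) in measurable)
  then have int: "integrable (lborel \<Otimes>\<^sub>M lborel) (\<lambda>(r, s). ?F r s * c s)" by (simp add: split_def)
  have inner: "(\<integral>s. ?F r s * c s \<partial>lborel) = indicat_real {0<..} r *\<^sub>R (cis \<alpha> * f (complex_of_real r * cis \<alpha>) * (\<integral>s. g (r * s) * c s \<partial>lborel))" for r
    by (simp add: mult.assoc)
  have sup: "superpose f \<alpha> g s = (\<integral>r. ?F r s \<partial>lborel)" for s
    by (simp add: superpose_def set_lebesgue_integral_def)
  have "(\<integral>s. superpose f \<alpha> g s * c s \<partial>lborel) = (\<integral>s. (\<integral>r. ?F r s * c s \<partial>lborel) \<partial>lborel)"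
    unfolding sup integral_mult_left_zero ..
  also have "\<dots> = (\<integral>r. (\<integral>s. ?F r s * c s \<partial>lborel) \<partial>lborel)"
    by (rule lborel_pair.Fubini_integral[OF int])
  finally show "(\<integral>s. superpose f \<alpha> g s * c s \<partial>lborel)
      = (LBINT r:{0<..}. cis \<alpha> * f (complex_of_real r * cis \<alpha>) * (\<integral>s. g (r * s) * c s \<partial>lborel))"
    unfolding inner set_lebesgue_integral_def .
  show "set_integrable lborel {0<..} (\<lambda>r. cis \<alpha> * f (complex_of_real r * cis \<alpha>) * (\<integral>s. g (r * s) * c s \<partial>lborel))"
    using lborel_pair.integrable_fst[OF int] unfolding inner set_integrable_def .
qed

lemma cosine_kernel_superpose:
  "cosine_kernel (superpose f \<alpha> g) (\<lambda>t. LBINT r:{0<..}. ray_integrand f \<bar>t\<bar> \<alpha> r)"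
  unfolding cosine_kernel_def
proof (intro conjI allI)
  show "integrable lborel (superpose f \<alpha> g)" by (rule integrable_superpose)
  show "superpose f \<alpha> g (- s) = superpose f \<alpha> g s" for s
    unfolding superpose_def using cosine_kernelD(2)[OF ker] by simp
  fix t
  have "(\<integral>s. superpose f \<alpha> g s * complex_of_real (cos (s * t)) \<partial>lborel)
      = (LBINT r:{0<..}. cis \<alpha> * f (complex_of_real r * cis \<alpha>) * (\<integral>s. g (r * s) * complex_of_real (cos (s * t)) \<partial>lborel))"
    by (rule integral_superpose(1)[where K = 1]) (auto simp: norm_of_real)
  also have "\<dots> = (LBINT r:{0<..}. ray_integrand f \<bar>t\<bar> \<alpha> r)"
    by (rule set_lebesgue_integral_cong)
      (auto simp: cosine_kernelD(3)[OF cosine_kernel_ray_scale[OF ker]] resolvent_fun_def ray_integrand_def)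
  finally show "(\<integral>s. superpose f \<alpha> g s * complex_of_real (cos (s * t)) \<partial>lborel) = (LBINT r:{0<..}. ray_integrand f \<bar>t\<bar> \<alpha> r)" .
qed

end

end

lemma cosine_kernel_isCont:
  assumes g: "cosine_kernel g F" and X: "X \<longlonglongrightarrow> t"
  shows "(\<lambda>n. F (X n)) \<longlonglongrightarrow> F t"
proof -
  have [measurable]: "g \<in> borel_measurable borel" using cosine_kernelD(1)[OF g] by auto
  have "(\<lambda>n. \<integral>s. g s * complex_of_real (cos (s * X n)) \<partial>lborel) \<longlonglongrightarrow> (\<integral>s. g s * complex_of_real (cos (s * t)) \<partial>lborel)"
  proof (rule integral_dominated_convergence[where w = "\<lambda>s. cmod (g s)"])
    show "integrable lborel (\<lambda>s. cmod (g s))" using cosine_kernelD(1)[OF g] by simp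
    show "AE s in lborel. (\<lambda>n. g s * complex_of_real (cos (s * X n))) \<longlonglongrightarrow> g s * complex_of_real (cos (s * t))"
      by (intro AE_I2 tendsto_intros X)
    show "AE s in lborel. norm (g s * complex_of_real (cos (s * X n))) \<le> cmod (g s)" for n
      by (intro AE_I2) (simp add: norm_mult mult_left_le)
  qed simp_all
  then show ?thesis unfolding cosine_kernelD(3)[OF g] .
qed

context sector_function
begin

text \<open>
  For \<open>t \<noteq> 0\<close> this is Cauchy's formula. At \<open>t = 0\<close> both sides are continuous from the right, and the value
  \<open>0\<close> of \<open>restrict_Rplus f\<close> is the limit of \<open>f\<close>.
\<close>
lemma cosine_kernel_restrict:
  assumes g: "cosine_kernel g (resolvent_fun (cis (- \<theta>)))" and h: "cosine_kernel h (resolvent_fun (cis \<theta>))"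
  shows "cosine_kernel (\<lambda>s. 1 / (2 * complex_of_real pi * \<i>) * (superpose f (- \<theta>) g s + - 1 * superpose f \<theta> h s)) (restrict_Rplus f)"
proof -
  define c where "c = 1 / (2 * complex_of_real pi * \<i>)"
  have th: "\<bar>- \<theta>\<bar> = \<theta>" "\<bar>\<theta>\<bar> = \<theta>" using angles by auto
  define F where "F t = c * ((LBINT r:{0<..}. ray_integrand f \<bar>t\<bar> (- \<theta>) r) + - 1 * (LBINT r:{0<..}. ray_integrand f \<bar>t\<bar> \<theta> r))" for t
  have ker: "cosine_kernel (\<lambda>s. c * (superpose f (- \<theta>) g s + - 1 * superpose f \<theta> h s)) F"
    unfolding F_def
    by (intro cosine_kernel_cmult cosine_kernel_add cosine_kernel_superpose th g h)
  have F: "F t = f (complex_of_real \<bar>t\<bar>)" if "t \<noteq> 0" for t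
    using sector_Cauchy[of "\<bar>t\<bar>"] that by (simp add: F_def c_def)
  have "F 0 = 0"
  proof (rule LIMSEQ_unique)
    have "(\<lambda>n. 1 / real (Suc n)) \<longlonglongrightarrow> 0" using LIMSEQ_Suc[OF lim_1_over_n] by simp
    then show "(\<lambda>n. F (1 / real (Suc n))) \<longlonglongrightarrow> F 0" by (rule cosine_kernel_isCont[OF ker])
    show "(\<lambda>n. F (1 / real (Suc n))) \<longlonglongrightarrow> 0"
    proof (rule Lim_null_comparison)
      show "\<forall>\<^sub>F n in sequentially. norm (F (1 / real (Suc n))) \<le> M * (1 / real (Suc n)) powr s"
      proof (intro always_eventually allI)
        fix n
        have x: "(1 / real (Suc n)) > 0" by simp
        have "complex_of_real (1 / real (Suc n)) \<in> sector \<phi>"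
          using ray_in_sector[OF _ angles(3) x, of 0] angles by simp
        then have "cmod (f (complex_of_real (1 / real (Suc n)))) \<le> M * min ((1 / real (Suc n)) powr s) ((1 / real (Suc n)) powr (- s))"
          using bound x by (metis abs_of_pos norm_of_real)
        also have "\<dots> \<le> M * (1 / real (Suc n)) powr s" using M by (intro mult_left_mono) auto
        finally show "norm (F (1 / real (Suc n))) \<le> M * (1 / real (Suc n)) powr s"
          using F[of "1 / real (Suc n)"] x by simp
      qed
      show "(\<lambda>n. M * (1 / real (Suc n)) powr s) \<longlonglongrightarrow> 0" using s by real_asymp
    qed
  qed
  then have "F = restrict_Rplus f" using F by (auto simp: restrict_Rplus_def fun_eq_iff)
  then show ?thesis using ker unfolding c_def by simp
qed

end

lemma cis_slit_plane:
  assumes "0 < \<theta>" "\<theta> < pi" "\<bar>\<alpha>\<bar> = \<theta>" "r > 0"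
  shows "Im (complex_of_real r * cis \<alpha>) \<noteq> 0" "complex_of_real r * cis \<alpha> \<in> slit_plane" "Im (cis \<alpha>) \<noteq> 0"
proof -
  have "sin \<theta> > 0" using assms by (intro sin_gt_zero) auto
  then have "sin \<alpha> \<noteq> 0" using assms by (cases "\<alpha> \<ge> 0") (auto simp: abs_if split: if_splits)
  then show "Im (complex_of_real r * cis \<alpha>) \<noteq> 0" "Im (cis \<alpha>) \<noteq> 0" using assms by auto
  then show "complex_of_real r * cis \<alpha> \<in> slit_plane" by (simp add: slit_plane_def)
qed

locale calculus_comparison = bounded_cosine Cos K + sector_function f \<phi> \<theta> M s
  for Cos :: "real \<Rightarrow> 'a::complex_banach \<Rightarrow>\<^sub>L 'a" and K f \<phi> \<theta> M s
begin

definition ray_operator :: "real \<Rightarrow> real \<Rightarrow> 'a \<Rightarrow>\<^sub>L 'a"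
  where "ray_operator \<alpha> r = cis \<alpha> *\<^sub>C f (complex_of_real r * cis \<alpha>) *\<^sub>C R (complex_of_real r * cis \<alpha>)"

lemma ray_operator_integrable:
  assumes \<alpha>: "\<bar>\<alpha>\<bar> = \<theta>"
  shows "ray_operator \<alpha> integrable_on {0<..}"
proof -
  have th: "0 < \<theta>" "\<theta> < pi" using angles by auto
  note slit = cis_slit_plane[OF th \<alpha>]
  obtain J where J: "\<And>z. Im z \<noteq> 0 \<Longrightarrow> cmod z * norm (R z) \<le> J * (cmod z / \<bar>Im z\<bar>) + J" "J \<ge> 0"
    by (rule norm_R_le) (rule that; blast)
  define L where "L = J / sin \<theta> + J"
  have L: "r * norm (R (complex_of_real r * cis \<alpha>)) \<le> L" if r: "r > 0" for r
    using J(1)[OF slit(1)[OF r]] r abs_sin_\<alpha>[OF \<alpha>] by (simp add: norm_mult abs_mult L_def)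
  show ?thesis
  proof (rule integrable_on_halfline_dominated)
    have "continuous_on {0<..} (\<lambda>r. R (complex_of_real r * cis \<alpha>))"
      by (rule continuous_on_compose2[OF pseudo_resolvent_continuous[OF R_pseudo_resolvent]])
        (auto intro!: continuous_intros slit)
    then show "continuous_on {0<..} (ray_operator \<alpha>)"
      unfolding ray_operator_def[abs_def]
      by (intro bounded_bilinear.continuous_on[OF bounded_bilinear_scaleC] continuous_intros continuous_on_f_ray[OF \<alpha>])
    show "(\<lambda>r. M * L * decay s r) integrable_on {0<..}"
      using set_borel_integral_eq_integral(1)[OF set_integrable_decay[OF s]] by (rule integrable_on_mult_right)
    fix r :: real assume r: "r > 0"
    have "norm (ray_operator \<alpha> r) = (cmod (f (complex_of_real r * cis \<alpha>)) / r) * (r * norm (R (complex_of_real r * cis \<alpha>)))"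
      using r by (simp add: ray_operator_def norm_scaleC)
    also have "\<dots> \<le> (M * decay s r) * L"
      using M decay_nonneg[of s r] by (intro mult_mono norm_f_ray_le[OF \<alpha> r] L[OF r]) (use r in auto)
    finally show "norm (ray_operator \<alpha> r) \<le> M * L * decay s r" by (simp add: mult_ac)
  qed
qed

text \<open>
  Functionals commute with the operator-valued integral, and the scalar integrals are exchanged by
  Fubini's theorem in \<open>integral_superpose\<close>.
\<close>
lemma ray_operator_integral:
  assumes \<alpha>: "\<bar>\<alpha>\<bar> = \<theta>" and ker: "cosine_kernel g (resolvent_fun (cis \<alpha>))" and \<psi>: "cfunctional \<psi>"
  shows "\<psi> (blinfun_apply (integral {0<..} (ray_operator \<alpha>)) x)
    = (\<integral>s. superpose f \<alpha> g s * \<psi> (blinfun_apply (Cos s) x) \<partial>lborel)"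
proof -
  have th: "0 < \<theta>" "\<theta> < pi" using angles by auto
  obtain B where B: "\<And>s. cmod (\<psi> (blinfun_apply (Cos s) x)) \<le> B" using cfunctional_Cos_bound[OF \<psi>] by blast
  note c = cfunctional_Cos_measurable[OF \<psi>, of x] B
  have bl: "bounded_linear (\<lambda>T. \<psi> (blinfun_apply T x))"
    by (rule bounded_linear_compose[OF cfunctional_bounded_linear[OF \<psi>] blinfun.bounded_linear_left])
  have eq: "\<psi> (blinfun_apply (ray_operator \<alpha> r) x)
      = cis \<alpha> * f (complex_of_real r * cis \<alpha>) * (\<integral>s. g (r * s) * \<psi> (blinfun_apply (Cos s) x) \<partial>lborel)" if "r > 0" for r
    using cfunctional_Phi[OF cosine_kernel_ray_scale[OF ker that] \<psi>, of x]
    by (simp add: ray_operator_def blinfun_apply_scaleC cfunctional_scaleC[OF \<psi>])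
  have "\<psi> (blinfun_apply (integral {0<..} (ray_operator \<alpha>)) x) = integral {0<..} (\<lambda>r. \<psi> (blinfun_apply (ray_operator \<alpha> r) x))"
    using integral_linear[OF ray_operator_integrable[OF \<alpha>] bl] by (simp add: comp_def)
  also have "\<dots> = integral {0<..} (\<lambda>r. cis \<alpha> * f (complex_of_real r * cis \<alpha>) * (\<integral>s. g (r * s) * \<psi> (blinfun_apply (Cos s) x) \<partial>lborel))"
    by (rule integral_cong) (simp only: greaterThan_iff eq)
  also have "\<dots> = (LBINT r:{0<..}. cis \<alpha> * f (complex_of_real r * cis \<alpha>) * (\<integral>s. g (r * s) * \<psi> (blinfun_apply (Cos s) x) \<partial>lborel))"
    by (rule set_borel_integral_eq_integral(2)[OF integral_superpose(2)[OF \<alpha> ker c], symmetric])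
  also have "\<dots> = (\<integral>s. superpose f \<alpha> g s * \<psi> (blinfun_apply (Cos s) x) \<partial>lborel)"
    by (rule integral_superpose(1)[OF \<alpha> ker c, symmetric])
  finally show ?thesis .
qed

lemma calculi_agree:
  assumes gen: "generates_cosine (neg_op A) Cos" and A: "linear_operator A"
  shows "restrict_Rplus f \<in> E_space" "Phi Cos (restrict_Rplus f) = Psi A \<theta> f"
proof -
  have th: "0 < \<theta>" "\<theta> < pi" "\<bar>- \<theta>\<bar> = \<theta>" "\<bar>\<theta>\<bar> = \<theta>" using angles by auto
  have "cis (- \<theta>) \<in> slit_plane" "cis \<theta> \<in> slit_plane"
    using cis_slit_plane(3)[OF th(1,2,3), of 1] cis_slit_plane(3)[OF th(1,2,4), of 1] by (auto simp: slit_plane_def)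
  then obtain g h where g: "cosine_kernel g (resolvent_fun (cis (- \<theta>)))" and h: "cosine_kernel h (resolvent_fun (cis \<theta>))"
    using has_kernel_resolvent_fun unfolding has_kernel_def by blast
  note ker = cosine_kernel_restrict[OF g h]
  show "restrict_Rplus f \<in> E_space"
    unfolding E_space_def
    by (intro CollectI exI conjI, rule cosine_kernel_transform[OF ker, symmetric],
        rule complex_measure_density[OF cosine_kernelD(1)[OF ker]])
  have ray_eq: "integral {0<..} (\<lambda>r. cis \<alpha> *\<^sub>C f (complex_of_real r * cis \<alpha>) *\<^sub>C resolvent (complex_of_real r * cis \<alpha>) (sqrt_op A))
      = integral {0<..} (ray_operator \<alpha>)" if "\<bar>\<alpha>\<bar> = \<theta>" for \<alpha>
    by (rule integral_cong)
      (simp add: ray_operator_def sqrt_op_eq_square_root[OF gen A] square_root_resolvent(1) cis_slit_plane(2)[OF th(1,2) that])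
  have Psi: "Psi A \<theta> f = (1 / (2 * complex_of_real pi * \<i>)) *\<^sub>C (integral {0<..} (ray_operator (- \<theta>)) - integral {0<..} (ray_operator \<theta>))"
    unfolding Psi_def sector_boundary_integral_def ray_eq[OF th(3)] ray_eq[OF th(4)] ..
  show "Phi Cos (restrict_Rplus f) = Psi A \<theta> f"
  proof (rule blinfun_eqI, rule cfunctionals_separate_points)
    fix x and \<psi> :: "'a \<Rightarrow> complex" assume \<psi>: "cfunctional \<psi>"
    let ?c = "\<lambda>s. \<psi> (blinfun_apply (Cos s) x)" and ?k = "1 / (2 * complex_of_real pi * \<i>)"
    have i: "integrable lborel (\<lambda>s. superpose f (- \<theta>) g s * ?c s)" "integrable lborel (\<lambda>s. superpose f \<theta> h s * ?c s)"
      by (intro integrable_kernel_Cos[OF \<psi>] integrable_superpose th g h)+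
    have "\<psi> (blinfun_apply (Phi Cos (restrict_Rplus f)) x)
        = (\<integral>s. ?k * (superpose f (- \<theta>) g s + - 1 * superpose f \<theta> h s) * ?c s \<partial>lborel)"
      by (rule cfunctional_Phi[OF ker \<psi>])
    also have "\<dots> = (\<integral>s. ?k * (superpose f (- \<theta>) g s * ?c s - superpose f \<theta> h s * ?c s) \<partial>lborel)"
      by (intro Bochner_Integration.integral_cong refl) (simp add: algebra_simps)
    also have "\<dots> = ?k * ((\<integral>s. superpose f (- \<theta>) g s * ?c s \<partial>lborel) - (\<integral>s. superpose f \<theta> h s * ?c s \<partial>lborel))"
      unfolding integral_mult_right_zero Bochner_Integration.integral_diff[OF i] ..
    also have "\<dots> = \<psi> (blinfun_apply (Psi A \<theta> f) x)"
      unfolding Psi blinfun_apply_scaleC cfunctional_scaleC[OF \<psi>] blinfun.diff_left cfunctional_diff[OF \<psi>]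
        ray_operator_integral[OF th(3) g \<psi>] ray_operator_integral[OF th(4) h \<psi>] ..
    finally show "\<psi> (blinfun_apply (Phi Cos (restrict_Rplus f)) x) = \<psi> (blinfun_apply (Psi A \<theta> f) x)" .
  qed
qed

end

theorem proposition6p2:
  fixes A :: "'a::complex_banach operator"
    and Cos :: "real \<Rightarrow> 'a \<Rightarrow>\<^sub>L 'a"
    and f :: "complex \<Rightarrow> complex" and \<phi> :: real
  assumes "linear_operator A"
    and "cosine_function Cos" and "bounded (range Cos)"
    and "generates_cosine (neg_op A) Cos"
    and "0 < \<phi>" and "\<phi> < pi"
    and "f \<in> H_inf_0 \<phi>"
  shows "restrict_Rplus f \<in> E_space
    \<and> (\<forall>\<phi>'. 0 < \<phi>' \<and> \<phi>' < \<phi> \<longrightarrow> Phi Cos (restrict_Rplus f) = Psi A \<phi>' f)"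
proof -
  obtain K where K: "\<And>t. norm (Cos t) \<le> K"
    using assms(3) unfolding bounded_iff by blast
  obtain M s where f: "f holomorphic_on sector \<phi>" "M > 0" "s > 0"
    "\<And>z. z \<in> sector \<phi> \<Longrightarrow> cmod (f z) \<le> M * min (cmod z powr s) (cmod z powr (- s))"
    using assms(7) unfolding H_inf_0_def by blast
  have cmp: "calculus_comparison Cos K f \<phi> \<theta> M s" if "0 < \<theta>" "\<theta> < \<phi>" for \<theta>
    by unfold_locales (use that assms f K in auto)
  show ?thesis
    using calculus_comparison.calculi_agree[OF cmp assms(4,1)] dense[OF assms(5)] by blast
qed

end
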